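(* Let $X$ be a locally compact metrisable space and let $\phi:X\to X$ be a continuous proper surjection. Let $X_r$ denote the set of recurrent points of $(X,\phi)$. Then the Jacobson radical of the analytic crossed product is $$\mathrm{Rad}\bigl(C_0(X)\times_\phi\mathbb{Z}_+\bigr)=\Bigl\{\sum_{n\ge 1}U^nf_n\in C_0(X)\times_\phi\mathbb{Z}_+ \;:\; f_n|_{X_r}=0\text{ for all }n\Bigr\},$$ that is, the Jacobson radical consists of exactly those elements $A$ of $C_0(X)\times_\phi\mathbb{Z}_+$ whose $0$-th Fourier coefficient $E_0(A)$ is zero and whose Fourier coefficients $E_n(A)$, $n\ge 1$, all vanish on $X_r$.
   Context: $\mathbb{Z}_+=\{0,1,2,\dots\}$. A point $x\in X$ is recurrent for $(X,\phi)$ if for every neighbourhood $V$ of $x$ there is $n\ge1$ with $\phi^n(x)\in V$. Analytic crossed product: write elements of the Banach space $\ell^1(\mathbb{Z}_+,C_0(X))$ as formal series $A=\sum_{n\ge0}U^nf_n$ with norm $\|A\|_1=\sum_n\|f_n\|_\infty$. Put $\alpha_n(f)=f\circ\phi^n$. The multiplication determined by $(U^nf)(U^mg)=U^{n+m}(\alpha_m(f)g)$, extended by linearity and continuity, makes it a Banach algebra. Let $C_0(X)$ be represented faithfully (by a $*$-representation) on a Hilbert space $H_o$, and define a faithful contractive representation $\pi$ of $\ell^1(\mathbb{Z}_+,C_0(X))$ on $\mathcal{H}=H_o\otimes\ell^2(\mathbb{Z}_+)$ by $\pi(U^nf)(\xi\otimes e_k)=\alpha_k(f)\xi\otimes e_{k+n}$.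 The analytic crossed product $C_0(X)\times_\phi\mathbb{Z}_+$ is the norm closure of the image of $\pi$ in $\mathcal{B}(\mathcal{H})$ (up to isometric isomorphism it does not depend on the choice of the faithful representation of $C_0(X)$). The maps $\sum_n U^nf_n\mapsto f_m$ on $\ell^1(\mathbb{Z}_+,C_0(X))$ are contractive in the operator norm, hence extend to contractions $E_m:C_0(X)\times_\phi\mathbb{Z}_+\to C_0(X)$; $E_m(A)$ is called the $m$-th Fourier coefficient of $A$. An element $A$ of the analytic crossed product is denoted by the formal series $\sum_{n\ge0}U^nf_n$ where $f_n=E_n(A)$ (no convergence is implied); writing $\sum_{n\ge1}U^nf_n$ means $E_0(A)=0$. The Jacobson radical $\mathrm{Rad}\,\mathcal{A}$ of an algebra $\mathcal{A}$ is the intersection of all primitive ideals, i.e. of the kernels of all algebraically irreducible representations of $\mathcal{A}$. *)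

theory Defs
  imports "HOL-Analysis.Analysis"
begin

section \<open>Complex Hilbert spaces\<close>

class complex_vector = real_vector +
  fixes scaleC :: "complex \<Rightarrow> 'a \<Rightarrow> 'a"  (infixr "*\<^sub>C" 75)
  assumes scaleC_add_right: "a *\<^sub>C (x + y) = a *\<^sub>C x + a *\<^sub>C y"
    and scaleC_add_left: "(a + b) *\<^sub>C x = a *\<^sub>C x + b *\<^sub>C x"
    and scaleC_scaleC: "a *\<^sub>C b *\<^sub>C x = (a * b) *\<^sub>C x"
    and scaleC_of_real: "complex_of_real r *\<^sub>C x = r *\<^sub>R x"

text \<open>The complex inner product is linear in the first argument; its real part is the inner
  product of the underlying real Hilbert space, which determines norm and topology.\<close>

class complex_hilbert = complex_vector + real_inner + complete_space +
  fixes cinner :: "'a \<Rightarrow> 'a \<Rightarrow> complex"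
  assumes cinner_commute: "cinner x y = cnj (cinner y x)"
    and cinner_add_left: "cinner (x + y) z = cinner x z + cinner y z"
    and cinner_scaleC_left: "cinner (a *\<^sub>C x) y = a * cinner x y"
    and Re_cinner: "Re (cinner x y) = inner x y"

subclass (in complex_hilbert) banach ..

lemma vector_space_scaleC: "vector_space (scaleC :: complex \<Rightarrow> 'a \<Rightarrow> 'a::complex_vector)"
proof
  show "1 *\<^sub>C x = x" for x :: 'a
    using scaleC_of_real[of 1 x] by simp
qed (simp_all add: scaleC_add_right scaleC_add_left scaleC_scaleC)

abbreviation csubspace :: "'a::complex_vector set \<Rightarrow> bool"
  where "csubspace \<equiv> module.subspace scaleC"

lemma csubspace_def:
  "csubspace S \<longleftrightarrow> 0 \<in> S \<and> (\<forall>x\<in>S. \<forall>y\<in>S. x + y \<in> S) \<and> (\<forall>c. \<forall>x\<in>S. c *\<^sub>C x \<in> S)"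
proof -
  interpret vector_space "scaleC :: complex \<Rightarrow> 'a \<Rightarrow> 'a" by (rule vector_space_scaleC)
  show ?thesis by (rule subspace_def)
qed

lemma Im_cinner: "Im (cinner x y) = inner (- \<i> *\<^sub>C x) y"
  by (simp add: Re_cinner[symmetric] cinner_scaleC_left)

lemma cinner_self: "cinner x x = complex_of_real ((norm x)\<^sup>2)"
proof -
  have "Im (cinner x x) = 0"
    using arg_cong[OF cinner_commute[of x x], of Im] by simp
  moreover have "Re (cinner x x) = (norm x)\<^sup>2"
    by (simp add: Re_cinner power2_norm_eq_inner)
  ultimately show ?thesis by (simp add: complex_eq_iff)
qed

lemma norm_scaleC: "norm (c *\<^sub>C x) = cmod c * norm (x :: 'a::complex_hilbert)"
proof -
  have "cinner (c *\<^sub>C x) (c *\<^sub>C x) = c * cnj c * cinner x x"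
    by (metis cinner_commute cinner_scaleC_left complex_cnj_mult mult.assoc)
  then have "complex_of_real ((norm (c *\<^sub>C x))\<^sup>2) = complex_of_real ((cmod c * norm x)\<^sup>2)"
    by (simp add: cinner_self complex_norm_square[symmetric] power_mult_distrib)
  then have "(norm (c *\<^sub>C x))\<^sup>2 = (cmod c * norm x)\<^sup>2"
    by (simp only: of_real_eq_iff)
  then show ?thesis by (simp add: power2_eq_iff_nonneg)
qed

lemma bounded_linear_scaleC: "bounded_linear (\<lambda>x :: 'a::complex_hilbert. c *\<^sub>C x)"
proof (rule bounded_linear_intro[where K = "cmod c"])
  show "c *\<^sub>C (r *\<^sub>R x) = r *\<^sub>R (c *\<^sub>C x)" for r and x :: 'a
    by (simp add: scaleC_of_real[symmetric] scaleC_scaleC mult.commute)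
qed (simp_all add: scaleC_add_right norm_scaleC)

instantiation complex :: complex_hilbert
begin
definition "scaleC_complex (c::complex) (x::complex) = c * x"
definition "cinner_complex (x::complex) (y::complex) = x * cnj y"
instance
  by standard (simp_all add: scaleC_complex_def cinner_complex_def algebra_simps
      inner_complex_def scaleR_conv_of_real)
end

instantiation blinfun :: (real_normed_vector, complex_hilbert) complex_vector
begin
definition scaleC_blinfun :: "complex \<Rightarrow> ('a \<Rightarrow>\<^sub>L 'b) \<Rightarrow> 'a \<Rightarrow>\<^sub>L 'b"
  where "scaleC_blinfun c T = Blinfun (\<lambda>x. c *\<^sub>C T x)"
lemma scaleC_blinfun_apply: "blinfun_apply (c *\<^sub>C T) x = c *\<^sub>C blinfun_apply T x"
  unfolding scaleC_blinfun_def
  by (subst bounded_linear_Blinfun_apply)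
     (auto intro: bounded_linear_compose[OF bounded_linear_scaleC] blinfun.bounded_linear_right)
instance
  by standard (auto intro!: blinfun_eqI simp: scaleC_blinfun_apply blinfun.add_left
      blinfun.scaleR_left scaleC_add_right scaleC_add_left scaleC_scaleC scaleC_of_real)
end

section \<open>The Hilbert space of square-summable sequences\<close>

text \<open>The Hilbert tensor product of \<open>'h\<close> with the square-summable scalar sequences is realised
  as the space of square-summable sequences in \<open>'h\<close>; the elementary tensor of \<open>\<xi>\<close> with the \<open>k\<close>-th
  basis vector is the sequence with \<open>\<xi>\<close> in position \<open>k\<close> and \<open>0\<close> elsewhere.\<close>

typedef (overloaded) 'h l2 = "{x :: nat \<Rightarrow> 'h::complex_hilbert. summable (\<lambda>n. (norm (x n))\<^sup>2)}"
  by (rule exI[of _ "\<lambda>_. 0"]) simp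

setup_lifting type_definition_l2

lemma l2_summable: "summable (\<lambda>n. (norm (Rep_l2 x n))\<^sup>2)"
  using Rep_l2[of x] by simp

lemma l2_add_aux:
  fixes x y :: "nat \<Rightarrow> 'a::real_inner"
  assumes "summable (\<lambda>n. (norm (x n))\<^sup>2)" "summable (\<lambda>n. (norm (y n))\<^sup>2)"
  shows "summable (\<lambda>n. (norm (x n + y n))\<^sup>2)"
proof (rule summable_comparison_test'[where N = 0])
  show "summable (\<lambda>n. 2 * (norm (x n))\<^sup>2 + 2 * (norm (y n))\<^sup>2)"
    using assms by (intro summable_add summable_mult)
  fix n
  have "0 \<le> (norm (x n - y n))\<^sup>2" by simp
  then have "(norm (x n + y n))\<^sup>2 \<le> 2 * (norm (x n))\<^sup>2 + 2 * (norm (y n))\<^sup>2"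
    unfolding power2_norm_eq_inner by (simp add: inner_simps inner_commute)
  then show "norm ((norm (x n + y n))\<^sup>2) \<le> 2 * (norm (x n))\<^sup>2 + 2 * (norm (y n))\<^sup>2"
    by simp
qed

lemma l2_inner_aux:
  fixes x y :: "nat \<Rightarrow> 'a::real_inner"
  assumes "summable (\<lambda>n. (norm (x n))\<^sup>2)" "summable (\<lambda>n. (norm (y n))\<^sup>2)"
  shows "summable (\<lambda>n. inner (x n) (y n))"
proof (rule summable_comparison_test'[where N = 0])
  show "summable (\<lambda>n. (norm (x n))\<^sup>2 + (norm (y n))\<^sup>2)"
    using assms by (intro summable_add)
  fix n
  have "\<bar>inner (x n) (y n)\<bar> \<le> norm (x n) * norm (y n)" by (rule Cauchy_Schwarz_ineq2)
  also have "\<dots> \<le> (norm (x n))\<^sup>2 + (norm (y n))\<^sup>2"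
    using sum_squares_bound[of "norm (x n)" "norm (y n)"] mult_nonneg_nonneg[OF norm_ge_zero norm_ge_zero, of "x n" "y n"]
    by linarith
  finally show "norm (inner (x n) (y n)) \<le> (norm (x n))\<^sup>2 + (norm (y n))\<^sup>2" by simp
qed

instantiation l2 :: (complex_hilbert) complex_vector
begin
lift_definition zero_l2 :: "'a l2" is "\<lambda>_. 0" by simp
lift_definition plus_l2 :: "'a l2 \<Rightarrow> 'a l2 \<Rightarrow> 'a l2" is "\<lambda>x y n. x n + y n"
  by (rule l2_add_aux)
lift_definition uminus_l2 :: "'a l2 \<Rightarrow> 'a l2" is "\<lambda>x n. - x n" by simp
lift_definition minus_l2 :: "'a l2 \<Rightarrow> 'a l2 \<Rightarrow> 'a l2" is "\<lambda>x y n. x n - y n"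
  subgoal for x y using l2_add_aux[of x "\<lambda>n. - y n"] by simp
  done
lift_definition scaleR_l2 :: "real \<Rightarrow> 'a l2 \<Rightarrow> 'a l2" is "\<lambda>r x n. r *\<^sub>R x n"
  by (simp add: power_mult_distrib summable_mult)
lift_definition scaleC_l2 :: "complex \<Rightarrow> 'a l2 \<Rightarrow> 'a l2" is "\<lambda>c x n. c *\<^sub>C x n"
  by (simp add: norm_scaleC power_mult_distrib summable_mult)
instance
  by standard (transfer, simp add: algebra_simps scaleC_add_right scaleC_add_left scaleC_scaleC
      scaleC_of_real)+
end

instantiation l2 :: (complex_hilbert) real_inner
begin
definition inner_l2 :: "'a l2 \<Rightarrow> 'a l2 \<Rightarrow> real"
  where "inner_l2 x y = (\<Sum>n. inner (Rep_l2 x n) (Rep_l2 y n))"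
definition norm_l2 :: "'a l2 \<Rightarrow> real" where "norm_l2 x = sqrt (inner x x)"
definition sgn_l2 :: "'a l2 \<Rightarrow> 'a l2" where "sgn_l2 x = x /\<^sub>R norm x"
definition dist_l2 :: "'a l2 \<Rightarrow> 'a l2 \<Rightarrow> real" where "dist_l2 x y = norm (x - y)"
definition uniformity_l2 :: "('a l2 \<times> 'a l2) filter"
  where "uniformity_l2 = (INF e\<in>{0<..}. principal {(x, y). dist x y < e})"
definition open_l2 :: "'a l2 set \<Rightarrow> bool"
  where "open_l2 U = (\<forall>x\<in>U. \<forall>\<^sub>F (x', y) in uniformity. x' = x \<longrightarrow> y \<in> U)"
instance
proof
  fix x y z :: "'a l2" and r :: real
  note s = l2_inner_aux[OF l2_summable l2_summable]
  show "inner x y = inner y x" by (simp add: inner_l2_def inner_commute)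
  show "inner (x + y) z = inner x z + inner y z"
    by (simp add: inner_l2_def plus_l2.rep_eq inner_add_left suminf_add s)
  show "inner (r *\<^sub>R x) y = r * inner x y"
    by (simp add: inner_l2_def scaleR_l2.rep_eq suminf_mult s)
  show "0 \<le> inner x x" by (simp add: inner_l2_def suminf_nonneg s)
  show "inner x x = 0 \<longleftrightarrow> x = 0"
  proof -
    have "inner x x = 0 \<longleftrightarrow> (\<forall>n. inner (Rep_l2 x n) (Rep_l2 x n) = 0)"
      unfolding inner_l2_def by (rule suminf_eq_zero_iff[OF s]) simp
    also have "\<dots> \<longleftrightarrow> x = 0" by (simp add: Rep_l2_inject[symmetric] zero_l2.rep_eq fun_eq_iff)
    finally show ?thesis .
  qed
qed (fact norm_l2_def sgn_l2_def dist_l2_def uniformity_l2_def open_l2_def)+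
end

lemma norm_l2_sq: "(norm x)\<^sup>2 = (\<Sum>n. (norm (Rep_l2 x n))\<^sup>2)"
  by (simp add: power2_norm_eq_inner inner_l2_def)

lemma norm_l2_leI:
  assumes "\<And>m. (\<Sum>n<m. (norm (Rep_l2 x n))\<^sup>2) \<le> e\<^sup>2" "0 \<le> e"
  shows "norm x \<le> e"
proof -
  have "(norm x)\<^sup>2 \<le> e\<^sup>2"
    unfolding norm_l2_sq by (intro suminf_le_const l2_summable assms)
  then show ?thesis using assms(2) by (rule power2_le_imp_le)
qed

lemma partial_le_norm_l2: "(\<Sum>n<m. (norm (Rep_l2 x n))\<^sup>2) \<le> (norm x)\<^sup>2"
  unfolding norm_l2_sq by (rule sum_le_suminf) (auto intro: l2_summable)

lemma component_le_norm_l2: "norm (Rep_l2 x n) \<le> norm x"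
proof -
  have "(norm (Rep_l2 x n))\<^sup>2 \<le> (\<Sum>k<Suc n. (norm (Rep_l2 x k))\<^sup>2)"
    by (simp add: sum_nonneg)
  also have "\<dots> \<le> (norm x)\<^sup>2" by (rule partial_le_norm_l2)
  finally show ?thesis by (rule power2_le_imp_le) simp
qed

instantiation l2 :: (complex_hilbert) complex_hilbert
begin
definition cinner_l2 :: "'a l2 \<Rightarrow> 'a l2 \<Rightarrow> complex"
  where "cinner_l2 x y = (\<Sum>n. cinner (Rep_l2 x n) (Rep_l2 y n))"
instance
proof
  fix x y z :: "'a l2" and a :: complex
  note s = l2_inner_aux[OF l2_summable l2_summable]
  have sC: "summable (\<lambda>n. cinner (Rep_l2 x n) (Rep_l2 y n))" for x y :: "'a l2"
    using s[of x y] s[of "(- \<i>) *\<^sub>C x" y]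
    by (simp add: summable_complex_iff Re_cinner Im_cinner scaleC_l2.rep_eq)
  show "cinner x y = cnj (cinner y x)"
    unfolding cinner_l2_def
    by (subst cinner_commute) (simp add: bounded_linear.suminf[OF bounded_linear_cnj sC])
  show "cinner (x + y) z = cinner x z + cinner y z"
    by (simp add: cinner_l2_def plus_l2.rep_eq cinner_add_left suminf_add sC)
  show "cinner (a *\<^sub>C x) y = a * cinner x y"
    by (simp add: cinner_l2_def scaleC_l2.rep_eq cinner_scaleC_left suminf_mult sC)
  show "Re (cinner x y) = inner x y"
    by (simp add: cinner_l2_def inner_l2_def bounded_linear.suminf[OF bounded_linear_Re sC] Re_cinner)
next
  fix X :: "nat \<Rightarrow> 'a l2"
  assume X: "Cauchy X"
  have "Cauchy (\<lambda>j. Rep_l2 (X j) n)" for n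
  proof (rule CauchyI)
    fix e :: real assume "0 < e"
    then obtain M where M: "\<And>i j. i \<ge> M \<Longrightarrow> j \<ge> M \<Longrightarrow> norm (X i - X j) < e"
      using X CauchyD by blast
    have "norm (Rep_l2 (X i) n - Rep_l2 (X j) n) < e" if "i \<ge> M" "j \<ge> M" for i j
      using component_le_norm_l2[of "X i - X j" n] M[OF that] by (simp add: minus_l2.rep_eq)
    then show "\<exists>M. \<forall>i\<ge>M. \<forall>j\<ge>M. norm (Rep_l2 (X i) n - Rep_l2 (X j) n) < e" by blast
  qed
  then have "\<forall>n. \<exists>l. (\<lambda>j. Rep_l2 (X j) n) \<longlonglongrightarrow> l"
    by (simp add: Cauchy_convergent_iff convergent_def)
  then obtain y where y: "\<And>n. (\<lambda>j. Rep_l2 (X j) n) \<longlonglongrightarrow> y n" by metis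
  have bound: "(\<Sum>n<m. (norm (Rep_l2 (X i) n - y n))\<^sup>2) \<le> e\<^sup>2"
    if M: "\<And>i j. i \<ge> M \<Longrightarrow> j \<ge> M \<Longrightarrow> norm (X i - X j) < e" and i: "i \<ge> M" for M e i m
  proof (rule LIMSEQ_le_const2)
    show "(\<lambda>j. \<Sum>n<m. (norm (Rep_l2 (X i) n - Rep_l2 (X j) n))\<^sup>2)
        \<longlonglongrightarrow> (\<Sum>n<m. (norm (Rep_l2 (X i) n - y n))\<^sup>2)"
      by (intro tendsto_intros y)
    have "(\<Sum>n<m. (norm (Rep_l2 (X i) n - Rep_l2 (X j) n))\<^sup>2) \<le> e\<^sup>2" if j: "j \<ge> M" for j
    proof -
      have "(\<Sum>n<m. (norm (Rep_l2 (X i) n - Rep_l2 (X j) n))\<^sup>2) \<le> (norm (X i - X j))\<^sup>2"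
        using partial_le_norm_l2[of "X i - X j" m] by (simp add: minus_l2.rep_eq)
      also have "\<dots> \<le> e\<^sup>2" using M[OF i j] by (intro power_mono) auto
      finally show ?thesis .
    qed
    then show "\<exists>N. \<forall>j\<ge>N. (\<Sum>n<m. (norm (Rep_l2 (X i) n - Rep_l2 (X j) n))\<^sup>2) \<le> e\<^sup>2" by blast
  qed
  obtain M where M: "\<And>i j. i \<ge> M \<Longrightarrow> j \<ge> M \<Longrightarrow> norm (X i - X j) < 1"
    using X CauchyD[of X 1] by auto
  have "summable (\<lambda>n. (norm (Rep_l2 (X M) n - y n))\<^sup>2)"
    by (rule summableI_nonneg_bounded[where x = "1\<^sup>2"]) (use bound[OF M] in auto)
  from l2_add_aux[OF l2_summable[of "X M"], of "\<lambda>n. - (Rep_l2 (X M) n - y n)"] this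
  have "summable (\<lambda>n. (norm (y n))\<^sup>2)" by (simp add: norm_minus_commute)
  then have Y: "Rep_l2 (Abs_l2 y) = y" by (simp add: Abs_l2_inverse)
  have "X \<longlonglongrightarrow> Abs_l2 y"
  proof (rule LIMSEQ_I)
    fix e :: real assume e: "0 < e"
    then obtain M where M: "\<And>i j. i \<ge> M \<Longrightarrow> j \<ge> M \<Longrightarrow> norm (X i - X j) < e/2"
      using X CauchyD[of X "e/2"] by auto
    have "norm (X i - Abs_l2 y) < e" if "i \<ge> M" for i
    proof -
      have "norm (X i - Abs_l2 y) \<le> e/2"
        by (rule norm_l2_leI) (use bound[OF M that] e in \<open>auto simp: minus_l2.rep_eq Y\<close>)
      then show ?thesis using e by simp
    qed
    then show "\<exists>M. \<forall>i\<ge>M. norm (X i - Abs_l2 y) < e" by blast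
  qed
  then show "convergent X" by (auto simp: convergent_def)
qed
end

lift_definition etensor :: "'h::complex_hilbert \<Rightarrow> nat \<Rightarrow> 'h l2"
  is "\<lambda>\<xi> k n. if n = k then \<xi> else 0"
  subgoal for \<xi> k by (rule summable_finite[of "{k}"]) auto
  done


section \<open>Continuous functions vanishing at infinity and their representations\<close>

definition c0 :: "('x::topological_space \<Rightarrow> complex) set"
  where "c0 = {f. continuous_on UNIV f \<and>
    (\<forall>\<epsilon>>0. \<exists>K. compact K \<and> (\<forall>x. x \<notin> K \<longrightarrow> cmod (f x) < \<epsilon>))}"

definition supnorm :: "('x \<Rightarrow> complex) \<Rightarrow> real"
  where "supnorm f = (SUP x. cmod (f x))"

definition star_rep ::
    "(('x::topological_space \<Rightarrow> complex) \<Rightarrow> 'h::complex_hilbert \<Rightarrow>\<^sub>L 'h) \<Rightarrow> bool"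
  where "star_rep \<rho> \<longleftrightarrow>
    (\<forall>f\<in>c0. \<forall>c \<xi>. \<rho> f (c *\<^sub>C \<xi>) = c *\<^sub>C \<rho> f \<xi>) \<and>
    (\<forall>f\<in>c0. \<forall>g\<in>c0. \<rho> (\<lambda>x. f x + g x) = \<rho> f + \<rho> g) \<and>
    (\<forall>f\<in>c0. \<forall>c. \<rho> (\<lambda>x. c * f x) = c *\<^sub>C \<rho> f) \<and>
    (\<forall>f\<in>c0. \<forall>g\<in>c0. \<rho> (\<lambda>x. f x * g x) = \<rho> f o\<^sub>L \<rho> g) \<and>
    (\<forall>f\<in>c0. \<forall>\<xi> \<eta>. cinner (\<rho> f \<xi>) \<eta> = cinner \<xi> (\<rho> (\<lambda>x. cnj (f x)) \<eta>))"

definition faithful_star_rep ::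
    "(('x::topological_space \<Rightarrow> complex) \<Rightarrow> 'h::complex_hilbert \<Rightarrow>\<^sub>L 'h) \<Rightarrow> bool"
  where "faithful_star_rep \<rho> \<longleftrightarrow> star_rep \<rho> \<and> inj_on \<rho> c0"

section \<open>The analytic crossed product\<close>

definition ell1 :: "(nat \<Rightarrow> 'x::topological_space \<Rightarrow> complex) set"
  where "ell1 = {F. (\<forall>n. F n \<in> c0) \<and> summable (\<lambda>n. supnorm (F n))}"

text \<open>\<open>cp_monom \<phi> \<rho> n f\<close> is the image of $U^n f$: it maps the elementary tensor
  \<open>etensor \<xi> k\<close> to \<open>etensor (\<rho> (f \<circ> \<phi> ^^ k) \<xi>) (k + n)\<close>.\<close>

definition cp_monom ::
    "('x \<Rightarrow> 'x) \<Rightarrow> (('x \<Rightarrow> complex) \<Rightarrow> 'h::complex_hilbert \<Rightarrow>\<^sub>L 'h) \<Rightarrow>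
      nat \<Rightarrow> ('x \<Rightarrow> complex) \<Rightarrow> 'h l2 \<Rightarrow>\<^sub>L 'h l2"
  where "cp_monom \<phi> \<rho> n f = Blinfun (\<lambda>x. Abs_l2 (\<lambda>m.
    if m < n then 0 else \<rho> (f \<circ> \<phi> ^^ (m - n)) (Rep_l2 x (m - n))))"

definition cp_rep ::
    "('x \<Rightarrow> 'x) \<Rightarrow> (('x \<Rightarrow> complex) \<Rightarrow> 'h::complex_hilbert \<Rightarrow>\<^sub>L 'h) \<Rightarrow>
      (nat \<Rightarrow> 'x \<Rightarrow> complex) \<Rightarrow> 'h l2 \<Rightarrow>\<^sub>L 'h l2"
  where "cp_rep \<phi> \<rho> F = (\<Sum>n. cp_monom \<phi> \<rho> n (F n))"

definition crossed_product ::
    "('x::topological_space \<Rightarrow> 'x) \<Rightarrow> (('x \<Rightarrow> complex) \<Rightarrow> 'h::complex_hilbert \<Rightarrow>\<^sub>L 'h) \<Rightarrow>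
      ('h l2 \<Rightarrow>\<^sub>L 'h l2) set"
  where "crossed_product \<phi> \<rho> = closure (cp_rep \<phi> \<rho> ` ell1)"

text \<open>The extension by continuity of the map taking \<open>cp_rep \<phi> \<rho> F\<close> to \<open>F m\<close>.\<close>

definition fourier_coeff ::
    "('x::topological_space \<Rightarrow> 'x) \<Rightarrow> (('x \<Rightarrow> complex) \<Rightarrow> 'h::complex_hilbert \<Rightarrow>\<^sub>L 'h) \<Rightarrow>
      nat \<Rightarrow> ('h l2 \<Rightarrow>\<^sub>L 'h l2) \<Rightarrow> 'x \<Rightarrow> complex"
  where "fourier_coeff \<phi> \<rho> m A = (THE f. \<exists>F. (\<forall>j. F j \<in> ell1) \<and>
    (\<lambda>j. cp_rep \<phi> \<rho> (F j)) \<longlonglongrightarrow> A \<and> uniform_limit UNIV (\<lambda>j. F j m) f sequentially)"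

text \<open>The definitions make sense: representations of $C_0(X)$ are contractive (and isometric if
  faithful), so the operators \<open>cp_monom\<close> are bounded, the series \<open>cp_rep\<close> converges, and the
  Fourier coefficients are well defined.\<close>

lemma c0_dominated:
  assumes f: "f \<in> c0" and g: "continuous_on UNIV g" and le: "\<And>x. cmod (g x) \<le> B * cmod (f x)"
  shows "g \<in> c0"
  unfolding c0_def
proof (clarsimp simp: g)
  fix e :: real assume e: "0 < e"
  define B' where "B' = max B 1"
  have B': "0 < B'" by (simp add: B'_def)
  obtain K where K: "compact K" "\<And>x. x \<notin> K \<Longrightarrow> cmod (f x) < e / B'"
    using f divide_pos_pos[OF e B'] unfolding c0_def by blast
  have "cmod (g x) < e" if "x \<notin> K" for x
  proof -
    have "cmod (g x) \<le> B' * cmod (f x)"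
      using le[of x] mult_right_mono[of B B' "cmod (f x)"] by (simp add: B'_def)
    also have "\<dots> < e" using K(2)[OF that] B' by (simp add: field_simps)
    finally show ?thesis .
  qed
  then show "\<exists>K. compact K \<and> (\<forall>x. x \<notin> K \<longrightarrow> cmod (g x) < e)" using K(1) by blast
qed

lemma c0_continuous: "f \<in> c0 \<Longrightarrow> continuous_on UNIV f"
  by (simp add: c0_def)

lemma c0_bdd: assumes "f \<in> c0" shows "bdd_above (range (\<lambda>x. cmod (f x)))"
proof -
  obtain K where K: "compact K" "\<And>x. x \<notin> K \<Longrightarrow> cmod (f x) < 1"
    using assms zero_less_one[where 'a = real] unfolding c0_def by blast
  have "compact (f ` K)"
    using K(1) c0_continuous[OF assms] by (intro compact_continuous_image) (auto intro: continuous_on_subset)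
  then obtain M where M: "\<And>x. x \<in> K \<Longrightarrow> cmod (f x) \<le> M"
    using compact_imp_bounded[of "f ` K"] by (auto simp: bounded_iff)
  have "cmod (f x) \<le> max M 1" for x
    using K(2)[of x] M[of x] by (cases "x \<in> K") auto
  then show ?thesis by (intro bdd_aboveI[where M = "max M 1"]) auto
qed

lemma le_supnorm: "f \<in> c0 \<Longrightarrow> cmod (f x) \<le> supnorm f"
  unfolding supnorm_def by (rule cSUP_upper[OF UNIV_I c0_bdd])

lemma supnorm_nonneg: "f \<in> c0 \<Longrightarrow> 0 \<le> supnorm f"
  using le_supnorm[of f undefined] norm_ge_zero[of "f undefined"] by linarith

lemma supnorm_leI: "(\<And>x. cmod (f x) \<le> B) \<Longrightarrow> supnorm f \<le> B"
  unfolding supnorm_def by (rule cSUP_least) auto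

lemma c0_zero: "(\<lambda>_. 0) \<in> c0"
  by (auto simp: c0_def)

lemma c0_scale: assumes "f \<in> c0" shows "(\<lambda>x. c * f x) \<in> c0"
  by (rule c0_dominated[OF assms, where B = "cmod c"])
     (auto simp: norm_mult intro!: continuous_intros c0_continuous[OF assms])

lemma c0_cnj: assumes "f \<in> c0" shows "(\<lambda>x. cnj (f x)) \<in> c0"
  by (rule c0_dominated[OF assms, where B = 1]) (auto intro!: continuous_intros c0_continuous[OF assms])

lemma c0_add: assumes "f \<in> c0" "g \<in> c0" shows "(\<lambda>x. f x + g x) \<in> c0"
  unfolding c0_def mem_Collect_eq
proof (intro conjI allI impI continuous_intros c0_continuous assms)
  fix e :: real assume "0 < e"
  then have "0 < e/2" by simp
  obtain K L where K: "compact K" "\<And>x. x \<notin> K \<Longrightarrow> cmod (f x) < e/2"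
    and L: "compact L" "\<And>x. x \<notin> L \<Longrightarrow> cmod (g x) < e/2"
    using assms \<open>0 < e/2\<close> unfolding c0_def by blast
  have "cmod (f x + g x) < e" if "x \<notin> K \<union> L" for x
    using K(2)[of x] L(2)[of x] that norm_triangle_ineq[of "f x" "g x"] by auto
  then show "\<exists>K. compact K \<and> (\<forall>x. x \<notin> K \<longrightarrow> cmod (f x + g x) < e)"
    using compact_Un[OF K(1) L(1)] by blast
qed

lemma c0_mult: assumes "f \<in> c0" "g \<in> c0" shows "(\<lambda>x. f x * g x) \<in> c0"
proof (rule c0_dominated[OF assms(1), where B = "supnorm g"])
  show "cmod (f x * g x) \<le> supnorm g * cmod (f x)" for x
    using mult_right_mono[OF le_supnorm[OF assms(2), of x] norm_ge_zero[of "f x"]]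
    by (simp add: norm_mult mult.commute)
qed (intro continuous_intros c0_continuous assms)

lemma proper_funpow:
  fixes \<phi> :: "'x::topological_space \<Rightarrow> 'x"
  assumes "proper_map euclidean euclidean \<phi>"
  shows "proper_map euclidean euclidean (\<phi> ^^ k)"
proof (induction k)
  case 0
  have "\<phi> ^^ 0 = (\<lambda>x. x)" by (rule ext) simp
  then show ?case by simp
next
  case (Suc k)
  then show ?case using proper_map_compose[OF Suc assms] by (simp add: o_def)
qed

lemma continuous_funpow:
  fixes \<phi> :: "'x::topological_space \<Rightarrow> 'x"
  assumes "continuous_on UNIV \<phi>"
  shows "continuous_on UNIV (\<phi> ^^ k)"
proof (induction k)
  case (Suc k)
  have "continuous_on UNIV (\<phi> \<circ> (\<phi> ^^ k))"
    using Suc assms by (intro continuous_on_compose) (auto intro: continuous_on_subset)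
  then show ?case by simp
qed simp

lemma c0_compose:
  fixes \<phi> :: "'x::topological_space \<Rightarrow> 'x"
  assumes "continuous_on UNIV \<phi>" "proper_map euclidean euclidean \<phi>" and f: "f \<in> c0"
  shows "f \<circ> \<phi> ^^ k \<in> c0"
  unfolding c0_def
proof (safe)
  note p = continuous_funpow[OF assms(1), of k] proper_funpow[OF assms(2), of k]
  show "continuous_on UNIV (f \<circ> \<phi> ^^ k)"
    using p c0_continuous[OF f] by (intro continuous_on_compose) (auto intro: continuous_on_subset)
  fix e :: real assume "0 < e"
  then obtain K where K: "compact K" "\<And>x. x \<notin> K \<Longrightarrow> cmod (f x) < e"
    using f unfolding c0_def by auto
  have "compact {x. (\<phi> ^^ k) x \<in> K}"
    using compactin_proper_map_preimage[OF p(2), of K] K(1) by simp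
  then show "\<exists>K. compact K \<and> (\<forall>x. x \<notin> K \<longrightarrow> cmod ((f \<circ> \<phi> ^^ k) x) < e)"
    using K(2) by (intro exI[of _ "{x. (\<phi> ^^ k) x \<in> K}"]) auto
qed

lemma supnorm_compose_le: "f \<in> c0 \<Longrightarrow> supnorm (f \<circ> \<phi> ^^ k) \<le> supnorm f"
  by (rule supnorm_leI) (simp add: le_supnorm)

lemma norm_scaleC_blinfun:
  fixes T :: "'a::real_normed_vector \<Rightarrow>\<^sub>L 'b::complex_hilbert"
  shows "norm (c *\<^sub>C T) \<le> cmod c * norm T"
  by (rule norm_blinfun_bound)
     (auto simp: scaleC_blinfun_apply norm_scaleC mult.assoc intro!: mult_left_mono norm_blinfun)

context
  fixes \<rho> :: "('x::topological_space \<Rightarrow> complex) \<Rightarrow> 'h::complex_hilbert \<Rightarrow>\<^sub>L 'h"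
  assumes rep: "star_rep \<rho>"
begin

lemma rep_add: "f \<in> c0 \<Longrightarrow> g \<in> c0 \<Longrightarrow> \<rho> (\<lambda>x. f x + g x) = \<rho> f + \<rho> g"
  and rep_scale: "f \<in> c0 \<Longrightarrow> \<rho> (\<lambda>x. c * f x) = c *\<^sub>C \<rho> f"
  and rep_mult: "f \<in> c0 \<Longrightarrow> g \<in> c0 \<Longrightarrow> \<rho> (\<lambda>x. f x * g x) = \<rho> f o\<^sub>L \<rho> g"
  and rep_cnj: "f \<in> c0 \<Longrightarrow> cinner (\<rho> f \<xi>) \<eta> = cinner \<xi> (\<rho> (\<lambda>x. cnj (f x)) \<eta>)"
  using rep unfolding star_rep_def by blast+

lemma rep_inner: "f \<in> c0 \<Longrightarrow> inner (\<rho> f \<xi>) \<eta> = inner \<xi> (\<rho> (\<lambda>x. cnj (f x)) \<eta>)"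
  using arg_cong[OF rep_cnj, of f Re \<xi> \<eta>] by (simp add: Re_cinner)

lemma rep_zero: "\<rho> (\<lambda>_. 0) = 0"
  using rep_add[OF c0_zero c0_zero] by simp

lemma rep_contraction_aux:
  assumes u: "u \<in> c0" "\<And>x. cmod (u x) \<le> 1"
  shows "norm (\<rho> u) \<le> 1"
proof (rule norm_blinfun_bound)
  fix \<xi>
  define g where "g x = complex_of_real (1 - sqrt (1 - (cmod (u x))\<^sup>2))" for x
  have u2: "(cmod (u x))\<^sup>2 \<le> 1" for x using u(2)[of x] by (simp add: power_le_one)
  have g: "g \<in> c0"
  proof (rule c0_dominated[OF u(1), where B = 1])
    show "continuous_on UNIV g"
      unfolding g_def by (intro continuous_intros c0_continuous u)
    fix x
    have "1 - (cmod (u x))\<^sup>2 \<le> sqrt (1 - (cmod (u x))\<^sup>2)"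
      using u2[of x] by (intro real_le_rsqrt) (simp add: power2_eq_square mult_left_le_one_le mult_right_le_one_le)
    moreover have "sqrt (1 - (cmod (u x))\<^sup>2) \<le> 1" by simp
    moreover have "(cmod (u x))\<^sup>2 \<le> cmod (u x)"
      using u(2)[of x] by (simp add: power2_eq_square mult_left_le_one_le)
    ultimately show "cmod (g x) \<le> 1 * cmod (u x)"
      unfolding g_def norm_of_real by linarith
  qed
  have gc: "cnj (g x) = g x" for x by (simp add: g_def)
  have eq: "(\<lambda>x. cnj (u x) * u x) = (\<lambda>x. 2 * g x + (-1) * (g x * g x))"
  proof
    fix x
    define r where "r = sqrt (1 - (cmod (u x))\<^sup>2)"
    have "r\<^sup>2 = 1 - (cmod (u x))\<^sup>2" using u2[of x] by (simp add: r_def)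
    then have r: "2 * (1 - r) + (-1) * ((1 - r) * (1 - r)) = (cmod (u x))\<^sup>2"
      by (simp add: power2_eq_square algebra_simps)
    have "g x = complex_of_real (1 - r)" by (simp add: g_def r_def)
    then have "2 * g x + (-1) * (g x * g x)
        = complex_of_real (2 * (1 - r) + (-1) * ((1 - r) * (1 - r)))"
      by (simp only: of_real_add of_real_mult of_real_numeral of_real_minus of_real_1)
    then have "2 * g x + (-1) * (g x * g x) = complex_of_real ((cmod (u x))\<^sup>2)"
      by (simp only: r)
    then show "cnj (u x) * u x = 2 * g x + (-1) * (g x * g x)"
      by (simp add: complex_norm_square mult.commute del: of_real_power)
  qed
  have "(norm (\<rho> u \<xi>))\<^sup>2 = inner \<xi> (\<rho> (\<lambda>x. cnj (u x) * u x) \<xi>)"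
    using u by (simp add: power2_norm_eq_inner rep_inner rep_mult c0_cnj)
  also have "\<dots> = 2 * inner \<xi> (\<rho> g \<xi>) - inner \<xi> (\<rho> g (\<rho> g \<xi>))"
  proof -
    have "\<rho> (\<lambda>x. cnj (u x) * u x) = 2 *\<^sub>C \<rho> g + (-1) *\<^sub>C (\<rho> g o\<^sub>L \<rho> g)"
      unfolding eq using g by (simp only: rep_add rep_scale rep_mult c0_scale c0_mult)
    moreover have "2 *\<^sub>C v = 2 *\<^sub>R v" "(-1) *\<^sub>C v = - v" for v :: 'h
      using scaleC_of_real[of 2 v] scaleC_of_real[of "-1" v] by simp_all
    ultimately show ?thesis
      by (simp add: blinfun.add_left scaleC_blinfun_apply inner_simps)
  qed
  also have "inner \<xi> (\<rho> g (\<rho> g \<xi>)) = (norm (\<rho> g \<xi>))\<^sup>2"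
    using rep_inner[OF g, of \<xi> "\<rho> g \<xi>"] by (simp add: gc power2_norm_eq_inner)
  also have "2 * inner \<xi> (\<rho> g \<xi>) - (norm (\<rho> g \<xi>))\<^sup>2 = (norm \<xi>)\<^sup>2 - (norm (\<xi> - \<rho> g \<xi>))\<^sup>2"
    unfolding power2_norm_eq_inner by (simp add: inner_simps inner_commute)
  also have "\<dots> \<le> (norm \<xi>)\<^sup>2" by simp
  finally show "norm (\<rho> u \<xi>) \<le> 1 * norm \<xi>"
    unfolding mult_1_left by (rule power2_le_imp_le) (rule norm_ge_zero)
qed simp

lemma rep_contraction:
  assumes f: "f \<in> c0"
  shows "norm (\<rho> f) \<le> supnorm f"
proof (rule field_le_epsilon)
  fix e :: real assume e: "0 < e"
  define s where "s = supnorm f + e"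
  have s: "0 < s" using supnorm_nonneg[OF f] e by (simp add: s_def)
  define u where "u = (\<lambda>x. complex_of_real (1/s) * f x)"
  have u: "u \<in> c0" unfolding u_def by (rule c0_scale[OF f])
  have "cmod (u x) \<le> 1" for x
    using le_supnorm[OF f, of x] e s unfolding u_def norm_mult norm_of_real
    by (simp add: s_def field_simps)
  then have "norm (\<rho> u) \<le> 1" using rep_contraction_aux[OF u] by blast
  have "f = (\<lambda>x. complex_of_real s * u x)" using s by (simp add: u_def)
  then have "\<rho> f = complex_of_real s *\<^sub>C \<rho> u" using rep_scale[OF u] by metis
  then have "norm (\<rho> f) \<le> s * norm (\<rho> u)" using s by (simp add: scaleC_of_real)
  also have "\<dots> \<le> s" using \<open>norm (\<rho> u) \<le> 1\<close> s by simp
  finally show "norm (\<rho> f) \<le> supnorm f + e" by (simp add: s_def)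
qed

lemma rep_isometry:
  assumes inj: "inj_on \<rho> c0" and f: "f \<in> c0"
  shows "norm (\<rho> f) = supnorm f"
proof (rule antisym[OF rep_contraction[OF f]], rule ccontr)
  assume "\<not> supnorm f \<le> norm (\<rho> f)"
  then obtain c where c: "norm (\<rho> f) < c" "c < supnorm f" using dense by (auto simp: not_le)
  have c0: "0 < c" using c(1) norm_ge_zero[of "\<rho> f"] by linarith
  obtain x0 where x0: "c < cmod (f x0)"
    using c(2) supnorm_leI[of f c] by (meson not_le)
  define h where "h x = complex_of_real (max 0 (cmod (f x) - c))" for x
  define g where "g x = cnj (f x) / complex_of_real ((max c (cmod (f x)))\<^sup>2)" for x
  have m: "0 < max c (cmod (f x))" for x using c0 by simp
  have cf: "continuous_on UNIV f" by (rule c0_continuous[OF f])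
  have hc: "continuous_on UNIV h" unfolding h_def by (intro continuous_intros cf)
  have h: "h \<in> c0"
    by (rule c0_dominated[OF f hc, where B = 1]) (use c0 in \<open>auto simp: h_def\<close>)
  have gc: "continuous_on UNIV g"
    unfolding g_def using m by (intro continuous_intros cf) (auto simp: less_le)
  have gb: "cmod (g x) \<le> 1/c" for x
  proof -
    have "cmod (g x) = cmod (f x) / (max c (cmod (f x)))\<^sup>2"
      by (simp add: g_def norm_divide norm_power)
    also have "\<dots> \<le> max c (cmod (f x)) / (max c (cmod (f x)))\<^sup>2" by (intro divide_right_mono) auto
    also have "\<dots> = 1 / max c (cmod (f x))" using m[of x] by (simp add: power2_eq_square)
    also have "\<dots> \<le> 1/c" using c0 by (simp add: frac_le)
    finally show ?thesis .
  qed
  have hg: "(\<lambda>x. h x * g x ^ n) \<in> c0" for n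
  proof (rule c0_dominated[OF h, where B = "(1/c)^n"])
    show "continuous_on UNIV (\<lambda>x. h x * g x ^ n)" by (intro continuous_intros hc gc)
    show "cmod (h x * g x ^ n) \<le> (1/c)^n * cmod (h x)" for x
      using mult_right_mono[OF power_mono[OF gb[of x] norm_ge_zero, of n] norm_ge_zero[of "h x"]]
      by (simp add: norm_mult norm_power mult.commute)
  qed
  have step: "h x * g x ^ n = f x * (h x * g x ^ Suc n)" for n x
  proof (cases "cmod (f x) \<le> c")
    case True
    then show ?thesis by (simp add: h_def)
  next
    case False
    then have "f x \<noteq> 0" using c0 by auto
    have "max c (cmod (f x)) = cmod (f x)" using False by simp
    then have "f x * g x = 1"
      using \<open>f x \<noteq> 0\<close> unfolding g_def by (simp only: complex_norm_square) simp
    moreover have "f x * (h x * g x ^ Suc n) = (f x * g x) * (h x * g x ^ n)"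
      by (simp only: power_Suc mult_ac)
    ultimately show ?thesis by (simp only: mult_1_left)
  qed
  have *: "norm (\<rho> h) \<le> norm (\<rho> f) ^ n * norm (\<rho> (\<lambda>x. h x * g x ^ n))" for n
  proof (induction n)
    case (Suc n)
    have "\<rho> (\<lambda>x. h x * g x ^ n) = \<rho> f o\<^sub>L \<rho> (\<lambda>x. h x * g x ^ Suc n)"
      by (subst step) (rule rep_mult[OF f hg])
    then have "norm (\<rho> (\<lambda>x. h x * g x ^ n)) \<le> norm (\<rho> f) * norm (\<rho> (\<lambda>x. h x * g x ^ Suc n))"
      by (simp only: norm_blinfun_compose)
    from mult_left_mono[OF this, of "norm (\<rho> f) ^ n"] Suc show ?case
      by (simp add: mult.assoc mult.left_commute)
  qed simp
  have "norm (\<rho> h) \<le> (norm (\<rho> f) / c) ^ n * supnorm h" for n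
  proof -
    have "norm (\<rho> (\<lambda>x. h x * g x ^ n)) \<le> (1/c)^n * supnorm h"
    proof (rule order.trans[OF rep_contraction[OF hg] supnorm_leI])
      fix x
      show "cmod (h x * g x ^ n) \<le> (1/c)^n * supnorm h"
        using mult_mono[OF power_mono[OF gb[of x] norm_ge_zero, of n] le_supnorm[OF h, of x]] c0
        by (simp add: norm_mult norm_power mult.commute)
    qed
    from mult_left_mono[OF this, of "norm (\<rho> f) ^ n"] *[of n] show ?thesis
      by (simp add: power_divide)
  qed
  moreover have "(\<lambda>n. (norm (\<rho> f) / c) ^ n * supnorm h) \<longlonglongrightarrow> 0 * supnorm h"
    using c c0 by (intro tendsto_mult LIMSEQ_realpow_zero tendsto_const) auto
  ultimately have "norm (\<rho> h) \<le> 0 * supnorm h"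
    by (intro LIMSEQ_le_const) auto
  then have "\<rho> h = \<rho> (\<lambda>_. 0)" by (simp add: rep_zero)
  then have "h = (\<lambda>_. 0)" using inj h c0_zero by (auto dest: inj_onD)
  then have "h x0 = 0" by simp
  then show False using x0 by (simp add: h_def)
qed

context
  fixes \<phi> :: "'x \<Rightarrow> 'x"
  assumes cont: "continuous_on UNIV \<phi>" and proper: "proper_map euclidean euclidean \<phi>"
begin

lemma cp_monom_aux:
  assumes f: "f \<in> c0"
  shows "norm (\<rho> (f \<circ> \<phi> ^^ k) \<xi>) \<le> supnorm f * norm \<xi>"
proof -
  have "norm (\<rho> (f \<circ> \<phi> ^^ k)) \<le> supnorm f"
    using rep_contraction[OF c0_compose[OF cont proper f]] supnorm_compose_le[OF f] by (rule order.trans)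
  then show ?thesis
    by (rule order.trans[OF norm_blinfun mult_right_mono[OF _ norm_ge_zero]])
qed

lemma cp_monom_partial:
  fixes x :: "'h l2"
  assumes f: "f \<in> c0"
  shows "(\<Sum>m<N. (norm (if m < n then 0 else \<rho> (f \<circ> \<phi> ^^ (m - n)) (Rep_l2 x (m - n))))\<^sup>2)
    \<le> (supnorm f * norm x)\<^sup>2" (is "(\<Sum>m<N. ?t m) \<le> _")
proof -
  have "(\<Sum>m<N. ?t m) \<le> (\<Sum>m<N+n. ?t m)" by (rule sum_mono2) auto
  also have "\<dots> = (\<Sum>m\<in>{n..<N+n}. ?t m)" by (rule sum.mono_neutral_right) auto
  also have "\<dots> = (\<Sum>k<N. (norm (\<rho> (f \<circ> \<phi> ^^ k) (Rep_l2 x k)))\<^sup>2)"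
    by (rule sum.reindex_bij_witness[where i = "\<lambda>k. k + n" and j = "\<lambda>m. m - n"]) auto
  also have "\<dots> \<le> (\<Sum>k<N. (supnorm f)\<^sup>2 * (norm (Rep_l2 x k))\<^sup>2)"
    unfolding power_mult_distrib[symmetric] by (intro sum_mono power_mono cp_monom_aux f) auto
  also have "\<dots> \<le> (supnorm f)\<^sup>2 * (norm x)\<^sup>2"
    unfolding sum_distrib_left[symmetric] by (intro mult_left_mono partial_le_norm_l2) auto
  finally show ?thesis by (simp add: power_mult_distrib)
qed

lemma cp_monom:
  assumes f: "f \<in> c0"
  shows Rep_cp_monom: "\<And>x m. Rep_l2 (cp_monom \<phi> \<rho> n f x) m =
      (if m < n then 0 else \<rho> (f \<circ> \<phi> ^^ (m - n)) (Rep_l2 x (m - n)))"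
    and norm_cp_monom: "norm (cp_monom \<phi> \<rho> n f) \<le> supnorm f"
proof -
  let ?t = "\<lambda>x m. if m < n then 0 else \<rho> (f \<circ> \<phi> ^^ (m - n)) (Rep_l2 x (m - n))"
  have R: "Rep_l2 (Abs_l2 (?t x)) = ?t x" for x
    using summableI_nonneg_bounded[OF _ cp_monom_partial[OF f, of n x]]
    by (subst Abs_l2_inverse) auto
  have nb: "norm (Abs_l2 (?t x)) \<le> norm x * supnorm f" for x
    using cp_monom_partial[OF f, of n x] supnorm_nonneg[OF f]
    by (intro norm_l2_leI) (auto simp: R mult.commute)
  have bl: "bounded_linear (\<lambda>x. Abs_l2 (?t x))"
    by (rule bounded_linear_intro[OF _ _ nb])
       (auto simp: Rep_l2_inject[symmetric] R plus_l2.rep_eq scaleR_l2.rep_eq fun_eq_iff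
         blinfun.add_right blinfun.scaleR_right)
  show "Rep_l2 (cp_monom \<phi> \<rho> n f x) m = ?t x m" for x m
    unfolding cp_monom_def bounded_linear_Blinfun_apply[OF bl] R ..
  show "norm (cp_monom \<phi> \<rho> n f) \<le> supnorm f"
    using nb supnorm_nonneg[OF f]
    by (intro norm_blinfun_bound)
       (auto simp: cp_monom_def bounded_linear_Blinfun_apply[OF bl] mult.commute)
qed

lemma cp_monom_etensor:
  assumes f: "f \<in> c0"
  shows "cp_monom \<phi> \<rho> n f (etensor \<xi> k) = etensor (\<rho> (f \<circ> \<phi> ^^ k) \<xi>) (k + n)"
  by (auto simp: Rep_l2_inject[symmetric] Rep_cp_monom[OF f] etensor.rep_eq fun_eq_iff
      blinfun.zero_right)

lemma cp_rep_summable: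
  assumes "F \<in> ell1"
  shows "summable (\<lambda>n. cp_monom \<phi> \<rho> n (F n))"
proof (rule summable_norm_cancel)
  have c: "F n \<in> c0" for n using assms by (auto simp: ell1_def)
  have "summable (\<lambda>n. supnorm (F n))" using assms by (auto simp: ell1_def)
  moreover have "norm (norm (cp_monom \<phi> \<rho> n (F n))) \<le> supnorm (F n)" for n
    unfolding real_norm_def abs_norm_cancel by (rule norm_cp_monom[OF c])
  ultimately show "summable (\<lambda>n. norm (cp_monom \<phi> \<rho> n (F n)))"
    by (rule summable_comparison_test')
qed

lemma cp_rep_component:
  assumes F: "F \<in> ell1"
  shows "Rep_l2 (cp_rep \<phi> \<rho> F (etensor \<xi> 0)) m = \<rho> (F m) \<xi>"
proof -
  have bl: "bounded_linear (\<lambda>T :: 'h l2 \<Rightarrow>\<^sub>L 'h l2. Rep_l2 (T (etensor \<xi> 0)) m)"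
  proof (rule bounded_linear_compose[where f = "\<lambda>y. Rep_l2 y m"])
    show "bounded_linear (\<lambda>y :: 'h l2. Rep_l2 y m)"
      by (rule bounded_linear_intro[where K = 1])
         (auto simp: plus_l2.rep_eq scaleR_l2.rep_eq component_le_norm_l2)
  qed (rule blinfun.bounded_linear_left)
  have "Rep_l2 (cp_rep \<phi> \<rho> F (etensor \<xi> 0)) m
      = (\<Sum>n. Rep_l2 (cp_monom \<phi> \<rho> n (F n) (etensor \<xi> 0)) m)"
    unfolding cp_rep_def by (rule bounded_linear.suminf[OF bl cp_rep_summable[OF F]])
  also have "\<dots> = (\<Sum>n. if n = m then \<rho> (F m) \<xi> else 0)"
    using F by (intro suminf_cong) (auto simp: ell1_def cp_monom_etensor etensor.rep_eq)
  also have "\<dots> = \<rho> (F m) \<xi>" using suminf_finite[of "{m}" "\<lambda>n. if n = m then \<rho> (F m) \<xi> else 0"] by simp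
  finally show ?thesis .
qed

lemma norm_etensor: "norm (etensor \<xi> k) = norm \<xi>"
proof -
  have "(norm (etensor \<xi> k))\<^sup>2 = (norm \<xi>)\<^sup>2"
    unfolding norm_l2_sq
    using suminf_finite[of "{k}" "\<lambda>n. (norm (Rep_l2 (etensor \<xi> k) n))\<^sup>2"]
    by (simp add: etensor.rep_eq)
  then show ?thesis by simp
qed

lemma supnorm_le_cp_rep:
  assumes inj: "inj_on \<rho> c0" and F: "F \<in> ell1" and G: "G \<in> ell1"
  shows "cmod (F m x - G m x) \<le> norm (cp_rep \<phi> \<rho> F - cp_rep \<phi> \<rho> G)"
proof -
  have c: "F m \<in> c0" "G m \<in> c0" "(\<lambda>x. (-1) * G m x) \<in> c0"
    using F G c0_scale[of "G m" "-1"] by (auto simp: ell1_def)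
  have d: "(\<lambda>x. F m x + (-1) * G m x) \<in> c0" by (rule c0_add[OF c(1,3)])
  have "norm (\<rho> (\<lambda>x. F m x + (-1) * G m x)) \<le> norm (cp_rep \<phi> \<rho> F - cp_rep \<phi> \<rho> G)"
  proof (rule norm_blinfun_bound)
    fix \<xi>
    have "\<rho> (\<lambda>x. F m x + (-1) * G m x) = \<rho> (F m) - \<rho> (G m)"
      using rep_add[OF c(1,3)] rep_scale[OF c(2), of "-1"] scaleC_of_real[of "-1" "\<rho> (G m)"] by simp
    then have "\<rho> (\<lambda>x. F m x + (-1) * G m x) \<xi>
        = Rep_l2 ((cp_rep \<phi> \<rho> F - cp_rep \<phi> \<rho> G) (etensor \<xi> 0)) m"
      by (simp add: blinfun.diff_left minus_l2.rep_eq cp_rep_component[OF F] cp_rep_component[OF G])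
    also have "norm \<dots> \<le> norm ((cp_rep \<phi> \<rho> F - cp_rep \<phi> \<rho> G) (etensor \<xi> 0))"
      by (rule component_le_norm_l2)
    also have "\<dots> \<le> norm (cp_rep \<phi> \<rho> F - cp_rep \<phi> \<rho> G) * norm \<xi>"
      using norm_blinfun[of "cp_rep \<phi> \<rho> F - cp_rep \<phi> \<rho> G" "etensor \<xi> 0"] by (simp add: norm_etensor)
    finally show "norm (\<rho> (\<lambda>x. F m x + (-1) * G m x) \<xi>)
        \<le> norm (cp_rep \<phi> \<rho> F - cp_rep \<phi> \<rho> G) * norm \<xi>" .
  qed simp
  then have "supnorm (\<lambda>x. F m x + (-1) * G m x) \<le> norm (cp_rep \<phi> \<rho> F - cp_rep \<phi> \<rho> G)"
    by (simp only: rep_isometry[OF inj d])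
  then show ?thesis using le_supnorm[OF d, of x] by simp
qed

lemma fourier_coeff_eqI:
  assumes inj: "inj_on \<rho> c0" and F: "\<And>j. F j \<in> ell1"
    and A: "(\<lambda>j. cp_rep \<phi> \<rho> (F j)) \<longlonglongrightarrow> A"
    and f: "uniform_limit UNIV (\<lambda>j. F j m) f sequentially"
  shows "fourier_coeff \<phi> \<rho> m A = f"
  unfolding fourier_coeff_def
proof (rule the_equality)
  show "\<exists>F. (\<forall>j. F j \<in> ell1) \<and> (\<lambda>j. cp_rep \<phi> \<rho> (F j)) \<longlonglongrightarrow> A \<and>
      uniform_limit UNIV (\<lambda>j. F j m) f sequentially"
    using F A f by blast
  fix g assume "\<exists>G. (\<forall>j. G j \<in> ell1) \<and> (\<lambda>j. cp_rep \<phi> \<rho> (G j)) \<longlonglongrightarrow> A \<and>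
      uniform_limit UNIV (\<lambda>j. G j m) g sequentially"
  then obtain G where G: "\<And>j. G j \<in> ell1" "(\<lambda>j. cp_rep \<phi> \<rho> (G j)) \<longlonglongrightarrow> A"
    "uniform_limit UNIV (\<lambda>j. G j m) g sequentially" by blast
  show "g = f"
  proof
    fix x
    have "(\<lambda>j. cmod (F j m x - G j m x)) \<longlonglongrightarrow> cmod (f x - g x)"
      using tendsto_uniform_limitI[OF f, of x] tendsto_uniform_limitI[OF G(3), of x]
      by (intro tendsto_intros) auto
    moreover have "(\<lambda>j. norm (cp_rep \<phi> \<rho> (F j) - cp_rep \<phi> \<rho> (G j))) \<longlonglongrightarrow> norm (A - A)"
      by (intro tendsto_intros A G)
    ultimately have "cmod (f x - g x) \<le> norm (A - A)"
      by (rule LIMSEQ_le) (use supnorm_le_cp_rep[OF inj F G(1)] in auto)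
    then show "g x = f x" by simp
  qed
qed

lemma fourier_coeff_cp_rep:
  assumes "inj_on \<rho> c0" "F \<in> ell1"
  shows "fourier_coeff \<phi> \<rho> m (cp_rep \<phi> \<rho> F) = F m"
  using assms by (intro fourier_coeff_eqI[where F = "\<lambda>_. F"]) (auto intro!: uniform_limit_const)

lemma fourier_coeff_exists:
  assumes inj: "inj_on \<rho> c0" and A: "A \<in> crossed_product \<phi> \<rho>"
  obtains F where "\<And>j. F j \<in> ell1" "(\<lambda>j. cp_rep \<phi> \<rho> (F j)) \<longlonglongrightarrow> A"
    "\<And>m. uniform_limit UNIV (\<lambda>j. F j m) (fourier_coeff \<phi> \<rho> m A) sequentially"
proof -
  obtain T where T: "\<And>j. T j \<in> cp_rep \<phi> \<rho> ` ell1" "T \<longlonglongrightarrow> A"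
    using A unfolding crossed_product_def closure_sequential by blast
  then have "\<forall>j. \<exists>F. F \<in> ell1 \<and> T j = cp_rep \<phi> \<rho> F" by blast
  then obtain F where F: "\<And>j. F j \<in> ell1" "\<And>j. T j = cp_rep \<phi> \<rho> (F j)" by metis
  have lim: "(\<lambda>j. cp_rep \<phi> \<rho> (F j)) \<longlonglongrightarrow> A" using T(2) unfolding F(2)[symmetric] .
  have "uniform_limit UNIV (\<lambda>j. F j m) (fourier_coeff \<phi> \<rho> m A) sequentially" for m
  proof -
    have "uniformly_Cauchy_on UNIV (\<lambda>j. F j m)"
    proof (rule uniformly_Cauchy_onI)
      fix e :: real assume "0 < e"
      then obtain M where M: "\<forall>i\<ge>M. \<forall>j\<ge>M. norm (cp_rep \<phi> \<rho> (F i) - cp_rep \<phi> \<rho> (F j)) < e"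
        using CauchyD[OF LIMSEQ_imp_Cauchy[OF lim]] by blast
      show "\<exists>M. \<forall>x\<in>UNIV. \<forall>i\<ge>M. \<forall>j\<ge>M. dist (F i m x) (F j m x) < e"
        using M supnorm_le_cp_rep[OF inj F(1) F(1)] order.strict_trans1
        unfolding dist_norm by blast
    qed
    then obtain f where "uniform_limit UNIV (\<lambda>j. F j m) f sequentially"
      using Cauchy_uniformly_convergent[of UNIV] by (auto simp: uniformly_convergent_on_def)
    then show ?thesis using fourier_coeff_eqI[OF inj F(1) lim] by metis
  qed
  with F(1) lim show ?thesis using that by blast
qed

end

end

definition recurrent_points :: "('x::topological_space \<Rightarrow> 'x) \<Rightarrow> 'x set"
  where "recurrent_points \<phi> = {x. \<forall>V. open V \<and> x \<in> V \<longrightarrow> (\<exists>n\<ge>1. (\<phi> ^^ n) x \<in> V)}"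

section \<open>The Jacobson radical of an operator algebra\<close>

text \<open>Neither the algebra nor its representations are assumed to be unital or continuous.\<close>

definition algebra_rep ::
    "('k::complex_hilbert \<Rightarrow>\<^sub>L 'k) set \<Rightarrow> 'v::complex_vector set \<Rightarrow>
      (('k \<Rightarrow>\<^sub>L 'k) \<Rightarrow> 'v \<Rightarrow> 'v) \<Rightarrow> bool"
  where "algebra_rep \<A> V \<theta> \<longleftrightarrow> csubspace V \<and>
    (\<forall>a\<in>\<A>. \<forall>v\<in>V. \<theta> a v \<in> V) \<and>
    (\<forall>a\<in>\<A>. \<forall>v\<in>V. \<forall>w\<in>V. \<theta> a (v + w) = \<theta> a v + \<theta> a w) \<and>
    (\<forall>a\<in>\<A>. \<forall>v\<in>V. \<forall>c. \<theta> a (c *\<^sub>C v) = c *\<^sub>C \<theta> a v) \<and>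
    (\<forall>a\<in>\<A>. \<forall>b\<in>\<A>. \<forall>v\<in>V. \<theta> (a + b) v = \<theta> a v + \<theta> b v) \<and>
    (\<forall>a\<in>\<A>. \<forall>c. \<forall>v\<in>V. \<theta> (c *\<^sub>C a) v = c *\<^sub>C \<theta> a v) \<and>
    (\<forall>a\<in>\<A>. \<forall>b\<in>\<A>. \<forall>v\<in>V. \<theta> (a o\<^sub>L b) v = \<theta> a (\<theta> b v))"

definition irreducible_rep ::
    "('k::complex_hilbert \<Rightarrow>\<^sub>L 'k) set \<Rightarrow> 'v::complex_vector set \<Rightarrow>
      (('k \<Rightarrow>\<^sub>L 'k) \<Rightarrow> 'v \<Rightarrow> 'v) \<Rightarrow> bool"
  where "irreducible_rep \<A> V \<theta> \<longleftrightarrow> algebra_rep \<A> V \<theta> \<and>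
    (\<exists>a\<in>\<A>. \<exists>v\<in>V. \<theta> a v \<noteq> 0) \<and>
    (\<forall>W. csubspace W \<and> W \<subseteq> V \<and> (\<forall>a\<in>\<A>. \<forall>w\<in>W. \<theta> a w \<in> W) \<longrightarrow> W = {0} \<or> W = V)"

definition rep_kernel ::
    "('k::complex_hilbert \<Rightarrow>\<^sub>L 'k) set \<Rightarrow> 'v::complex_vector set \<Rightarrow>
      (('k \<Rightarrow>\<^sub>L 'k) \<Rightarrow> 'v \<Rightarrow> 'v) \<Rightarrow> ('k \<Rightarrow>\<^sub>L 'k) set"
  where "rep_kernel \<A> V \<theta> = {a\<in>\<A>. \<forall>v\<in>V. \<theta> a v = 0}"

text \<open>Representation spaces range over the complex subspaces of the type of \<open>\<A>\<close> itself. This is no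
  restriction: for \<open>v \<noteq> 0\<close> the map taking \<open>a\<close> to \<open>\<theta> a v\<close> is a linear surjection from \<open>\<A>\<close> onto
  the irreducible space, so the latter is isomorphic to a subspace of \<open>\<A>\<close>; see
  \<open>rep_kernel_primitive\<close> below.\<close>

definition primitive_ideals ::
    "('k::complex_hilbert \<Rightarrow>\<^sub>L 'k) set \<Rightarrow> ('k \<Rightarrow>\<^sub>L 'k) set set"
  where "primitive_ideals \<A> =
    {rep_kernel \<A> V \<theta> | (V :: ('k \<Rightarrow>\<^sub>L 'k) set) \<theta>. irreducible_rep \<A> V \<theta>}"

definition jacobson_radical :: "('k::complex_hilbert \<Rightarrow>\<^sub>L 'k) set \<Rightarrow> ('k \<Rightarrow>\<^sub>L 'k) set"
  where "jacobson_radical \<A> = \<A> \<inter> \<Inter>(primitive_ideals \<A>)"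

lemma rep_kernel_primitive:
  fixes \<A> :: "('k::complex_hilbert \<Rightarrow>\<^sub>L 'k) set" and V :: "'v::complex_vector set"
  assumes A: "csubspace \<A>" and mult: "\<And>a b. a \<in> \<A> \<Longrightarrow> b \<in> \<A> \<Longrightarrow> a o\<^sub>L b \<in> \<A>"
    and irr: "irreducible_rep \<A> V \<theta>"
  shows "rep_kernel \<A> V \<theta> \<in> primitive_ideals \<A>"
proof -
  interpret va: vector_space "scaleC :: complex \<Rightarrow> ('k \<Rightarrow>\<^sub>L 'k) \<Rightarrow> _" by (rule vector_space_scaleC)
  interpret vv: vector_space "scaleC :: complex \<Rightarrow> 'v \<Rightarrow> _" by (rule vector_space_scaleC)
  interpret p: vector_space_pair "scaleC :: complex \<Rightarrow> ('k \<Rightarrow>\<^sub>L 'k) \<Rightarrow> _"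
    "scaleC :: complex \<Rightarrow> 'v \<Rightarrow> _" ..
  interpret q: vector_space_pair "scaleC :: complex \<Rightarrow> 'v \<Rightarrow> _"
    "scaleC :: complex \<Rightarrow> ('k \<Rightarrow>\<^sub>L 'k) \<Rightarrow> _" ..
  have rep: "algebra_rep \<A> V \<theta>" and nz: "\<exists>a\<in>\<A>. \<exists>v\<in>V. \<theta> a v \<noteq> 0"
    and inv: "\<And>W. csubspace W \<Longrightarrow> W \<subseteq> V \<Longrightarrow> (\<And>a w. a \<in> \<A> \<Longrightarrow> w \<in> W \<Longrightarrow> \<theta> a w \<in> W)
      \<Longrightarrow> W = {0} \<or> W = V"
    using irr unfolding irreducible_rep_def by blast+
  have V: "csubspace V" and mem: "\<And>a v. a \<in> \<A> \<Longrightarrow> v \<in> V \<Longrightarrow> \<theta> a v \<in> V"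
    and add: "\<And>a v w. a \<in> \<A> \<Longrightarrow> v \<in> V \<Longrightarrow> w \<in> V \<Longrightarrow> \<theta> a (v + w) = \<theta> a v + \<theta> a w"
    and scl: "\<And>a v c. a \<in> \<A> \<Longrightarrow> v \<in> V \<Longrightarrow> \<theta> a (c *\<^sub>C v) = c *\<^sub>C \<theta> a v"
    and addA: "\<And>a b v. a \<in> \<A> \<Longrightarrow> b \<in> \<A> \<Longrightarrow> v \<in> V \<Longrightarrow> \<theta> (a + b) v = \<theta> a v + \<theta> b v"
    and sclA: "\<And>a v c. a \<in> \<A> \<Longrightarrow> v \<in> V \<Longrightarrow> \<theta> (c *\<^sub>C a) v = c *\<^sub>C \<theta> a v"
    and mulA: "\<And>a b v. a \<in> \<A> \<Longrightarrow> b \<in> \<A> \<Longrightarrow> v \<in> V \<Longrightarrow> \<theta> (a o\<^sub>L b) v = \<theta> a (\<theta> b v)"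
    using rep unfolding algebra_rep_def by blast+
  obtain a0 v0 where a0: "a0 \<in> \<A>" and v0: "v0 \<in> V" and av: "\<theta> a0 v0 \<noteq> 0" using nz by blast
  let ?q = "\<lambda>a. \<theta> a v0"
  have "csubspace (?q ` \<A>)"
    unfolding csubspace_def
  proof (intro conjI ballI allI)
    show "0 \<in> ?q ` \<A>"
      using va.subspace_0[OF A] sclA[OF a0 v0, of 0] va.scale_zero_left vv.scale_zero_left
      by (metis image_eqI)
  qed (use A v0 in \<open>auto simp: addA[symmetric] sclA[symmetric] csubspace_def\<close>)
  moreover have "\<theta> a w \<in> ?q ` \<A>" if "a \<in> \<A>" "w \<in> ?q ` \<A>" for a w
    using that mult v0 by (auto simp: mulA[symmetric])
  moreover have "?q ` \<A> \<subseteq> V" using mem v0 by blast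
  ultimately have "?q ` \<A> = {0} \<or> ?q ` \<A> = V" by (intro inv)
  then have surj: "?q ` \<A> = V" using a0 av by blast
  obtain B where B: "va.independent B" "B \<subseteq> \<A>" "\<A> \<subseteq> va.span B"
    using va.maximal_independent_subset[of \<A>] by blast
  have spanB: "va.span B = \<A>" using B A va.span_minimal by blast
  define Q where "Q = p.construct B ?q"
  have linQ: "Vector_Spaces.linear scaleC scaleC Q" unfolding Q_def by (rule p.linear_construct[OF B(1)])
  interpret Q: Vector_Spaces.linear scaleC scaleC Q by (rule linQ)
  have "a \<in> \<A> \<and> Q a = \<theta> a v0" if "a \<in> \<A>" for a
    using that unfolding spanB[symmetric]
  proof (induction rule: va.span_induct_alt)
    case base
    then show ?case using sclA[OF a0 v0, of 0] va.subspace_0[OF A] by (simp add: Q.zero spanB)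
  next
    case (step c x y)
    then have x: "x \<in> \<A>" and y: "y \<in> \<A>" and Qy: "Q y = \<theta> y v0" using B(2) spanB by auto
    moreover have cx: "c *\<^sub>C x \<in> \<A>" using A x by (simp add: csubspace_def)
    moreover have "c *\<^sub>C x + y \<in> \<A>" using A cx y by (simp add: csubspace_def)
    moreover have "Q x = \<theta> x v0" unfolding Q_def by (rule p.construct_basis[OF B(1) step(1)])
    ultimately show ?case
      using v0 by (simp add: Q.add Q.scale addA sclA spanB)
  qed
  then have Q: "Q a = \<theta> a v0" if "a \<in> \<A>" for a using that by blast
  obtain s where s: "range s \<subseteq> \<A>" "Vector_Spaces.linear scaleC scaleC s" "\<forall>v\<in>Q ` \<A>. Q (s v) = v"
    using p.linear_exists_right_inverse_on[OF linQ A] by blast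
  interpret s: Vector_Spaces.linear scaleC scaleC s by (rule s(2))
  have Qs: "Q (s v) = v" if "v \<in> V" for v
  proof -
    have "Q ` \<A> = V" using surj Q by (auto simp: image_def)
    then show ?thesis using s(3) that by simp
  qed
  define N where "N = s ` V"
  define \<theta>' where "\<theta>' a n = s (\<theta> a (Q n))" for a n
  have N: "csubspace N" unfolding N_def using V s.subspace_image by blast
  have QN: "Q n \<in> V" if "n \<in> N" for n using that Qs by (auto simp: N_def)
  have sQ: "s (Q n) = n" if "n \<in> N" for n using that Qs by (auto simp: N_def)
  have "irreducible_rep \<A> N \<theta>'"
    unfolding irreducible_rep_def algebra_rep_def
  proof (intro conjI ballI allI impI)
    show "csubspace N" by (rule N)
    show "\<theta>' a v \<in> N" if "a \<in> \<A>" "v \<in> N" for a v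
      using mem[OF that(1) QN[OF that(2)]] by (simp add: \<theta>'_def N_def)
    show "\<exists>a\<in>\<A>. \<exists>v\<in>N. \<theta>' a v \<noteq> 0"
    proof (intro bexI)
      show "\<theta>' a0 (s v0) \<noteq> 0"
        using av Qs[OF mem[OF a0 v0]] Qs[OF v0] Q.zero by (auto simp: \<theta>'_def)
    qed (use a0 v0 in \<open>auto simp: N_def\<close>)
    fix W assume W: "csubspace W \<and> W \<subseteq> N \<and> (\<forall>a\<in>\<A>. \<forall>w\<in>W. \<theta>' a w \<in> W)"
    have "Q ` W = {0} \<or> Q ` W = V"
    proof (rule inv)
      show "csubspace (Q ` W)" using W Q.subspace_image by blast
      show "Q ` W \<subseteq> V" using W QN by blast
      fix a w assume "a \<in> \<A>" "w \<in> Q ` W"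
      then obtain n where n: "n \<in> W" "w = Q n" by blast
      then have "\<theta>' a n \<in> W" using W \<open>a \<in> \<A>\<close> by blast
      moreover have "Q (\<theta>' a n) = \<theta> a w"
        using n W QN mem \<open>a \<in> \<A>\<close> by (auto simp: \<theta>'_def Qs)
      ultimately show "\<theta> a w \<in> Q ` W" by (metis imageI)
    qed
    moreover have "W = s ` Q ` W"
      using W sQ by (force simp: image_image subset_iff)
    ultimately show "W = {0} \<or> W = N"
      by (auto simp: N_def s.zero)
  qed (auto simp: \<theta>'_def QN Qs mem add scl addA sclA mulA Q.add Q.scale s.add s.scale)
  moreover have "rep_kernel \<A> V \<theta> = rep_kernel \<A> N \<theta>'"
  proof -
    have "s w = 0 \<longleftrightarrow> w = 0" if "w \<in> V" for w
      using Qs[OF that] s.zero Q.zero by metis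
    then show ?thesis
      using mem Qs by (auto simp: rep_kernel_def \<theta>'_def N_def)
  qed
  ultimately show ?thesis unfolding primitive_ideals_def by blast
qed

end

theory Submission
  imports Defs
begin

text \<open>An element is in the radical if and only if all its left multiples are left quasi-regular. Hence the
  radical is a closed, semiprime, gauge-invariant ideal. Averaging the gauge action over roots of
  unity, once with a character and once with a Fejer kernel, shows that an element \<open>A\<close> belongs to the
  radical if and only if all its homogeneous parts \<open>U n (E n A)\<close> do. For a homogeneous part with \<open>n \<ge> 1\<close>,
  semiprimeness and Baire's theorem, applied to the common zero set of the \<open>f\<close> with \<open>U n f\<close> in the
  radical, show that vanishing on the recurrent points is sufficient. It is necessary because the return
  times of a recurrent point allow one to build an element of the ideal generated by \<open>U n f\<close> whose powers
  have Fourier coefficients too large for a quasi-inverse to exist.\<close>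

section \<open>The Jacobson radical of a closed operator algebra\<close>

text \<open>Three gaps shape the argument. The representations defining the radical are purely
  algebraic, so their kernels are not obviously closed. Fourier series need not converge in norm, so
  \<open>A\<close> can be reached from its homogeneous parts only through means that are contractive
  uniformly in their length. And a non-recurrent point avoids some neighbourhood of itself, but the
  size of that neighbourhood depends on the point; Baire's theorem makes it uniform on a relatively
  open set. For necessity, powers of a single \<open>U p f\<close> prove nothing: at multiples of
  one return time the orbit of a recurrent point may leave the support of \<open>f\<close>. Several
  times must be mixed, and later ones depend on neighbourhoods chosen before; the ruler order lets a
  valid pattern be repeated after one new step. All coefficients of the constructed element are
  nonnegative, so minus its quasi-inverse is bounded below term by term, without spectral
  radii.\<close>

lemma scaleC_one [simp]: "1 *\<^sub>C x = (x :: 'a::complex_vector)"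
  using scaleC_of_real[of 1 x] by simp

lemma scaleC_minus_one: "(- 1) *\<^sub>C x = - (x :: 'a::complex_vector)"
  using scaleC_of_real[of "-1" x] by simp

lemma scaleC_zero [simp]: "0 *\<^sub>C x = (0 :: 'a::complex_vector)" "c *\<^sub>C 0 = (0 :: 'a::complex_vector)"
proof -
  interpret vector_space "scaleC :: complex \<Rightarrow> 'a \<Rightarrow> 'a" by (rule vector_space_scaleC)
  show "0 *\<^sub>C x = (0 :: 'a)" "c *\<^sub>C 0 = (0 :: 'a)" by simp_all
qed

lemma scaleC_diff_right: "c *\<^sub>C (x - y) = c *\<^sub>C x - c *\<^sub>C (y :: 'a::complex_vector)"
proof -
  interpret vector_space "scaleC :: complex \<Rightarrow> 'a \<Rightarrow> 'a" by (rule vector_space_scaleC)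
  show ?thesis by (rule scale_right_diff_distrib)
qed

lemma blinfun_compose_assoc: "(a o\<^sub>L b) o\<^sub>L c = a o\<^sub>L (b o\<^sub>L c)"
  by (rule blinfun_eqI) simp

lemma csubspace_facts:
  assumes "csubspace S"
  shows csubspace_0: "0 \<in> S"
    and csubspace_add: "\<And>x y. x \<in> S \<Longrightarrow> y \<in> S \<Longrightarrow> x + y \<in> S"
    and csubspace_scaleC: "\<And>c x. x \<in> S \<Longrightarrow> c *\<^sub>C x \<in> S"
    and csubspace_minus: "\<And>x. x \<in> S \<Longrightarrow> - x \<in> S"
    and csubspace_diff: "\<And>x y. x \<in> S \<Longrightarrow> y \<in> S \<Longrightarrow> x - y \<in> S"
    and csubspace_sum: "\<And>I f. (\<And>i. i \<in> I \<Longrightarrow> f i \<in> S) \<Longrightarrow> sum f I \<in> S"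
proof -
  show 0: "0 \<in> S" and add: "\<And>x y. x \<in> S \<Longrightarrow> y \<in> S \<Longrightarrow> x + y \<in> S"
    and sc: "\<And>c x. x \<in> S \<Longrightarrow> c *\<^sub>C x \<in> S"
    using assms unfolding csubspace_def by blast+
  show neg: "- x \<in> S" if "x \<in> S" for x
    using sc[OF that, of "-1"] by (simp add: scaleC_minus_one)
  show "x - y \<in> S" if "x \<in> S" "y \<in> S" for x y
    using add[OF that(1) neg[OF that(2)]] by simp
  show "sum f I \<in> S" if "\<And>i. i \<in> I \<Longrightarrow> f i \<in> S" for I and f :: "'b \<Rightarrow> 'a"
    using that by (induction I rule: infinite_finite_induct) (auto intro: 0 add)
qed

lemma bounded_linear_blinfun_compose_left: "bounded_linear (\<lambda>a. a o\<^sub>L b)"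
  and bounded_linear_blinfun_compose_right: "bounded_linear (\<lambda>b. a o\<^sub>L b)"
  by (intro bounded_linear_intros)+

lemma blinfun_compose_arith:
  "(a + b) o\<^sub>L c = (a o\<^sub>L c) + (b o\<^sub>L c)" "(a - b) o\<^sub>L c = (a o\<^sub>L c) - (b o\<^sub>L c)"
  "(- a) o\<^sub>L c = - (a o\<^sub>L c)" "a o\<^sub>L (b + c) = (a o\<^sub>L b) + (a o\<^sub>L c)"
  "a o\<^sub>L (b - c) = (a o\<^sub>L b) - (a o\<^sub>L c)"
  by (rule blinfun_eqI, simp add: blinfun.bilinear_simps)+

lemma scaleC_blinfun_compose: "(c *\<^sub>C a) o\<^sub>L b = c *\<^sub>C (a o\<^sub>L b)"
  by (rule blinfun_eqI) (simp add: scaleC_blinfun_apply)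

text \<open>Elements of \<open>'k \<Rightarrow>\<^sub>L 'k\<close> are only real-linear, hence the
  explicit assumption \<open>clinear\<close>. A unit is not assumed, so quasi-inverses replace
  inverses: \<open>c + d = d o\<^sub>L c\<close> says \<open>(1 - d) (1 - c) = 1\<close> in a
  unitization.\<close>

locale closed_operator_algebra =
  fixes \<A> :: "('k::complex_hilbert \<Rightarrow>\<^sub>L 'k) set"
  assumes sub: "csubspace \<A>" and closed: "closed \<A>"
    and mult: "\<And>a b. a \<in> \<A> \<Longrightarrow> b \<in> \<A> \<Longrightarrow> a o\<^sub>L b \<in> \<A>"
    and clinear: "\<And>a c x. a \<in> \<A> \<Longrightarrow> blinfun_apply a (c *\<^sub>C x) = c *\<^sub>C blinfun_apply a x"
begin

lemma compose_scaleC: "a \<in> \<A> \<Longrightarrow> a o\<^sub>L (c *\<^sub>C b) = c *\<^sub>C (a o\<^sub>L b)"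
  by (rule blinfun_eqI) (simp add: scaleC_blinfun_apply clinear)

lemma radical_iff:
  "a \<in> jacobson_radical \<A> \<longleftrightarrow> a \<in> \<A> \<and>
    (\<forall>(V :: ('k \<Rightarrow>\<^sub>L 'k) set) \<theta>. irreducible_rep \<A> V \<theta> \<longrightarrow> (\<forall>v\<in>V. \<theta> a v = 0))"
  unfolding jacobson_radical_def primitive_ideals_def rep_kernel_def by blast

lemma radical_subset: "jacobson_radical \<A> \<subseteq> \<A>"
  unfolding jacobson_radical_def by blast

lemma irreducible_repD:
  fixes V :: "'v::complex_vector set"
  assumes irr: "irreducible_rep \<A> V \<theta>"
  shows "csubspace V" "\<And>a v. a \<in> \<A> \<Longrightarrow> v \<in> V \<Longrightarrow> \<theta> a v \<in> V"
    "\<And>a v w. a \<in> \<A> \<Longrightarrow> v \<in> V \<Longrightarrow> w \<in> V \<Longrightarrow> \<theta> a (v + w) = \<theta> a v + \<theta> a w"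
    "\<And>a v c. a \<in> \<A> \<Longrightarrow> v \<in> V \<Longrightarrow> \<theta> a (c *\<^sub>C v) = c *\<^sub>C \<theta> a v"
    "\<And>a b v. a \<in> \<A> \<Longrightarrow> b \<in> \<A> \<Longrightarrow> v \<in> V \<Longrightarrow> \<theta> (a + b) v = \<theta> a v + \<theta> b v"
    "\<And>a v c. a \<in> \<A> \<Longrightarrow> v \<in> V \<Longrightarrow> \<theta> (c *\<^sub>C a) v = c *\<^sub>C \<theta> a v"
    "\<And>a b v. a \<in> \<A> \<Longrightarrow> b \<in> \<A> \<Longrightarrow> v \<in> V \<Longrightarrow> \<theta> (a o\<^sub>L b) v = \<theta> a (\<theta> b v)"
    "\<exists>a\<in>\<A>. \<exists>v\<in>V. \<theta> a v \<noteq> 0"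
    "\<And>W. csubspace W \<Longrightarrow> W \<subseteq> V \<Longrightarrow> (\<And>a w. a \<in> \<A> \<Longrightarrow> w \<in> W \<Longrightarrow> \<theta> a w \<in> W) \<Longrightarrow> W = {0} \<or> W = V"
proof -
  have rep: "algebra_rep \<A> V \<theta>" and "\<exists>a\<in>\<A>. \<exists>v\<in>V. \<theta> a v \<noteq> 0"
    and inv: "\<And>W. csubspace W \<Longrightarrow> W \<subseteq> V \<Longrightarrow> (\<And>a w. a \<in> \<A> \<Longrightarrow> w \<in> W \<Longrightarrow> \<theta> a w \<in> W)
      \<Longrightarrow> W = {0} \<or> W = V"
    using irr unfolding irreducible_rep_def by blast+
  then show "\<exists>a\<in>\<A>. \<exists>v\<in>V. \<theta> a v \<noteq> 0" 
    "\<And>W. csubspace W \<Longrightarrow> W \<subseteq> V \<Longrightarrow> (\<And>a w. a \<in> \<A> \<Longrightarrow> w \<in> W \<Longrightarrow> \<theta> a w \<in> W) \<Longrightarrow> W = {0} \<or> W = V"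
    by blast+
  show "csubspace V" "\<And>a v. a \<in> \<A> \<Longrightarrow> v \<in> V \<Longrightarrow> \<theta> a v \<in> V"
    "\<And>a v w. a \<in> \<A> \<Longrightarrow> v \<in> V \<Longrightarrow> w \<in> V \<Longrightarrow> \<theta> a (v + w) = \<theta> a v + \<theta> a w"
    "\<And>a v c. a \<in> \<A> \<Longrightarrow> v \<in> V \<Longrightarrow> \<theta> a (c *\<^sub>C v) = c *\<^sub>C \<theta> a v"
    "\<And>a b v. a \<in> \<A> \<Longrightarrow> b \<in> \<A> \<Longrightarrow> v \<in> V \<Longrightarrow> \<theta> (a + b) v = \<theta> a v + \<theta> b v"
    "\<And>a v c. a \<in> \<A> \<Longrightarrow> v \<in> V \<Longrightarrow> \<theta> (c *\<^sub>C a) v = c *\<^sub>C \<theta> a v"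
    "\<And>a b v. a \<in> \<A> \<Longrightarrow> b \<in> \<A> \<Longrightarrow> v \<in> V \<Longrightarrow> \<theta> (a o\<^sub>L b) v = \<theta> a (\<theta> b v)"
    using rep unfolding algebra_rep_def by blast+
qed

text \<open>In an irreducible space the vectors annihilated by the whole algebra form an invariant
  subspace, which is 0 because the action is not zero. So every nonzero vector is cyclic, and some
  \<open>b\<close> carries \<open>\<theta> a v\<close> back to \<open>v\<close>. Later proofs of
  membership in the radical refute this fixed vector.\<close>

lemma not_radicalE:
  assumes a: "a \<in> \<A>" and nr: "a \<notin> jacobson_radical \<A>"
  obtains V :: "('k \<Rightarrow>\<^sub>L 'k) set" and \<theta> v b
  where "irreducible_rep \<A> V \<theta>" "v \<in> V" "v \<noteq> 0" "b \<in> \<A>" "\<theta> (b o\<^sub>L a) v = v"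
proof -
  obtain V :: "('k \<Rightarrow>\<^sub>L 'k) set" and \<theta> v where irr: "irreducible_rep \<A> V \<theta>" and v: "v \<in> V" "\<theta> a v \<noteq> 0"
    using a nr unfolding radical_iff by blast
  note I = irreducible_repD[OF irr]
  let ?w = "\<theta> a v"
  have w: "?w \<in> V" using I(2) a v by blast
  have th0: "\<theta> b 0 = 0" if "b \<in> \<A>" for b
    using I(4)[OF that csubspace_0[OF I(1)], of 0] by simp
  have "\<not> (\<forall>b\<in>\<A>. \<theta> b ?w = 0)"
  proof
    assume *: "\<forall>b\<in>\<A>. \<theta> b ?w = 0"
    define W where "W = {u \<in> V. \<forall>b\<in>\<A>. \<theta> b u = 0}"
    have "W = {0} \<or> W = V"
    proof (rule I(9))
      show "csubspace W" unfolding csubspace_def W_def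
        using I(3,4) th0 csubspace_facts[OF I(1)] by auto
      show "\<theta> a w \<in> W" if "a \<in> \<A>" "w \<in> W" for a w
        using that I(2) csubspace_0[OF I(1)] th0 by (auto simp: W_def)
    qed (auto simp: W_def)
    moreover have "?w \<in> W" using w * by (auto simp: W_def)
    ultimately have "W = V" using v by blast
    then show False using I(8) by (auto simp: W_def)
  qed
  then obtain b where b: "b \<in> \<A>" "\<theta> b ?w \<noteq> 0" by blast
  have "(\<lambda>b. \<theta> b ?w) ` \<A> = {0} \<or> (\<lambda>b. \<theta> b ?w) ` \<A> = V"
  proof (rule I(9))
    show "csubspace ((\<lambda>b. \<theta> b ?w) ` \<A>)" unfolding csubspace_def
    proof (intro conjI ballI allI)
      show "0 \<in> (\<lambda>b. \<theta> b ?w) ` \<A>"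
        using I(6)[OF a w, of 0] csubspace_0[OF sub] by force
      fix x y assume "x \<in> (\<lambda>b. \<theta> b ?w) ` \<A>" "y \<in> (\<lambda>b. \<theta> b ?w) ` \<A>"
      then obtain b c where bc: "b \<in> \<A>" "x = \<theta> b ?w" "c \<in> \<A>" "y = \<theta> c ?w" by blast
      then have "x + y = \<theta> (b + c) ?w" using I(5) w by simp
      then show "x + y \<in> (\<lambda>b. \<theta> b ?w) ` \<A>" using csubspace_add[OF sub bc(1,3)] by blast
    next
      fix x k assume "x \<in> (\<lambda>b. \<theta> b ?w) ` \<A>"
      then obtain b where b: "b \<in> \<A>" "x = \<theta> b ?w" by blast
      then have "k *\<^sub>C x = \<theta> (k *\<^sub>C b) ?w" using I(6) w by simp
      then show "k *\<^sub>C x \<in> (\<lambda>b. \<theta> b ?w) ` \<A>" using csubspace_scaleC[OF sub b(1)] by blast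
    qed
    show "(\<lambda>b. \<theta> b ?w) ` \<A> \<subseteq> V" using I(2) w by blast
    show "\<theta> c u \<in> (\<lambda>b. \<theta> b ?w) ` \<A>" if "c \<in> \<A>" "u \<in> (\<lambda>b. \<theta> b ?w) ` \<A>" for c u
    proof -
      obtain b where b: "b \<in> \<A>" "u = \<theta> b ?w" using \<open>u \<in> _\<close> by blast
      then have "\<theta> c u = \<theta> (c o\<^sub>L b) ?w" using I(7)[OF \<open>c \<in> _\<close> _ w] by simp
      then show ?thesis using mult[OF \<open>c \<in> _\<close> b(1)] by blast
    qed
  qed
  then have "(\<lambda>b. \<theta> b ?w) ` \<A> = V" using b by blast
  then obtain c where "c \<in> \<A>" "\<theta> c ?w = v" using v by (metis imageE)
  moreover have "v \<noteq> 0" using v th0[OF a] by auto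
  ultimately show ?thesis
    using that[OF irr v(1), of c] I(7)[of c a v] a v by simp
qed

section \<open>Ideal properties of the radical\<close>

lemma radicalI:
  assumes "a \<in> \<A>"
    and "\<And>(V :: ('k \<Rightarrow>\<^sub>L 'k) set) \<theta> v. irreducible_rep \<A> V \<theta> \<Longrightarrow> v \<in> V \<Longrightarrow> \<theta> a v = 0"
  shows "a \<in> jacobson_radical \<A>"
  using assms by (simp add: radical_iff)

lemma radicalD:
  fixes V :: "('k \<Rightarrow>\<^sub>L 'k) set"
  assumes "a \<in> jacobson_radical \<A>" "irreducible_rep \<A> V \<theta>" "v \<in> V"
  shows "\<theta> a v = 0"
  using assms by (simp add: radical_iff)

lemma radical_csubspace: "csubspace (jacobson_radical \<A>)"
  unfolding csubspace_def
proof (intro conjI ballI allI)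
  show "0 \<in> jacobson_radical \<A>"
  proof (rule radicalI)
    fix V :: "('k \<Rightarrow>\<^sub>L 'k) set" and \<theta> v assume irr: "irreducible_rep \<A> V \<theta>" and v: "v \<in> V"
    show "\<theta> 0 v = 0" using irreducible_repD(6)[OF irr csubspace_0[OF sub] v, of 0] by simp
  qed (rule csubspace_0[OF sub])
next
  fix x y assume x: "x \<in> jacobson_radical \<A>" and y: "y \<in> jacobson_radical \<A>"
  then have xy: "x \<in> \<A>" "y \<in> \<A>" using radical_subset by auto
  show "x + y \<in> jacobson_radical \<A>"
  proof (rule radicalI)
    fix V :: "('k \<Rightarrow>\<^sub>L 'k) set" and \<theta> v assume irr: "irreducible_rep \<A> V \<theta>" and v: "v \<in> V"
    show "\<theta> (x + y) v = 0"
      using irreducible_repD(5)[OF irr xy v] radicalD[OF x irr v] radicalD[OF y irr v] by simp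
  qed (rule csubspace_add[OF sub xy])
next
  fix x c assume x: "x \<in> jacobson_radical \<A>"
  then have xA: "x \<in> \<A>" using radical_subset by auto
  show "c *\<^sub>C x \<in> jacobson_radical \<A>"
  proof (rule radicalI)
    fix V :: "('k \<Rightarrow>\<^sub>L 'k) set" and \<theta> v assume irr: "irreducible_rep \<A> V \<theta>" and v: "v \<in> V"
    show "\<theta> (c *\<^sub>C x) v = 0"
      using irreducible_repD(6)[OF irr xA v] radicalD[OF x irr v] by simp
  qed (rule csubspace_scaleC[OF sub xA])
qed

lemma radical_mult_left:
  assumes a: "a \<in> \<A>" and b: "b \<in> jacobson_radical \<A>"
  shows "a o\<^sub>L b \<in> jacobson_radical \<A>"
proof (rule radicalI)
  have bA: "b \<in> \<A>" using b radical_subset by auto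
  then show "a o\<^sub>L b \<in> \<A>" by (rule mult[OF a])
  fix V :: "('k \<Rightarrow>\<^sub>L 'k) set" and \<theta> v assume irr: "irreducible_rep \<A> V \<theta>" and v: "v \<in> V"
  note I = irreducible_repD[OF irr]
  show "\<theta> (a o\<^sub>L b) v = 0"
    using I(7)[OF a bA v] radicalD[OF b irr v] I(4)[OF a csubspace_0[OF I(1)], of 0] by simp
qed

lemma radical_mult_right:
  assumes a: "a \<in> \<A>" and b: "b \<in> jacobson_radical \<A>"
  shows "b o\<^sub>L a \<in> jacobson_radical \<A>"
proof (rule radicalI)
  have bA: "b \<in> \<A>" using b radical_subset by auto
  then show "b o\<^sub>L a \<in> \<A>" using a by (rule mult)
  fix V :: "('k \<Rightarrow>\<^sub>L 'k) set" and \<theta> v assume irr: "irreducible_rep \<A> V \<theta>" and v: "v \<in> V"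
  note I = irreducible_repD[OF irr]
  show "\<theta> (b o\<^sub>L a) v = 0"
    using I(7)[OF bA a v] radicalD[OF b irr I(2)[OF a v]] by simp
qed

text \<open>If \<open>b a\<close> fixes \<open>v\<close>, then \<open>v = b (a b a) v\<close>, which
  is 0 once \<open>a b a\<close> is in the radical.\<close>

lemma radical_semiprime:
  assumes a: "a \<in> \<A>" and *: "\<And>b. b \<in> \<A> \<Longrightarrow> a o\<^sub>L (b o\<^sub>L a) \<in> jacobson_radical \<A>"
  shows "a \<in> jacobson_radical \<A>"
proof (rule ccontr)
  assume "a \<notin> jacobson_radical \<A>"
  then obtain V :: "('k \<Rightarrow>\<^sub>L 'k) set" and \<theta> v b where irr: "irreducible_rep \<A> V \<theta>"
    and v: "v \<in> V" "v \<noteq> 0" and b: "b \<in> \<A>" and eq: "\<theta> (b o\<^sub>L a) v = v"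
    by (rule not_radicalE[OF a])
  have "b o\<^sub>L (a o\<^sub>L (b o\<^sub>L a)) \<in> jacobson_radical \<A>" by (rule radical_mult_left[OF b *[OF b]])
  then have "\<theta> (b o\<^sub>L (a o\<^sub>L (b o\<^sub>L a))) v = 0" using irr v(1) by (rule radicalD)
  moreover have "b o\<^sub>L (a o\<^sub>L (b o\<^sub>L a)) = (b o\<^sub>L a) o\<^sub>L (b o\<^sub>L a)" by (rule blinfun_eqI) simp
  ultimately show False
    using irreducible_repD(7)[OF irr mult[OF b a] mult[OF b a] v(1)] eq v by simp
qed

text \<open>On a fixed vector \<open>v\<close> of \<open>c\<close>, the identity
  \<open>c + d = d c\<close> reads \<open>v + d v = d v\<close>.\<close>

lemma left_quasi_regular_no_fixed_vector:
  assumes irr: "irreducible_rep \<A> V \<theta>" and v: "v \<in> V" and c: "c \<in> \<A>" and d: "d \<in> \<A>"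
    and eq: "c + d = d o\<^sub>L c" and fv: "\<theta> c v = v"
  shows "v = 0"
proof -
  note I = irreducible_repD[OF irr]
  have "\<theta> (c + d) v = \<theta> d (\<theta> c v)" unfolding eq by (rule I(7)[OF d c v])
  then show ?thesis using I(5)[OF c d v] fv by simp
qed

text \<open>\<open>d\<close> is minus the Neumann series of \<open>c\<close>. Without a unit it
  starts at \<open>c\<close>, so \<open>p n\<close> is the power of exponent
  \<open>n + 1\<close>.\<close>

lemma quasi_regular_small:
  assumes c: "c \<in> \<A>" and n: "norm c < 1"
  shows "\<exists>d\<in>\<A>. c + d = d o\<^sub>L c"
proof -
  define p where "p n = ((\<lambda>x. x o\<^sub>L c) ^^ n) c" for n
  have pS: "p (Suc n) = p n o\<^sub>L c" for n by (simp add: p_def)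
  have p0: "p 0 = c" by (simp add: p_def)
  have pA: "p n \<in> \<A>" for n by (induction n) (auto simp: p0 pS c mult)
  have pn: "norm (p n) \<le> norm c ^ n * norm c" for n
  proof (induction n)
    case (Suc n)
    have "norm (p (Suc n)) \<le> norm (p n) * norm c" unfolding pS by (rule norm_blinfun_compose)
    also have "\<dots> \<le> (norm c ^ n * norm c) * norm c" by (rule mult_right_mono[OF Suc]) simp
    finally show ?case by (simp add: mult_ac)
  qed (simp add: p0)
  have sm: "summable p"
  proof (rule summable_norm_cancel, rule summable_comparison_test'[where N = 0])
    show "summable (\<lambda>n. norm c ^ n * norm c)" using n by (intro summable_mult2 summable_geometric) simp
  qed (use pn in simp)
  define s where "s = suminf p"
  have "(\<lambda>n. \<Sum>i<n. p i) \<longlonglongrightarrow> s" unfolding s_def by (rule summable_LIMSEQ[OF sm])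
  moreover have "(\<Sum>i<n. p i) \<in> \<A>" for n by (rule csubspace_sum[OF sub pA])
  ultimately have sA: "s \<in> \<A>" using closed_sequentially[OF closed] by metis
  have "s o\<^sub>L c = (\<Sum>n. p n o\<^sub>L c)"
    unfolding s_def by (rule bounded_linear.suminf[OF bounded_linear_blinfun_compose_left sm])
  also have "\<dots> = s - c" using suminf_split_head[OF sm] by (simp add: pS s_def p0)
  finally have "c + (- s) = (- s) o\<^sub>L c"
    by (simp add: blinfun_compose_arith)
  then show ?thesis using csubspace_minus[OF sub sA] by blast
qed

text \<open>If \<open>x n\<close> tends to \<open>l\<close> and \<open>b l\<close> fixes
  \<open>v\<close>, then \<open>b (l - x n)\<close> fixes \<open>v\<close> too, since
  \<open>b (x n)\<close> kills it. For large \<open>n\<close> this element has norm below 1, hence a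
  left quasi-inverse, and so no nonzero fixed vector.\<close>

lemma radical_closed: "closed (jacobson_radical \<A>)"
proof (rule closed_sequential_limits[THEN iffD2], intro allI impI, elim conjE)
  fix x l assume x: "\<forall>n. x n \<in> jacobson_radical \<A>" and lim: "x \<longlonglongrightarrow> l"
  have xA: "x n \<in> \<A>" for n using x radical_subset by blast
  have lA: "l \<in> \<A>" using closed_sequentially[OF closed _ lim] xA by simp
  show "l \<in> jacobson_radical \<A>"
  proof (rule ccontr)
    assume "l \<notin> jacobson_radical \<A>"
    then obtain V :: "('k \<Rightarrow>\<^sub>L 'k) set" and \<theta> v b where irr: "irreducible_rep \<A> V \<theta>"
      and v: "v \<in> V" "v \<noteq> 0" and b: "b \<in> \<A>" and eq: "\<theta> (b o\<^sub>L l) v = v"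
      by (rule not_radicalE[OF lA])
    note I = irreducible_repD[OF irr]
    have "(\<lambda>n. b o\<^sub>L (l - x n)) \<longlonglongrightarrow> (b o\<^sub>L (l - l))"
      by (intro bounded_linear.tendsto[OF bounded_linear_blinfun_compose_right] tendsto_intros lim)
    then have "(\<lambda>n. norm (b o\<^sub>L (l - x n))) \<longlonglongrightarrow> 0"
      using tendsto_norm by fastforce
    then have "\<forall>\<^sub>F n in sequentially. norm (b o\<^sub>L (l - x n)) < 1"
      by (rule order_tendstoD) simp
    then obtain n where n: "norm (b o\<^sub>L (l - x n)) < 1"
      by (auto simp: eventually_sequentially)
    have diff: "l - x n \<in> \<A>" using csubspace_diff[OF sub lA xA] .
    have "\<theta> (b o\<^sub>L x n) v = 0"
      using radicalD[OF radical_mult_left[OF b] irr v(1)] x by blast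
    moreover have "b o\<^sub>L l = (b o\<^sub>L (l - x n)) + (b o\<^sub>L x n)"
      by (simp add: blinfun_compose_arith)
    ultimately have "\<theta> (b o\<^sub>L (l - x n)) v = v"
      using eq I(5)[OF mult[OF b diff] mult[OF b xA[of n]] v(1)] by simp
    moreover obtain d where d: "d \<in> \<A>" "(b o\<^sub>L (l - x n)) + d = d o\<^sub>L (b o\<^sub>L (l - x n))"
      using quasi_regular_small[OF mult[OF b diff] n] by blast
    ultimately show False
      using left_quasi_regular_no_fixed_vector[OF irr v(1) mult[OF b diff] d] v(2) by simp
  qed
qed

text \<open>If \<open>c\<close> has no left quasi-inverse, then the left ideal of all \<open>b - bc\<close> does not contain \<open>c\<close>.
  A left ideal maximal with this property is a maximal modular left ideal, and \<open>c\<close> acts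
  non-trivially on the quotient, which we realise as the range of a linear projection.\<close>

lemma radical_quasi_regular:
  assumes c: "c \<in> jacobson_radical \<A>"
  shows "\<exists>d\<in>\<A>. c + d = d o\<^sub>L c"
proof (rule ccontr)
  assume no: "\<not> (\<exists>d\<in>\<A>. c + d = d o\<^sub>L c)"
  have cA: "c \<in> \<A>" using c radical_subset by blast
  define L where "L = (\<lambda>b. b - (b o\<^sub>L c)) ` \<A>"
  define good where "good = {N. csubspace N \<and> N \<subseteq> \<A> \<and> (\<forall>a\<in>\<A>. \<forall>n\<in>N. a o\<^sub>L n \<in> N) \<and> L \<subseteq> N \<and> c \<notin> N}"
  have cL: "c \<notin> L"
  proof
    assume "c \<in> L"
    then obtain b where b: "b \<in> \<A>" "c = b - (b o\<^sub>L c)" by (auto simp: L_def)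
    have "c + (- b) = - e" if "c = b - e" for e using that by simp
    from this[OF b(2)] have "c + (- b) = (- b) o\<^sub>L c" by (simp only: blinfun_compose_arith)
    then show False using no csubspace_minus[OF sub b(1)] by blast
  qed
  have Lgood: "L \<in> good"
    unfolding good_def csubspace_def L_def
  proof (intro CollectI conjI ballI allI)
    show "0 \<in> (\<lambda>b. b - (b o\<^sub>L c)) ` \<A>"
    proof (rule image_eqI)
      show "0 = 0 - (0 o\<^sub>L c)" by simp
    qed (rule csubspace_0[OF sub])
    show "c \<notin> (\<lambda>b. b - (b o\<^sub>L c)) ` \<A>" using cL by (simp add: L_def)
    fix x assume "x \<in> (\<lambda>b. b - (b o\<^sub>L c)) ` \<A>"
    then obtain a where a: "a \<in> \<A>" "x = a - (a o\<^sub>L c)" by blast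
    show "k *\<^sub>C x \<in> (\<lambda>b. b - (b o\<^sub>L c)) ` \<A>" for k
    proof (rule image_eqI)
      show "k *\<^sub>C x = (k *\<^sub>C a) - ((k *\<^sub>C a) o\<^sub>L c)"
        unfolding a(2) by (simp add: scaleC_diff_right scaleC_blinfun_compose)
    qed (use csubspace_scaleC[OF sub a(1)] in simp)
    show "y o\<^sub>L x \<in> (\<lambda>b. b - (b o\<^sub>L c)) ` \<A>" if "y \<in> \<A>" for y
    proof (rule image_eqI)
      show "y o\<^sub>L x = (y o\<^sub>L a) - ((y o\<^sub>L a) o\<^sub>L c)"
        unfolding a(2) by (simp add: blinfun_compose_arith blinfun_compose_assoc)
    qed (use mult[OF that a(1)] in simp)
    fix y assume "y \<in> (\<lambda>b. b - (b o\<^sub>L c)) ` \<A>"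
    then obtain b where b: "b \<in> \<A>" "y = b - (b o\<^sub>L c)" by blast
    show "x + y \<in> (\<lambda>b. b - (b o\<^sub>L c)) ` \<A>"
    proof (rule image_eqI)
      show "x + y = (a + b) - ((a + b) o\<^sub>L c)" unfolding a(2) b(2) by (simp add: blinfun_compose_arith)
    qed (rule csubspace_add[OF sub a(1) b(1)])
  next
    show "(\<lambda>b. b - (b o\<^sub>L c)) ` \<A> \<subseteq> \<A>" using csubspace_diff[OF sub _ mult[OF _ cA]] by blast
  qed simp
  obtain M where M: "M \<in> good" and max: "\<And>N. N \<in> good \<Longrightarrow> M \<subseteq> N \<Longrightarrow> N = M"
  proof -
    have "\<exists>M\<in>good. \<forall>X\<in>good. M \<subseteq> X \<longrightarrow> X = M"
    proof (rule subset_Zorn_nonempty)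
      show "good \<noteq> {}" using Lgood by blast
      fix C assume ne: "C \<noteq> {}" and ch: "subset.chain good C"
      have sub: "N \<in> good" if "N \<in> C" for N
        using ch that unfolding subset.chain_def by blast
      have cmp: "N \<subseteq> N' \<or> N' \<subseteq> N" if "N \<in> C" "N' \<in> C" for N N'
        using ch that unfolding subset.chain_def by blast
      show "\<Union>C \<in> good"
        unfolding good_def csubspace_def
      proof (intro CollectI conjI ballI allI)
        obtain N where "N \<in> C" using ne by blast
        then show "0 \<in> \<Union>C" using sub[of N] csubspace_0 unfolding good_def by blast
        show "\<Union>C \<subseteq> \<A>" using sub unfolding good_def by blast
        show "L \<subseteq> \<Union>C" using \<open>N \<in> C\<close> sub[of N] unfolding good_def by blast
        show "c \<notin> \<Union>C" using sub unfolding good_def by blast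
        show "x + y \<in> \<Union>C" if xy: "x \<in> \<Union>C" "y \<in> \<Union>C" for x y
        proof -
          obtain N N' where "N \<in> C" "N' \<in> C" "x \<in> N" "y \<in> N'" using xy by blast
          then obtain K where "K \<in> C" "x \<in> K" "y \<in> K" using cmp[of N N'] by blast
          then show ?thesis using csubspace_add sub[of K] unfolding good_def by blast
        qed
        show "k *\<^sub>C x \<in> \<Union>C" if "x \<in> \<Union>C" for k x
          using that sub csubspace_scaleC unfolding good_def by blast
        show "a o\<^sub>L n \<in> \<Union>C" if "a \<in> \<A>" "n \<in> \<Union>C" for a n
          using that sub unfolding good_def by blast
      qed
    qed
    then show ?thesis using that by blast
  qed
  have Ms: "csubspace M" and MA: "M \<subseteq> \<A>" and Mi: "\<And>a n. a \<in> \<A> \<Longrightarrow> n \<in> M \<Longrightarrow> a o\<^sub>L n \<in> M"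
    and LM: "L \<subseteq> M" and cM: "c \<notin> M"
    using M unfolding good_def by blast+
  have mod: "b - (b o\<^sub>L c) \<in> M" if "b \<in> \<A>" for b using that LM by (auto simp: L_def)
  \<comment> \<open>\<open>M\<close> was chosen maximal only among left ideals avoiding
    \<open>c\<close>. One that contains \<open>M\<close> and \<open>c\<close> contains every
    \<open>b = (b - b c) + b c\<close>, so \<open>M\<close> is maximal outright.\<close>
  have maxi: "N = M \<or> N = \<A>"
    if N: "csubspace N" "N \<subseteq> \<A>" "\<And>a n. a \<in> \<A> \<Longrightarrow> n \<in> N \<Longrightarrow> a o\<^sub>L n \<in> N" "M \<subseteq> N" for N
  proof (cases "c \<in> N")
    case False
    then have "N \<in> good" using N LM unfolding good_def by blast
    then show ?thesis using max N(4) by blast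
  next
    case True
    have "b \<in> N" if "b \<in> \<A>" for b
      using csubspace_add[OF N(1), of "b - (b o\<^sub>L c)" "b o\<^sub>L c"] mod[OF that] N(3)[OF that True] N(4) by auto
    then show ?thesis using N(2) by blast
  qed
  interpret va: vector_space "scaleC :: complex \<Rightarrow> ('k \<Rightarrow>\<^sub>L 'k) \<Rightarrow> _" by (rule vector_space_scaleC)
  interpret p: vector_space_pair "scaleC :: complex \<Rightarrow> ('k \<Rightarrow>\<^sub>L 'k) \<Rightarrow> _"
    "scaleC :: complex \<Rightarrow> ('k \<Rightarrow>\<^sub>L 'k) \<Rightarrow> _" ..
  obtain B where B: "B \<subseteq> M" "va.independent B" "M \<subseteq> va.span B"
    by (rule va.maximal_independent_subset)
  obtain B' where B': "B \<subseteq> B'" "va.independent B'" "va.span B' = UNIV"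
    using va.maximal_independent_subset_extend[OF subset_UNIV B(2)] by (metis top.extremum_unique)
  \<comment> \<open>\<open>P\<close> kills the basis \<open>B\<close> of \<open>M\<close> and fixes
    the remaining vectors of \<open>B'\<close>, so its kernel is \<open>M\<close>. Its image of
    \<open>\<A>\<close> is a copy of the quotient inside the operator type, where
    \<open>primitive_ideals\<close> looks for representation spaces.\<close>
  define P where "P = p.construct B' (\<lambda>b. if b \<in> B then 0 else b)"
  interpret P: Vector_Spaces.linear scaleC scaleC P
    unfolding P_def by (rule p.linear_construct[OF B'(2)])
  have PM: "P x = 0" if "x \<in> M" for x
  proof -
    have "x \<in> va.span B" using that B by blast
    then show ?thesis
    proof (induction rule: va.span_induct_alt)
      case (step k x y)
      then have "P x = 0" using B'(1) unfolding P_def by (subst p.construct_basis[OF B'(2)]) auto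
      with step show ?case by (simp add: P.add P.scale)
    qed (simp add: P.zero)
  qed
  have Pd: "P x - x \<in> M" for x
  proof -
    have "x \<in> va.span B'" using B' by blast
    then show ?thesis
    proof (induction rule: va.span_induct_alt)
      case (step k x y)
      have "P x - x \<in> M"
        using step(1) B(1) csubspace_0[OF Ms] csubspace_minus[OF Ms] unfolding P_def
        by (subst p.construct_basis[OF B'(2)]) auto
      then have "k *\<^sub>C (P x - x) + (P y - y) \<in> M"
        using step csubspace_add[OF Ms] csubspace_scaleC[OF Ms] by blast
      then show ?case by (simp add: P.add P.scale va.scale_right_diff_distrib algebra_simps)
    qed (simp add: P.zero csubspace_0[OF Ms])
  qed
  define V where "V = P ` \<A>"
  define \<theta> :: "('k \<Rightarrow>\<^sub>L 'k) \<Rightarrow> ('k \<Rightarrow>\<^sub>L 'k) \<Rightarrow> ('k \<Rightarrow>\<^sub>L 'k)" where "\<theta> a v = P (a o\<^sub>L v)" for a v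
  have PA: "P x \<in> \<A>" if "x \<in> \<A>" for x
    using csubspace_add[OF sub subsetD[OF MA Pd[of x]] that] by simp
  have VA: "V \<subseteq> \<A>" using PA by (auto simp: V_def)
  have PP: "P (P x) = P x" for x using PM[OF Pd[of x]] by (simp add: P.diff)
  have PV: "P v = v" if "v \<in> V" for v using that PP by (auto simp: V_def)
  have P0: "P x = 0 \<longleftrightarrow> x \<in> M" for x
    using PM Pd[of x] csubspace_minus[OF Ms] by force
  have Pa: "P (a o\<^sub>L P x) = P (a o\<^sub>L x)" if "a \<in> \<A>" for a x
    using PM[OF Mi[OF that Pd[of x]]] by (simp add: P.diff blinfun_compose_arith)
  have irr: "irreducible_rep \<A> V \<theta>"
    unfolding irreducible_rep_def algebra_rep_def
  proof (intro conjI ballI allI impI)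
    show "csubspace V" unfolding V_def using sub P.subspace_image by blast
    show "\<theta> a v \<in> V" if "a \<in> \<A>" "v \<in> V" for a v
      using that VA mult by (auto simp: \<theta>_def V_def)
    \<comment> \<open>\<open>c c\<close> is congruent to \<open>c\<close> modulo \<open>M\<close>,
      so \<open>c\<close> does not kill its own class.\<close>
    have "c - (c o\<^sub>L c) \<in> M" by (rule mod[OF cA])
    then have "c o\<^sub>L c \<notin> M" using cM csubspace_add[OF Ms, of "c - (c o\<^sub>L c)" "c o\<^sub>L c"] by auto
    then show "\<exists>a\<in>\<A>. \<exists>v\<in>V. \<theta> a v \<noteq> 0"
      using cA by (intro bexI[of _ c] bexI[of _ "P c"]) (auto simp: \<theta>_def Pa P0 V_def)
    show "\<theta> a (k *\<^sub>C v) = k *\<^sub>C \<theta> a v" if "a \<in> \<A>" for a k v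
      using that by (simp add: \<theta>_def compose_scaleC P.scale)
    show "\<theta> (k *\<^sub>C a) v = k *\<^sub>C \<theta> a v" for a k v
      by (simp add: \<theta>_def scaleC_blinfun_compose P.scale)
    show "\<theta> (a o\<^sub>L b) v = \<theta> a (\<theta> b v)" if "a \<in> \<A>" for a b v
      using that by (simp add: \<theta>_def Pa blinfun_compose_assoc)
    fix W assume W: "csubspace W \<and> W \<subseteq> V \<and> (\<forall>a\<in>\<A>. \<forall>w\<in>W. \<theta> a w \<in> W)"
    define N where "N = {x \<in> \<A>. P x \<in> W}"
    have "N = M \<or> N = \<A>"
    proof (rule maxi)
      show "csubspace N" unfolding csubspace_def N_def
        using W csubspace_facts[OF sub] csubspace_facts[of W] by (auto simp: P.zero P.add P.scale)
      show "a o\<^sub>L n \<in> N" if "a \<in> \<A>" "n \<in> N" for a n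
      proof -
        have "\<theta> a (P n) \<in> W" using that W by (auto simp: N_def)
        then show ?thesis using that mult by (auto simp: N_def \<theta>_def Pa)
      qed
      show "M \<subseteq> N" using MA PM W csubspace_0[of W] by (auto simp: N_def)
    qed (auto simp: N_def)
    moreover have "W = P ` N" using W VA PV by (force simp: N_def image_iff subset_iff)
    moreover have "P ` M = {0}" using PM csubspace_0[OF Ms] by force
    ultimately show "W = {0} \<or> W = V" by (auto simp: V_def)
  qed (simp_all add: \<theta>_def blinfun_compose_arith P.add)
  have "\<theta> c (P c) = 0" using cA by (intro radicalD[OF c irr]) (simp add: V_def)
  then have "c o\<^sub>L c \<in> M" using cA by (simp add: \<theta>_def Pa P0)
  then show False using cM csubspace_add[OF Ms mod[OF cA], of "c o\<^sub>L c"] by simp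
qed

text \<open>Only operations of the algebra occur on the right, so invariance under an automorphism
  can be checked on quasi-inverses, without transporting representations.\<close>

lemma radical_iff_quasi_regular:
  "a \<in> jacobson_radical \<A> \<longleftrightarrow> a \<in> \<A> \<and> (\<forall>b\<in>\<A>. \<exists>d\<in>\<A>. (b o\<^sub>L a) + d = d o\<^sub>L (b o\<^sub>L a))"
proof (intro iffI conjI ballI)
  show "a \<in> \<A>" if "a \<in> jacobson_radical \<A>" using that radical_subset by (rule rev_subsetD)
  show "\<exists>d\<in>\<A>. (b o\<^sub>L a) + d = d o\<^sub>L (b o\<^sub>L a)" if "a \<in> jacobson_radical \<A>" "b \<in> \<A>" for b
    using radical_quasi_regular[OF radical_mult_left] that by blast
  assume a: "a \<in> \<A> \<and> (\<forall>b\<in>\<A>. \<exists>d\<in>\<A>. (b o\<^sub>L a) + d = d o\<^sub>L (b o\<^sub>L a))"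
  show "a \<in> jacobson_radical \<A>"
  proof (rule ccontr)
    assume "a \<notin> jacobson_radical \<A>"
    then obtain V :: "('k \<Rightarrow>\<^sub>L 'k) set" and \<theta> v b where irr: "irreducible_rep \<A> V \<theta>"
      and v: "v \<in> V" "v \<noteq> 0" and b: "b \<in> \<A>" and eq: "\<theta> (b o\<^sub>L a) v = v"
      using a not_radicalE by metis
    have aA: "a \<in> \<A>" using a by blast
    obtain d where d: "d \<in> \<A>" "(b o\<^sub>L a) + d = d o\<^sub>L (b o\<^sub>L a)" using a b by blast
    show False
      using left_quasi_regular_no_fixed_vector[OF irr v(1) mult[OF b aA] d eq] v(2) by contradiction
  qed
qed

end

section \<open>The algebra and its Fourier coefficients\<close>

lemma csubspace_bounded_linear_vimage:
  fixes g :: "('a::real_normed_vector \<Rightarrow>\<^sub>L 'b::complex_hilbert) \<Rightarrow> ('c::real_normed_vector \<Rightarrow>\<^sub>L 'd::complex_hilbert)"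
  assumes "csubspace S" "bounded_linear g" "\<And>c x. g (c *\<^sub>C x) = c *\<^sub>C g x"
  shows "csubspace (g -` S)"
proof -
  interpret bounded_linear g by (rule assms(2))
  show ?thesis using assms(1) unfolding csubspace_def vimage_def by (simp add: zero add assms(3))
qed

lemma closed_bounded_linear_vimage:
  fixes g :: "'a::real_normed_vector \<Rightarrow> 'b::real_normed_vector"
  assumes "closed S" "bounded_linear g"
  shows "closed (g -` S)"
  by (rule closed_vimage[OF assms(1) linear_continuous_on[OF assms(2)]])

lemma bounded_linear_scaleC_blinfun:
  "bounded_linear (\<lambda>T :: 'a::real_normed_vector \<Rightarrow>\<^sub>L 'b::complex_hilbert. c *\<^sub>C T)"
proof (rule bounded_linear_intro[where K = "cmod c"])
  show "c *\<^sub>C (r *\<^sub>R x) = r *\<^sub>R (c *\<^sub>C x)" for r and x :: "'a \<Rightarrow>\<^sub>L 'b"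
    by (simp add: scaleC_of_real[symmetric] scaleC_scaleC mult.commute)
  show "norm (c *\<^sub>C x) \<le> norm x * cmod c" for x :: "'a \<Rightarrow>\<^sub>L 'b"
    using norm_scaleC_blinfun[of c x] by (simp add: mult.commute)
qed (simp add: scaleC_add_right)

lemma csubspace_closure:
  fixes S :: "('a::real_normed_vector \<Rightarrow>\<^sub>L 'b::complex_hilbert) set"
  assumes S: "csubspace S"
  shows "csubspace (closure S)"
  unfolding csubspace_def
proof (intro conjI ballI allI)
  show "0 \<in> closure S" using csubspace_0[OF S] closure_subset by (rule rev_subsetD)
  fix x assume "x \<in> closure S"
  then obtain X where X: "\<And>n. X n \<in> S" "X \<longlonglongrightarrow> x" unfolding closure_sequential by blast
  show "c *\<^sub>C x \<in> closure S" for c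
    unfolding closure_sequential
    using bounded_linear.tendsto[OF bounded_linear_scaleC_blinfun X(2), of c] csubspace_scaleC[OF S X(1)]
    by (intro exI[of _ "\<lambda>n. c *\<^sub>C X n"]) simp
  fix y assume "y \<in> closure S"
  then obtain Y where Y: "\<And>n. Y n \<in> S" "Y \<longlonglongrightarrow> y" unfolding closure_sequential by blast
  show "x + y \<in> closure S"
    unfolding closure_sequential
    using tendsto_add[OF X(2) Y(2)] csubspace_add[OF S X(1) Y(1)]
    by (intro exI[of _ "\<lambda>n. X n + Y n"]) simp
qed

lemma bounded_linear_l2_component:
  "bounded_linear (\<lambda>T :: 'a::complex_hilbert l2 \<Rightarrow>\<^sub>L 'b::complex_hilbert l2. Rep_l2 (T x) m)"
proof (rule bounded_linear_compose[where f = "\<lambda>y. Rep_l2 y m"])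
  show "bounded_linear (\<lambda>y :: 'b l2. Rep_l2 y m)"
    by (rule bounded_linear_intro[where K = 1])
       (auto simp: plus_l2.rep_eq scaleR_l2.rep_eq component_le_norm_l2)
qed (rule blinfun.bounded_linear_left)

lemma blinfun_l2_eqI:
  "(\<And>x m. Rep_l2 (blinfun_apply S x) m = Rep_l2 (blinfun_apply T x) m) \<Longrightarrow> S = T"
  by (rule blinfun_eqI) (simp add: Rep_l2_inject[symmetric] fun_eq_iff)

lemma c0_diff: assumes "f \<in> c0" "g \<in> c0" shows "(\<lambda>x. f x - g x) \<in> c0"
  using c0_add[OF assms(1) c0_scale[OF assms(2), of "-1"]] by simp

lemma c0_uniform_limit:
  fixes f :: "nat \<Rightarrow> 'x::topological_space \<Rightarrow> complex"
  assumes f: "\<And>n. f n \<in> c0" and lim: "uniform_limit UNIV f g sequentially"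
  shows "g \<in> c0"
  unfolding c0_def mem_Collect_eq
proof (intro conjI allI impI)
  show "continuous_on UNIV g"
    by (rule uniform_limit_theorem[OF _ lim]) (auto intro: always_eventually c0_continuous f)
  fix e :: real assume "0 < e"
  then have e2: "0 < e/2" by simp
  from uniform_limitD[OF lim e2] obtain n where n: "\<And>x. dist (f n x) (g x) < e/2"
    unfolding eventually_sequentially by blast
  obtain K where K: "compact K" "\<And>x. x \<notin> K \<Longrightarrow> cmod (f n x) < e/2"
    using f[of n] e2 unfolding c0_def by blast
  have "cmod (g x) < e" if "x \<notin> K" for x
    using n[of x] K(2)[OF that] norm_triangle_ineq2[of "g x" "f n x"]
    unfolding dist_norm norm_minus_commute[of "f n x"] by linarith
  then show "\<exists>K. compact K \<and> (\<forall>x. x \<notin> K \<longrightarrow> cmod (g x) < e)" using K(1) by blast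
qed

locale crossed_product_system =
  fixes \<phi> :: "'x::topological_space \<Rightarrow> 'x"
    and \<rho> :: "('x \<Rightarrow> complex) \<Rightarrow> 'h::complex_hilbert \<Rightarrow>\<^sub>L 'h"
  assumes rep: "star_rep \<rho>" and inj: "inj_on \<rho> c0"
    and cont: "continuous_on UNIV \<phi>" and proper: "proper_map euclidean euclidean \<phi>"
begin

abbreviation "U \<equiv> cp_monom \<phi> \<rho>"
abbreviation "\<A> \<equiv> crossed_product \<phi> \<rho>"
abbreviation "E \<equiv> fourier_coeff \<phi> \<rho>"
abbreviation "e0 \<xi> \<equiv> etensor (\<xi>::'h) 0"

lemmas comp_c0 = c0_compose[OF cont proper]
lemmas Rep_U = Rep_cp_monom[OF rep cont proper]
lemmas norm_U = norm_cp_monom[OF rep cont proper]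

section \<open>Monomials and absolutely summable series\<close>

lemma rep_clinear: "f \<in> c0 \<Longrightarrow> blinfun_apply (\<rho> f) (c *\<^sub>C \<xi>) = c *\<^sub>C blinfun_apply (\<rho> f) \<xi>"
  using rep unfolding star_rep_def by blast

lemma pullback_c0: "f \<in> c0 \<Longrightarrow> (\<lambda>x. f ((\<phi> ^^ k) x)) \<in> c0"
  using comp_c0[of f k] by (simp add: comp_def)

lemma U_add: "f \<in> c0 \<Longrightarrow> g \<in> c0 \<Longrightarrow> U n (\<lambda>x. f x + g x) = U n f + U n g"
  by (rule blinfun_l2_eqI)
     (auto simp: Rep_U c0_add blinfun.add_left plus_l2.rep_eq comp_def pullback_c0 rep_add[OF rep])

lemma U_scale: "f \<in> c0 \<Longrightarrow> U n (\<lambda>x. c * f x) = c *\<^sub>C U n f"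
  by (rule blinfun_l2_eqI)
     (auto simp: Rep_U c0_scale scaleC_blinfun_apply scaleC_l2.rep_eq comp_def pullback_c0 rep_scale[OF rep])

lemma U_zero: "U n (\<lambda>_. 0) = 0"
  using U_scale[OF c0_zero, of n 0] by simp

lemma U_diff: assumes "f \<in> c0" "g \<in> c0" shows "U n (\<lambda>x. f x - g x) = U n f - U n g"
  using U_add[OF assms(1) c0_scale[OF assms(2), of "-1"]] U_scale[OF assms(2), of n "-1"]
  by (simp add: scaleC_minus_one)

lemma U_mult:
  assumes f: "f \<in> c0" and g: "g \<in> c0"
  shows "U n f o\<^sub>L U m g = U (n + m) (\<lambda>x. f ((\<phi> ^^ m) x) * g x)"
proof (rule blinfun_l2_eqI)
  fix x k
  have h: "(\<lambda>x. f ((\<phi> ^^ m) x) * g x) \<in> c0" by (intro c0_mult pullback_c0 f g)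
  show "Rep_l2 (blinfun_apply (U n f o\<^sub>L U m g) x) k
      = Rep_l2 (blinfun_apply (U (n + m) (\<lambda>x. f ((\<phi> ^^ m) x) * g x)) x) k"
  proof (cases "k < n + m")
    case True
    then show ?thesis by (auto simp: Rep_U f g h blinfun.zero_right)
  next
    case False
    \<comment> \<open>Entry \<open>j\<close> of the input reaches position \<open>k\<close>:
      \<open>U m g\<close> moves it to \<open>j + m\<close>, where \<open>f\<close> then acts
      composed with \<open>\<phi> ^^ (j + m)\<close>.\<close>
    define j where "j = k - n - m"
    have k: "k = j + n + m" using False by (simp add: j_def)
    have "(\<lambda>x. f ((\<phi> ^^ m) x) * g x) \<circ> \<phi> ^^ j = (\<lambda>x. (f \<circ> \<phi> ^^ (j + m)) x * (g \<circ> \<phi> ^^ j) x)"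
      by (simp add: fun_eq_iff add.commute[of j m] funpow_add)
    then have "\<rho> ((\<lambda>x. f ((\<phi> ^^ m) x) * g x) \<circ> \<phi> ^^ j) = \<rho> (f \<circ> \<phi> ^^ (j + m)) o\<^sub>L \<rho> (g \<circ> \<phi> ^^ j)"
      using rep_mult[OF rep comp_c0[OF f] comp_c0[OF g]] by simp
    then show ?thesis by (simp add: Rep_U f g h k)
  qed
qed

lemma U_clinear: "f \<in> c0 \<Longrightarrow> blinfun_apply (U n f) (c *\<^sub>C x) = c *\<^sub>C blinfun_apply (U n f) x"
  by (auto simp: Rep_l2_inject[symmetric] fun_eq_iff Rep_U scaleC_l2.rep_eq rep_clinear comp_c0)

lemma ell1_c0: "F \<in> ell1 \<Longrightarrow> F n \<in> c0"
  by (simp add: ell1_def)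

lemma ell1_add:
  assumes F: "F \<in> ell1" and G: "G \<in> ell1"
  shows "(\<lambda>n x. F n x + G n x) \<in> ell1"
  unfolding ell1_def mem_Collect_eq
proof (intro conjI allI)
  show c: "(\<lambda>x. F n x + G n x) \<in> c0" for n by (intro c0_add ell1_c0 F G)
  show "summable (\<lambda>n. supnorm (\<lambda>x. F n x + G n x))"
  proof (rule summable_comparison_test'[where N = 0])
    show "summable (\<lambda>n. supnorm (F n) + supnorm (G n))"
      using F G by (intro summable_add) (auto simp: ell1_def)
    have "supnorm (\<lambda>x. F n x + G n x) \<le> supnorm (F n) + supnorm (G n)" for n
    proof (rule supnorm_leI)
      show "cmod (F n x + G n x) \<le> supnorm (F n) + supnorm (G n)" for x
        by (intro order.trans[OF norm_triangle_ineq] add_mono le_supnorm ell1_c0 F G)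
    qed
    then show "norm (supnorm (\<lambda>x. F n x + G n x)) \<le> supnorm (F n) + supnorm (G n)" for n
      using supnorm_nonneg[OF c] by simp
  qed
qed

lemma ell1_scale:
  assumes F: "F \<in> ell1"
  shows "(\<lambda>n x. c * F n x) \<in> ell1"
  unfolding ell1_def mem_Collect_eq
proof (intro conjI allI)
  show c: "(\<lambda>x. c * F n x) \<in> c0" for n by (intro c0_scale ell1_c0 F)
  show "summable (\<lambda>n. supnorm (\<lambda>x. c * F n x))"
  proof (rule summable_comparison_test'[where N = 0])
    show "summable (\<lambda>n. cmod c * supnorm (F n))"
      using F by (intro summable_mult) (auto simp: ell1_def)
    have "supnorm (\<lambda>x. c * F n x) \<le> cmod c * supnorm (F n)" for n
      by (rule supnorm_leI) (auto simp: norm_mult intro!: mult_left_mono le_supnorm ell1_c0 F)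
    then show "norm (supnorm (\<lambda>x. c * F n x)) \<le> cmod c * supnorm (F n)" for n
      using supnorm_nonneg[OF c] by simp
  qed
qed

lemma ell1_single:
  assumes "f \<in> c0"
  shows "(\<lambda>k. if k = n then f else (\<lambda>_. 0)) \<in> ell1"
  unfolding ell1_def mem_Collect_eq
proof (intro conjI allI)
  show "summable (\<lambda>k. supnorm (if k = n then f else (\<lambda>_. 0)))"
    by (rule summable_finite[of "{n}"]) (auto simp: supnorm_def)
qed (auto simp: assms c0_zero)

lemma cp_rep_add:
  assumes F: "F \<in> ell1" and G: "G \<in> ell1"
  shows "cp_rep \<phi> \<rho> (\<lambda>n x. F n x + G n x) = cp_rep \<phi> \<rho> F + cp_rep \<phi> \<rho> G"
  unfolding cp_rep_def
  by (subst suminf_add[OF cp_rep_summable[OF rep cont proper F] cp_rep_summable[OF rep cont proper G]])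
     (simp add: U_add ell1_c0 F G)

lemma cp_rep_scale:
  assumes F: "F \<in> ell1"
  shows "cp_rep \<phi> \<rho> (\<lambda>n x. c * F n x) = c *\<^sub>C cp_rep \<phi> \<rho> F"
  unfolding cp_rep_def
  by (subst bounded_linear.suminf[OF bounded_linear_scaleC_blinfun cp_rep_summable[OF rep cont proper F]])
     (simp add: U_scale ell1_c0 F)

lemma cp_rep_single:
  assumes "f \<in> c0"
  shows "cp_rep \<phi> \<rho> (\<lambda>k. if k = n then f else (\<lambda>_. 0)) = U n f"
  unfolding cp_rep_def by (subst suminf_finite[of "{n}"]) (auto simp: U_zero)

section \<open>The norm closure: approximation by polynomials, products\<close>

lemma csubspace_crossed_product: "csubspace \<A>"
  unfolding crossed_product_def
proof (rule csubspace_closure)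
  show "csubspace (cp_rep \<phi> \<rho> ` ell1)"
    unfolding csubspace_def
  proof (intro conjI ballI allI)
    have z: "cp_rep \<phi> \<rho> (\<lambda>k. if k = 0 then (\<lambda>_. 0) else (\<lambda>_. 0)) = 0"
      unfolding cp_rep_single[OF c0_zero] by (rule U_zero)
    show "0 \<in> cp_rep \<phi> \<rho> ` ell1"
      by (rule image_eqI[where f = "cp_rep \<phi> \<rho>", OF z[symmetric] ell1_single[OF c0_zero]])
    fix S assume "S \<in> cp_rep \<phi> \<rho> ` ell1"
    then obtain F where F: "F \<in> ell1" "S = cp_rep \<phi> \<rho> F" by blast
    show "c *\<^sub>C S \<in> cp_rep \<phi> \<rho> ` ell1" for c
      unfolding F(2) cp_rep_scale[OF F(1), symmetric] by (rule imageI[OF ell1_scale[OF F(1)]])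
    fix T assume "T \<in> cp_rep \<phi> \<rho> ` ell1"
    then obtain G where G: "G \<in> ell1" "T = cp_rep \<phi> \<rho> G" by blast
    show "S + T \<in> cp_rep \<phi> \<rho> ` ell1"
      unfolding F(2) G(2) cp_rep_add[OF F(1) G(1), symmetric] by (rule imageI[OF ell1_add[OF F(1) G(1)]])
  qed
qed

lemma closed_crossed_product: "closed \<A>"
  by (simp add: crossed_product_def)

lemma cp_rep_mem: "F \<in> ell1 \<Longrightarrow> cp_rep \<phi> \<rho> F \<in> \<A>"
  unfolding crossed_product_def by (rule subsetD[OF closure_subset imageI])

lemma U_mem: "f \<in> c0 \<Longrightarrow> U n f \<in> \<A>"
  using cp_rep_mem[OF ell1_single, of f n] by (simp add: cp_rep_single)

lemma cp_rep_in_closed_subspace: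
  assumes S: "csubspace S" "closed S" and F: "F \<in> ell1" and U: "\<And>n. U n (F n) \<in> S"
  shows "cp_rep \<phi> \<rho> F \<in> S"
proof (rule closed_sequentially[OF S(2)])
  show "(\<Sum>n<N. U n (F n)) \<in> S" for N by (rule csubspace_sum[OF S(1) U])
  show "(\<lambda>N. \<Sum>n<N. U n (F n)) \<longlonglongrightarrow> cp_rep \<phi> \<rho> F"
    unfolding cp_rep_def by (rule summable_LIMSEQ[OF cp_rep_summable[OF rep cont proper F]])
qed

text \<open>Serves as the induction principle of the algebra: a property that defines a closed
  complex subspace only has to be checked on monomials.\<close>

lemma crossed_product_minimal:
  assumes S: "csubspace S" "closed S" and U: "\<And>n f. f \<in> c0 \<Longrightarrow> U n f \<in> S"
  shows "\<A> \<subseteq> S"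
  unfolding crossed_product_def
proof (rule closure_minimal[OF image_subsetI S(2)])
  show "cp_rep \<phi> \<rho> F \<in> S" if "F \<in> ell1" for F
    by (rule cp_rep_in_closed_subspace[OF S that U[OF ell1_c0[OF that]]])
qed

lemma crossed_product_approx:
  assumes A: "A \<in> \<A>" and e: "0 < e"
  obtains F N where "\<And>n. F n \<in> c0" "\<And>n. N \<le> n \<Longrightarrow> F n = (\<lambda>_. 0)"
    "norm (A - (\<Sum>n<N. U n (F n))) < e"
proof -
  have e2: "0 < e/2" using e by simp
  then obtain T where T: "T \<in> cp_rep \<phi> \<rho> ` ell1" "dist T A < e/2"
    using A unfolding crossed_product_def closure_approachable by blast
  then obtain F where F: "F \<in> ell1" and TF: "T = cp_rep \<phi> \<rho> F" by blast
  have "(\<lambda>N. \<Sum>n<N. U n (F n)) \<longlonglongrightarrow> T"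
    unfolding TF cp_rep_def by (rule summable_LIMSEQ[OF cp_rep_summable[OF rep cont proper F]])
  then obtain N where N: "norm ((\<Sum>n<N. U n (F n)) - T) < e/2"
    using LIMSEQ_D[OF _ e2] by blast
  define G where "G n = (if n < N then F n else (\<lambda>_. 0))" for n
  have s: "(\<Sum>n<N. U n (G n)) = (\<Sum>n<N. U n (F n))" by (rule sum.cong) (auto simp: G_def)
  show ?thesis
  proof (rule that)
    show "G n \<in> c0" for n by (simp add: G_def ell1_c0[OF F] c0_zero)
    show "G n = (\<lambda>_. 0)" if "N \<le> n" for n using that by (simp add: G_def)
    have "A - (\<Sum>n<N. U n (F n)) = - (T - A) - ((\<Sum>n<N. U n (F n)) - T)" by simp
    then have "norm (A - (\<Sum>n<N. U n (F n))) \<le> norm (T - A) + norm ((\<Sum>n<N. U n (F n)) - T)"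
      using norm_triangle_ineq4[of "- (T - A)"] by (simp only: norm_minus_cancel)
    then show "norm (A - (\<Sum>n<N. U n (G n))) < e"
      unfolding s using N T(2) unfolding dist_norm by linarith
  qed
qed

lemma crossed_product_clinear:
  assumes "A \<in> \<A>"
  shows "blinfun_apply A (c *\<^sub>C x) = c *\<^sub>C blinfun_apply A x"
proof -
  let ?S = "{A :: 'h l2 \<Rightarrow>\<^sub>L 'h l2. \<forall>c x. A (c *\<^sub>C x) = c *\<^sub>C A x}"
  have "\<A> \<subseteq> ?S"
  proof (rule crossed_product_minimal)
    show "csubspace ?S"
      unfolding csubspace_def
      by (auto simp: blinfun.add_left scaleC_add_right scaleC_blinfun_apply scaleC_scaleC mult.commute)
    have "?S = (\<Inter>c. \<Inter>x. {A :: 'h l2 \<Rightarrow>\<^sub>L 'h l2. A (c *\<^sub>C x) = c *\<^sub>C A x})" by auto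
    also have "closed \<dots>"
      by (intro closed_INT ballI closed_Collect_eq linear_continuous_on
          bounded_linear_compose[OF bounded_linear_scaleC] blinfun.bounded_linear_left)
    finally show "closed ?S" .
  qed (simp add: U_clinear)
  then show ?thesis using assms by blast
qed

lemma compose_scaleC_right: "A \<in> \<A> \<Longrightarrow> A o\<^sub>L (c *\<^sub>C B) = c *\<^sub>C (A o\<^sub>L B)"
  by (rule blinfun_eqI) (simp add: scaleC_blinfun_apply crossed_product_clinear)

lemma crossed_product_mult:
  assumes A: "A \<in> \<A>" and B: "B \<in> \<A>"
  shows "A o\<^sub>L B \<in> \<A>"
proof -
  have 1: "A o\<^sub>L U m g \<in> \<A>" if g: "g \<in> c0" for m g
  proof -
    have "\<A> \<subseteq> (\<lambda>A. A o\<^sub>L U m g) -` \<A>"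
    proof (rule crossed_product_minimal)
      show "csubspace ((\<lambda>A. A o\<^sub>L U m g) -` \<A>)"
        by (rule csubspace_bounded_linear_vimage[OF csubspace_crossed_product
              bounded_linear_blinfun_compose_left scaleC_blinfun_compose])
      show "closed ((\<lambda>A. A o\<^sub>L U m g) -` \<A>)"
        by (rule closed_bounded_linear_vimage[OF closed_crossed_product bounded_linear_blinfun_compose_left])
      show "U n f \<in> (\<lambda>A. A o\<^sub>L U m g) -` \<A>" if "f \<in> c0" for n f
        using that g by (simp add: U_mult U_mem c0_mult pullback_c0)
    qed
    then show ?thesis using A by blast
  qed
  have "\<A> \<subseteq> (\<lambda>B. A o\<^sub>L B) -` \<A>"
  proof (rule crossed_product_minimal)
    show "csubspace ((\<lambda>B. A o\<^sub>L B) -` \<A>)"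
      by (rule csubspace_bounded_linear_vimage[OF csubspace_crossed_product
            bounded_linear_blinfun_compose_right compose_scaleC_right[OF A]])
    show "closed ((\<lambda>B. A o\<^sub>L B) -` \<A>)"
      by (rule closed_bounded_linear_vimage[OF closed_crossed_product bounded_linear_blinfun_compose_right])
  qed (simp add: 1)
  then show ?thesis using B by blast
qed

sublocale closed_operator_algebra "crossed_product \<phi> \<rho>"
  by standard (fact csubspace_crossed_product closed_crossed_product crossed_product_mult
      crossed_product_clinear)+

text \<open>In the column at index 0 the coefficients appear without composition with
  \<open>\<phi>\<close>. The identity holds on \<open>ell1\<close> and passes to limits because
  \<open>\<rho>\<close> is contractive. With the injectivity of \<open>\<rho>\<close> it replaces
  the \<open>THE\<close> in the definition of the coefficients.\<close>

lemma fourier_component: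
  assumes A: "A \<in> \<A>"
  shows E_c0: "E m A \<in> c0" and component_e0: "Rep_l2 (blinfun_apply A (e0 \<xi>)) m = blinfun_apply (\<rho> (E m A)) \<xi>"
proof -
  obtain F where F: "\<And>j. F j \<in> ell1" "(\<lambda>j. cp_rep \<phi> \<rho> (F j)) \<longlonglongrightarrow> A"
    "\<And>m. uniform_limit UNIV (\<lambda>j. F j m) (E m A) sequentially"
    using fourier_coeff_exists[OF rep cont proper inj A] by metis
  show c: "E m A \<in> c0" by (rule c0_uniform_limit[OF ell1_c0[OF F(1)] F(3)])
  have "(\<lambda>j. \<rho> (F j m)) \<longlonglongrightarrow> \<rho> (E m A)"
  proof (rule LIMSEQ_I)
    fix r :: real assume "0 < r"
    then have r2: "0 < r/2" by simp
    from uniform_limitD[OF F(3) r2] obtain N where N: "\<And>j x. j \<ge> N \<Longrightarrow> dist (F j m x) (E m A x) < r/2"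
      unfolding eventually_sequentially by blast
    have "norm (\<rho> (F j m) - \<rho> (E m A)) < r" if "j \<ge> N" for j
    proof -
      have "\<rho> (\<lambda>x. F j m x - E m A x) = \<rho> (F j m) - \<rho> (E m A)"
        using rep_add[OF rep ell1_c0[OF F(1)] c0_scale[OF c, of "-1"]] rep_scale[OF rep c, of "-1"]
        by (simp add: scaleC_minus_one)
      moreover have "norm (\<rho> (\<lambda>x. F j m x - E m A x)) \<le> supnorm (\<lambda>x. F j m x - E m A x)"
        by (intro rep_contraction[OF rep] c0_diff c ell1_c0 F)
      moreover have "supnorm (\<lambda>x. F j m x - E m A x) \<le> r/2"
        using N[OF that] by (intro supnorm_leI) (auto simp: dist_norm intro: less_imp_le)
      ultimately show ?thesis using r2 by simp
    qed
    then show "\<exists>N. \<forall>j\<ge>N. norm (\<rho> (F j m) - \<rho> (E m A)) < r" by blast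
  qed
  from bounded_linear.tendsto[OF blinfun.bounded_linear_left this, of \<xi>]
  have "(\<lambda>j. Rep_l2 (blinfun_apply (cp_rep \<phi> \<rho> (F j)) (e0 \<xi>)) m) \<longlonglongrightarrow> \<rho> (E m A) \<xi>"
    by (simp add: cp_rep_component[OF rep cont proper F(1)])
  moreover have "(\<lambda>j. Rep_l2 (blinfun_apply (cp_rep \<phi> \<rho> (F j)) (e0 \<xi>)) m) \<longlonglongrightarrow> Rep_l2 (A (e0 \<xi>)) m"
    by (rule bounded_linear.tendsto[OF bounded_linear_l2_component F(2)])
  ultimately show "Rep_l2 (A (e0 \<xi>)) m = \<rho> (E m A) \<xi>" using LIMSEQ_unique by blast
qed

lemma E_eqI:
  assumes A: "A \<in> \<A>" and g: "g \<in> c0" and eq: "\<And>\<xi>. Rep_l2 (blinfun_apply A (e0 \<xi>)) m = blinfun_apply (\<rho> g) \<xi>"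
  shows "E m A = g"
proof -
  have "\<rho> (E m A) = \<rho> g" by (rule blinfun_eqI) (simp add: eq[symmetric] component_e0[OF A])
  then show ?thesis using inj E_c0[OF A] g by (auto dest: inj_onD)
qed

lemma E_add: "A \<in> \<A> \<Longrightarrow> B \<in> \<A> \<Longrightarrow> E m (A + B) = (\<lambda>x. E m A x + E m B x)"
  by (rule E_eqI)
     (simp_all add: csubspace_add[OF sub] c0_add E_c0 blinfun.add_left plus_l2.rep_eq component_e0 rep_add[OF rep])

lemma E_scale: "A \<in> \<A> \<Longrightarrow> E m (c *\<^sub>C A) = (\<lambda>x. c * E m A x)"
  by (rule E_eqI)
     (simp_all add: csubspace_scaleC[OF sub] c0_scale E_c0 scaleC_blinfun_apply scaleC_l2.rep_eq component_e0
       rep_scale[OF rep])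

lemma E_diff: "A \<in> \<A> \<Longrightarrow> B \<in> \<A> \<Longrightarrow> E m (A - B) = (\<lambda>x. E m A x - E m B x)"
  using E_add[of A "(-1) *\<^sub>C B" m] E_scale[of B m "-1"] csubspace_scaleC[OF sub, of B "-1"]
  by (simp add: scaleC_minus_one)

lemma E_U: "f \<in> c0 \<Longrightarrow> E m (U n f) = (if m = n then f else (\<lambda>_. 0))"
  by (rule E_eqI) (auto simp: U_mem c0_zero Rep_U etensor.rep_eq comp_def rep_zero[OF rep] blinfun.zero_right)

lemma E_sum_U:
  assumes "\<And>n. F n \<in> c0" "m < N"
  shows "E m (\<Sum>n<N. U n (F n)) = F m"
proof -
  have *: "(\<Sum>n<N. U n (F n)) \<in> \<A> \<and> E m (\<Sum>n<N. U n (F n)) = (if m < N then F m else (\<lambda>_. 0))" for N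
  proof (induction N)
    case 0
    have "E m 0 = (\<lambda>_. 0)" using E_U[OF c0_zero, of m m] by (simp add: U_zero)
    then show ?case using csubspace_0[OF sub] by simp
  next
    case (Suc N)
    then show ?case using assms by (auto simp: E_add U_mem E_U csubspace_add[OF sub] fun_eq_iff)
  qed
  show ?thesis using *[of N] assms by simp
qed

lemma E_bound:
  assumes A: "A \<in> \<A>"
  shows "cmod (E m A x) \<le> norm A"
proof -
  have "norm (\<rho> (E m A)) \<le> norm A"
  proof (rule norm_blinfun_bound)
    fix \<xi>
    have "norm (\<rho> (E m A) \<xi>) \<le> norm (A (e0 \<xi>))"
      unfolding component_e0[OF A, symmetric] by (rule component_le_norm_l2)
    also have "\<dots> \<le> norm A * norm (e0 \<xi>)" by (rule norm_blinfun)
    finally show "norm (\<rho> (E m A) \<xi>) \<le> norm A * norm \<xi>" by (simp add: norm_etensor[OF rep cont proper])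
  qed simp
  then show ?thesis
    using le_supnorm[OF E_c0[OF A], of m x] unfolding rep_isometry[OF rep inj E_c0[OF A]] by simp
qed

lemma supnorm_E: "A \<in> \<A> \<Longrightarrow> supnorm (E m A) \<le> norm A"
  by (intro supnorm_leI E_bound)

lemma E_tendsto:
  assumes A: "\<And>j. A j \<in> \<A>" and lim: "A \<longlonglongrightarrow> B"
  shows "(\<lambda>j. E m (A j) x) \<longlonglongrightarrow> E m B x"
proof (rule LIM_zero_cancel, rule Lim_null_comparison)
  have B: "B \<in> \<A>" by (rule closed_sequentially[OF closed A lim])
  show "\<forall>\<^sub>F j in sequentially. norm (E m (A j) x - E m B x) \<le> norm (A j - B)"
    using E_bound[OF csubspace_diff[OF sub A B], where m = m and x = x]
    by (intro always_eventually allI) (simp add: E_diff A B)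
  show "(\<lambda>j. norm (A j - B)) \<longlonglongrightarrow> 0" using lim by (simp add: LIM_zero tendsto_norm_zero)
qed

text \<open>A convolution twisted by \<open>\<phi>\<close>. Both sides are linear and continuous in
  each factor, so the formula spreads from monomials one factor at a time: \<open>1\<close> frees
  the left factor, the second use of \<open>crossed_product_minimal\<close> the right one.\<close>

lemma E_mult:
  assumes A: "A \<in> \<A>" and B: "B \<in> \<A>"
  shows "E N (A o\<^sub>L B) x = (\<Sum>i\<le>N. E (N - i) A ((\<phi> ^^ i) x) * E i B x)"
proof -
  have 1: "E N (A o\<^sub>L U m g) x = (\<Sum>i\<le>N. E (N - i) A ((\<phi> ^^ i) x) * E i (U m g) x)"
    if A: "A \<in> \<A>" and g: "g \<in> c0" for A m g N x
  proof -
    let ?S = "{A \<in> \<A>. \<forall>N x. E N (A o\<^sub>L U m g) x = (\<Sum>i\<le>N. E (N - i) A ((\<phi> ^^ i) x) * E i (U m g) x)}"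
    note Ug = U_mem[OF g, of m]
    have "\<A> \<subseteq> ?S"
    proof (rule crossed_product_minimal)
      show "csubspace ?S"
        unfolding csubspace_def
      proof (intro conjI ballI allI)
        show "0 \<in> ?S" using E_scale[OF Ug, where c = 0] csubspace_0[OF sub] by simp
        show "A + B \<in> ?S" if "A \<in> ?S" "B \<in> ?S" for A B
          using that by (simp add: csubspace_add[OF sub] blinfun_compose_arith E_add mult Ug sum.distrib distrib_right)
        show "c *\<^sub>C A \<in> ?S" if "A \<in> ?S" for A c
          using that by (simp add: csubspace_scaleC[OF sub] scaleC_blinfun_compose E_scale mult Ug sum_distrib_left mult.assoc)
      qed
      show "closed ?S"
      proof (rule closed_sequential_limits[THEN iffD2], intro allI impI, elim conjE)
        fix T l assume T: "\<forall>n. T n \<in> ?S" and lim: "T \<longlonglongrightarrow> l"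
        have TA: "T n \<in> \<A>" for n using T by simp
        have l: "l \<in> \<A>" by (rule closed_sequentially[OF closed TA lim])
        have "E N (l o\<^sub>L U m g) x = (\<Sum>i\<le>N. E (N - i) l ((\<phi> ^^ i) x) * E i (U m g) x)" for N x
        proof (rule LIMSEQ_unique)
          show "(\<lambda>n. E N (T n o\<^sub>L U m g) x) \<longlonglongrightarrow> E N (l o\<^sub>L U m g) x"
            by (intro E_tendsto mult TA Ug bounded_linear.tendsto[OF bounded_linear_blinfun_compose_left lim])
          have "(\<lambda>n. \<Sum>i\<le>N. E (N - i) (T n) ((\<phi> ^^ i) x) * E i (U m g) x)
              \<longlonglongrightarrow> (\<Sum>i\<le>N. E (N - i) l ((\<phi> ^^ i) x) * E i (U m g) x)"
            by (intro tendsto_intros E_tendsto TA lim)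
          then show "(\<lambda>n. E N (T n o\<^sub>L U m g) x)
              \<longlonglongrightarrow> (\<Sum>i\<le>N. E (N - i) l ((\<phi> ^^ i) x) * E i (U m g) x)"
            using T by simp
        qed
        then show "l \<in> ?S" using l by simp
      qed
      show "U n f \<in> ?S" if f: "f \<in> c0" for n f
      proof -
        have "E N (U n f o\<^sub>L U m g) x = (\<Sum>i\<le>N. E (N - i) (U n f) ((\<phi> ^^ i) x) * E i (U m g) x)" for N x
        proof -
          have "(\<Sum>i\<le>N. E (N - i) (U n f) ((\<phi> ^^ i) x) * E i (U m g) x)
              = (\<Sum>i\<le>N. if i = m then (if N - m = n then f ((\<phi> ^^ m) x) * g x else 0) else 0)"
            by (rule sum.cong) (auto simp: E_U f g)
          also have "\<dots> = (if N = n + m then f ((\<phi> ^^ m) x) * g x else 0)"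
            by (auto simp: sum.delta)
          finally show ?thesis
            by (simp add: U_mult f g E_U c0_mult pullback_c0)
        qed
        then show ?thesis using f by (simp add: U_mem)
      qed
    qed
    then show ?thesis using A by blast
  qed
  let ?S = "{B \<in> \<A>. \<forall>N x. E N (A o\<^sub>L B) x = (\<Sum>i\<le>N. E (N - i) A ((\<phi> ^^ i) x) * E i B x)}"
  have "\<A> \<subseteq> ?S"
  proof (rule crossed_product_minimal)
    show "csubspace ?S"
      unfolding csubspace_def
    proof (intro conjI ballI allI)
      show "0 \<in> ?S" using E_scale[OF A, where c = 0] csubspace_0[OF sub] by simp
      show "B + C \<in> ?S" if "B \<in> ?S" "C \<in> ?S" for B C
        using that by (simp add: csubspace_add[OF sub] blinfun_compose_arith E_add mult A sum.distrib distrib_left)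
      show "c *\<^sub>C B \<in> ?S" if "B \<in> ?S" for B c
        using that by (simp add: csubspace_scaleC[OF sub] compose_scaleC A E_scale mult sum_distrib_left mult_ac)
    qed
    show "closed ?S"
    proof (rule closed_sequential_limits[THEN iffD2], intro allI impI, elim conjE)
      fix T l assume T: "\<forall>n. T n \<in> ?S" and lim: "T \<longlonglongrightarrow> l"
      have TA: "T n \<in> \<A>" for n using T by simp
      have l: "l \<in> \<A>" by (rule closed_sequentially[OF closed TA lim])
      have "E N (A o\<^sub>L l) x = (\<Sum>i\<le>N. E (N - i) A ((\<phi> ^^ i) x) * E i l x)" for N x
      proof (rule LIMSEQ_unique)
        show "(\<lambda>n. E N (A o\<^sub>L T n) x) \<longlonglongrightarrow> E N (A o\<^sub>L l) x"
          by (intro E_tendsto mult TA A bounded_linear.tendsto[OF bounded_linear_blinfun_compose_right lim])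
        have "(\<lambda>n. \<Sum>i\<le>N. E (N - i) A ((\<phi> ^^ i) x) * E i (T n) x)
            \<longlonglongrightarrow> (\<Sum>i\<le>N. E (N - i) A ((\<phi> ^^ i) x) * E i l x)"
          by (intro tendsto_intros E_tendsto TA lim)
        then show "(\<lambda>n. E N (A o\<^sub>L T n) x)
            \<longlonglongrightarrow> (\<Sum>i\<le>N. E (N - i) A ((\<phi> ^^ i) x) * E i l x)"
          using T by simp
      qed
      then show "l \<in> ?S" using l by simp
    qed
    show "U m g \<in> ?S" if "g \<in> c0" for m g
      using 1[OF A that] U_mem[OF that] by simp
  qed
  then show ?thesis using B by blast
qed

end

section \<open>The gauge action and Fejer means\<close>

text \<open>A monomial of degree \<open>n\<close> raises the index by \<open>n\<close>, so
  conjugation by this diagonal operator multiplies it by \<open>u ^ n\<close>. It is used for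
  \<open>cmod u = 1\<close>, when its inverse is \<open>gauge_unitary (cnj u)\<close>.\<close>

definition gauge_unitary :: "complex \<Rightarrow> 'h::complex_hilbert l2 \<Rightarrow>\<^sub>L 'h l2"
  where "gauge_unitary u = Blinfun (\<lambda>x. Abs_l2 (\<lambda>k. u ^ k *\<^sub>C Rep_l2 x k))"

lemma gauge_unitary:
  fixes x :: "'h::complex_hilbert l2"
  assumes u: "cmod u = 1"
  shows Rep_gauge_unitary: "Rep_l2 (blinfun_apply (gauge_unitary u) x) k = u ^ k *\<^sub>C Rep_l2 x k"
    and norm_gauge_unitary: "norm (gauge_unitary u :: 'h l2 \<Rightarrow>\<^sub>L 'h l2) \<le> 1"
proof -
  have R: "Rep_l2 (Abs_l2 (\<lambda>k. u ^ k *\<^sub>C Rep_l2 x k)) = (\<lambda>k. u ^ k *\<^sub>C Rep_l2 x k)" for x :: "'h l2"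
    using l2_summable[of x] by (simp add: Abs_l2_inverse norm_scaleC norm_power u)
  have n: "norm (Abs_l2 (\<lambda>k. u ^ k *\<^sub>C Rep_l2 x k)) \<le> norm x * 1" for x :: "'h l2"
    using partial_le_norm_l2[where x = x] by (intro norm_l2_leI) (simp_all add: R norm_scaleC norm_power u)
  have bl: "bounded_linear (\<lambda>x :: 'h l2. Abs_l2 (\<lambda>k. u ^ k *\<^sub>C Rep_l2 x k))"
  proof (rule bounded_linear_intro[OF _ _ n])
    fix x y :: "'h l2" and r :: real
    show "Abs_l2 (\<lambda>k. u ^ k *\<^sub>C Rep_l2 (x + y) k) = Abs_l2 (\<lambda>k. u ^ k *\<^sub>C Rep_l2 x k) + Abs_l2 (\<lambda>k. u ^ k *\<^sub>C Rep_l2 y k)"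
      unfolding Rep_l2_inject[symmetric] R by (simp only: plus_l2.rep_eq R scaleC_add_right)
    have "u ^ k *\<^sub>C (r *\<^sub>R z) = r *\<^sub>R (u ^ k *\<^sub>C z)" for k and z :: 'h
      by (simp add: scaleC_of_real[symmetric] scaleC_scaleC mult.commute)
    then show "Abs_l2 (\<lambda>k. u ^ k *\<^sub>C Rep_l2 (r *\<^sub>R x) k) = r *\<^sub>R Abs_l2 (\<lambda>k. u ^ k *\<^sub>C Rep_l2 x k)"
      unfolding Rep_l2_inject[symmetric] R by (simp only: scaleR_l2.rep_eq R)
  qed
  show "Rep_l2 (blinfun_apply (gauge_unitary u) x) k = u ^ k *\<^sub>C Rep_l2 x k"
    unfolding gauge_unitary_def bounded_linear_Blinfun_apply[OF bl] R ..
  show "norm (gauge_unitary u :: 'h l2 \<Rightarrow>\<^sub>L 'h l2) \<le> 1"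
    using n by (intro norm_blinfun_bound) (auto simp: gauge_unitary_def bounded_linear_Blinfun_apply[OF bl])
qed

definition gauge_action :: "complex \<Rightarrow> ('h::complex_hilbert l2 \<Rightarrow>\<^sub>L 'h l2) \<Rightarrow> ('h l2 \<Rightarrow>\<^sub>L 'h l2)"
  where "gauge_action u T = gauge_unitary u o\<^sub>L (T o\<^sub>L gauge_unitary (cnj u))"

lemma id_blinfun_compose: "id_blinfun o\<^sub>L T = T" "T o\<^sub>L id_blinfun = T"
  by (rule blinfun_eqI, simp)+

lemma gauge_unitary_cnj:
  assumes "cmod u = 1"
  shows "gauge_unitary (cnj u) o\<^sub>L gauge_unitary u = (id_blinfun :: 'h::complex_hilbert l2 \<Rightarrow>\<^sub>L 'h l2)"
proof (rule blinfun_l2_eqI)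
  have "cnj u ^ m * u ^ m = 1" for m
    using complex_norm_square[of u] assms by (simp add: power_mult_distrib[symmetric] mult.commute)
  then show "Rep_l2 (blinfun_apply (gauge_unitary (cnj u) o\<^sub>L gauge_unitary u) x) m
      = Rep_l2 (blinfun_apply id_blinfun x) m" for x :: "'h l2" and m
    using assms by (simp add: Rep_gauge_unitary scaleC_scaleC)
qed

lemma bounded_linear_gauge: "bounded_linear (gauge_action u)"
  unfolding gauge_action_def[abs_def]
  by (rule bounded_linear_compose[OF bounded_linear_blinfun_compose_right bounded_linear_blinfun_compose_left])

lemma gauge_scaleC:
  fixes T :: "'h::complex_hilbert l2 \<Rightarrow>\<^sub>L 'h l2"
  assumes "cmod u = 1"
  shows "gauge_action u (c *\<^sub>C T) = c *\<^sub>C gauge_action u T"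
  by (rule blinfun_l2_eqI)
     (simp add: gauge_action_def Rep_gauge_unitary assms scaleC_blinfun_apply scaleC_l2.rep_eq scaleC_scaleC mult.commute)

lemma gauge_compose:
  assumes "cmod u = 1"
  shows "gauge_action u (S o\<^sub>L T) = gauge_action u S o\<^sub>L gauge_action u T"
proof -
  have "gauge_action u S o\<^sub>L gauge_action u T = gauge_unitary u o\<^sub>L (S o\<^sub>L ((gauge_unitary (cnj u) o\<^sub>L gauge_unitary u)
      o\<^sub>L (T o\<^sub>L gauge_unitary (cnj u))))"
    unfolding gauge_action_def by (simp only: blinfun_compose_assoc)
  then show ?thesis
    unfolding gauge_unitary_cnj[OF assms] by (simp add: gauge_action_def blinfun_compose_assoc id_blinfun_compose)
qed

lemma gauge_cnj:
  assumes "cmod u = 1"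
  shows "gauge_action u (gauge_action (cnj u) T) = T"
proof -
  have c: "cmod (cnj u) = 1" using assms by simp
  have "gauge_action u (gauge_action (cnj u) T) = (gauge_unitary (cnj (cnj u)) o\<^sub>L gauge_unitary (cnj u))
      o\<^sub>L (T o\<^sub>L (gauge_unitary (cnj (cnj u)) o\<^sub>L gauge_unitary (cnj u)))"
    by (simp add: gauge_action_def blinfun_compose_assoc)
  then show ?thesis
    unfolding gauge_unitary_cnj[OF c] by (simp only: id_blinfun_compose)
qed

lemma norm_gauge:
  assumes "cmod u = 1"
  shows "norm (gauge_action u T) \<le> norm (T :: 'h::complex_hilbert l2 \<Rightarrow>\<^sub>L 'h l2)"
proof -
  let ?W = "gauge_unitary :: complex \<Rightarrow> 'h l2 \<Rightarrow>\<^sub>L 'h l2"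
  have c: "cmod (cnj u) = 1" using assms by simp
  have "norm (gauge_action u T) \<le> norm (?W u) * norm (T o\<^sub>L ?W (cnj u))"
    unfolding gauge_action_def by (rule norm_blinfun_compose)
  also have "\<dots> \<le> 1 * norm (T o\<^sub>L ?W (cnj u))"
    by (rule mult_right_mono[OF norm_gauge_unitary[OF assms] norm_ge_zero])
  also have "\<dots> \<le> norm T * norm (?W (cnj u))" using norm_blinfun_compose by simp
  also have "\<dots> \<le> norm T * 1" by (rule mult_left_mono[OF norm_gauge_unitary[OF c] norm_ge_zero])
  finally show ?thesis by simp
qed

section \<open>Roots of unity in place of integration over the circle\<close>

definition unit_root :: "nat \<Rightarrow> complex"
  where "unit_root M = exp (2 * of_real pi * \<i> / of_nat M)"

lemma unit_root_power: "unit_root M ^ a = exp (2 * of_real pi * \<i> * of_nat a / of_nat M)"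
  unfolding unit_root_def by (simp add: exp_of_nat_mult[symmetric] mult_ac)

lemma norm_unit_root [simp]: "cmod (unit_root M) = 1"
proof -
  have "unit_root M = exp (\<i> * of_real (2 * pi / real M))" unfolding unit_root_def by (simp add: mult_ac)
  then show ?thesis by (simp only: norm_exp_i_times)
qed

text \<open>A geometric sum of an \<open>M\<close>-th root of unity that is 1 only if
  \<open>a\<close> and \<open>b\<close> agree modulo \<open>M\<close>; the bounds turn this into
  \<open>a = b\<close>. Conjugates stand for negative exponents.\<close>

lemma unit_root_orthogonality:
  assumes "a < M" "b < M"
  shows "(\<Sum>j<M. (unit_root M ^ j) ^ a * cnj (unit_root M ^ j) ^ b) = (if a = b then of_nat M else 0)"
proof -
  define z where "z = unit_root M ^ a * cnj (unit_root M) ^ b"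
  have M: "1 \<le> M" using assms by simp
  have unit: "unit_root M ^ k * cnj (unit_root M) ^ k = 1" for k
    using complex_norm_square[of "unit_root M"] by (simp add: power_mult_distrib[symmetric])
  have rM: "unit_root M ^ M = 1" unfolding unit_root_power using M by (simp add: exp_eq_1)
  have "cnj (unit_root M) ^ M = cnj (unit_root M ^ M)" by simp
  then have crM: "cnj (unit_root M) ^ M = 1" unfolding rM by simp
  have "z ^ M = (unit_root M ^ M) ^ a * (cnj (unit_root M) ^ M) ^ b"
    by (simp add: z_def power_mult_distrib power_mult[symmetric] mult.commute)
  then have zM: "z ^ M = 1" by (simp add: rM crM)
  have s: "(\<Sum>j<M. (unit_root M ^ j) ^ a * cnj (unit_root M ^ j) ^ b) = (\<Sum>j<M. z ^ j)"
    by (rule sum.cong) (simp_all add: z_def power_mult_distrib power_mult[symmetric] mult.commute)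
  show ?thesis
  proof (cases "a = b")
    case True
    then have "z = 1" using unit by (simp add: z_def)
    then show ?thesis unfolding s using True by simp
  next
    case False
    have "z \<noteq> 1"
    proof
      assume "z = 1"
      then have "unit_root M ^ a * (cnj (unit_root M) ^ b * unit_root M ^ b) = unit_root M ^ b"
        unfolding z_def by (simp add: mult.assoc[symmetric])
      then have "unit_root M ^ a = unit_root M ^ b" using unit[of b] by (simp add: mult.commute)
      then show False
        using complex_root_unity_eq[OF M, of a b] assms False unfolding unit_root_power by simp
    qed
    then show ?thesis unfolding s using sum_gp_strict[of z M] False zM by simp
  qed
qed

context crossed_product_system
begin

lemma gauge_U:
  assumes u: "cmod u = 1" and f: "f \<in> c0"
  shows "gauge_action u (U n f) = u ^ n *\<^sub>C U n f"
proof (rule blinfun_l2_eqI)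
  have "u ^ m * cnj u ^ (m - n) = u ^ n" if "n \<le> m" for m
  proof -
    have "u ^ m = u ^ n * u ^ (m - n)" using that by (simp add: power_add[symmetric])
    moreover have "u ^ (m - n) * cnj u ^ (m - n) = 1"
      using complex_norm_square[of u] u by (simp add: power_mult_distrib[symmetric])
    ultimately show ?thesis by (simp add: mult.assoc)
  qed
  then show "Rep_l2 (blinfun_apply (gauge_action u (U n f)) x) m = Rep_l2 (blinfun_apply (u ^ n *\<^sub>C U n f) x) m" for x m
    using u f by (auto simp: gauge_action_def Rep_gauge_unitary Rep_U scaleC_blinfun_apply scaleC_l2.rep_eq
        rep_clinear comp_c0 scaleC_scaleC)
qed

lemma gauge_mem:
  assumes u: "cmod u = 1" and A: "A \<in> \<A>"
  shows "gauge_action u A \<in> \<A>"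
proof -
  have "\<A> \<subseteq> gauge_action u -` \<A>"
  proof (rule crossed_product_minimal)
    show "csubspace (gauge_action u -` \<A>)"
      by (rule csubspace_bounded_linear_vimage[OF sub bounded_linear_gauge gauge_scaleC[OF u]])
    show "closed (gauge_action u -` \<A>)"
      by (rule closed_bounded_linear_vimage[OF closed bounded_linear_gauge])
    show "U n f \<in> gauge_action u -` \<A>" if "f \<in> c0" for n f
      using that by (simp add: gauge_U u csubspace_scaleC[OF sub] U_mem)
  qed
  then show ?thesis using A by blast
qed

text \<open>The automorphism carries a quasi-inverse of
  \<open>gauge_action (cnj u) B o\<^sub>L A\<close> to one of
  \<open>B o\<^sub>L gauge_action u A\<close>.\<close>

lemma gauge_radical:
  assumes u: "cmod u = 1" and a: "A \<in> jacobson_radical \<A>"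
  shows "gauge_action u A \<in> jacobson_radical \<A>"
proof -
  have u': "cmod (cnj u) = 1" using u by simp
  have A: "A \<in> \<A>" using a radical_subset by (rule rev_subsetD)
  have "\<exists>d\<in>\<A>. (B o\<^sub>L gauge_action u A) + d = d o\<^sub>L (B o\<^sub>L gauge_action u A)" if B: "B \<in> \<A>" for B
  proof -
    let ?b = "gauge_action (cnj u) B"
    have b: "?b \<in> \<A>" by (rule gauge_mem[OF u' B])
    obtain d where d: "d \<in> \<A>" "(?b o\<^sub>L A) + d = d o\<^sub>L (?b o\<^sub>L A)"
      using a b unfolding radical_iff_quasi_regular by blast
    have "gauge_action u ((?b o\<^sub>L A) + d) = gauge_action u (d o\<^sub>L (?b o\<^sub>L A))" unfolding d(2) ..
    then have "(B o\<^sub>L gauge_action u A) + gauge_action u d = gauge_action u d o\<^sub>L (B o\<^sub>L gauge_action u A)"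
      by (simp add: linear_add[OF bounded_linear.linear[OF bounded_linear_gauge]] gauge_compose[OF u] gauge_cnj[OF u])
    then show ?thesis using gauge_mem[OF u d(1)] by blast
  qed
  then show ?thesis unfolding radical_iff_quasi_regular using gauge_mem[OF u A] by blast
qed

definition gauge_mean :: "(nat \<Rightarrow> complex) \<Rightarrow> nat \<Rightarrow> ('h l2 \<Rightarrow>\<^sub>L 'h l2) \<Rightarrow> ('h l2 \<Rightarrow>\<^sub>L 'h l2)"
  where "gauge_mean c M T = (\<Sum>j<M. c j *\<^sub>C gauge_action (unit_root M ^ j) T)"

lemma norm_gauge_mean: "norm (gauge_mean c M T) \<le> (\<Sum>j<M. cmod (c j)) * norm T"
  unfolding gauge_mean_def sum_distrib_right
proof (rule sum_norm_le)
  fix j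
  have "norm (c j *\<^sub>C gauge_action (unit_root M ^ j) T) \<le> cmod (c j) * norm (gauge_action (unit_root M ^ j) T)"
    by (rule norm_scaleC_blinfun)
  also have "\<dots> \<le> cmod (c j) * norm T" by (intro mult_left_mono norm_gauge) (simp_all add: norm_power)
  finally show "norm (c j *\<^sub>C gauge_action (unit_root M ^ j) T) \<le> cmod (c j) * norm T" .
qed

lemma gauge_mean_diff: "gauge_mean c M (S - T) = gauge_mean c M S - gauge_mean c M T"
  unfolding gauge_mean_def sum_subtractf[symmetric]
  by (simp add: linear_diff[OF bounded_linear.linear[OF bounded_linear_gauge]] scaleC_diff_right)

lemma gauge_mean_polynomial:
  assumes F: "\<And>n. F n \<in> c0"
  shows "gauge_mean c M (\<Sum>n<N. U n (F n)) = (\<Sum>n<N. (\<Sum>j<M. c j * (unit_root M ^ j) ^ n) *\<^sub>C U n (F n))"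
proof -
  have sumC: "(\<Sum>j\<in>I. f j) *\<^sub>C T = (\<Sum>j\<in>I. f j *\<^sub>C T)" for I :: "nat set" and f and T :: "'h l2 \<Rightarrow>\<^sub>L 'h l2"
    by (induction I rule: infinite_finite_induct) (simp_all add: scaleC_add_left)
  have sumR: "c *\<^sub>C (\<Sum>j\<in>I. T j) = (\<Sum>j\<in>I. c *\<^sub>C T j)" for I :: "nat set" and c and T :: "nat \<Rightarrow> 'h l2 \<Rightarrow>\<^sub>L 'h l2"
    by (induction I rule: infinite_finite_induct) (simp_all add: scaleC_add_right)
  have "gauge_mean c M (\<Sum>n<N. U n (F n)) = (\<Sum>j<M. \<Sum>n<N. (c j * (unit_root M ^ j) ^ n) *\<^sub>C U n (F n))"
    unfolding gauge_mean_def
    by (simp add: linear_sum[OF bounded_linear.linear[OF bounded_linear_gauge]] gauge_U norm_power F sumR scaleC_scaleC)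
  also have "\<dots> = (\<Sum>n<N. \<Sum>j<M. (c j * (unit_root M ^ j) ^ n) *\<^sub>C U n (F n))" by (rule sum.swap)
  finally show ?thesis by (simp only: sumC)
qed

text \<open>A finite mean cannot separate degrees congruent modulo \<open>M\<close>, so it isolates
  degree \<open>n\<close> exactly only in polynomials of degree below \<open>M\<close>. For
  \<open>A\<close> itself it is an approximation, with an \<open>M\<close> depending on the error,
  and closedness of the radical finishes.\<close>

lemma radical_homogeneous:
  assumes a: "A \<in> jacobson_radical \<A>"
  shows "U n (E n A) \<in> jacobson_radical \<A>"
proof -
  have A: "A \<in> \<A>" using a radical_subset by (rule rev_subsetD)
  have "U n (E n A) \<in> closure (jacobson_radical \<A>)"
    unfolding closure_approachable
  proof (intro allI impI)
    fix e :: real assume "0 < e"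
    then have e2: "0 < e/2" by simp
    obtain F N0 where F: "\<And>n. F n \<in> c0" "\<And>n. N0 \<le> n \<Longrightarrow> F n = (\<lambda>_. 0)"
      and AP0: "norm (A - (\<Sum>n<N0. U n (F n))) < e/2"
      using crossed_product_approx[OF A e2] by metis
    define M where "M = max N0 (Suc n)"
    have M: "n < M" by (simp add: M_def)
    have "(\<Sum>n<N0. U n (F n)) = (\<Sum>n<M. U n (F n))"
      by (rule sum.mono_neutral_left) (auto simp: M_def F(2) U_zero)
    then have AP: "norm (A - (\<Sum>n<M. U n (F n))) < e/2" using AP0 by simp
    let ?P = "\<Sum>n<M. U n (F n)"
    have P: "?P \<in> \<A>" by (rule csubspace_sum[OF sub U_mem[OF F(1)]])
    define c where "c j = cnj (unit_root M ^ j) ^ n / of_nat M" for j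
    have c1: "(\<Sum>j<M. cmod (c j)) = 1" using M by (simp add: c_def norm_divide norm_power)
    have "(\<Sum>j<M. c j * (unit_root M ^ j) ^ i) = (if i = n then 1 else 0)" if "i < M" for i
      using unit_root_orthogonality[OF that M] M
      by (simp add: c_def mult.commute sum_divide_distrib[symmetric])
    then have "gauge_mean c M ?P = (\<Sum>i<M. if i = n then U n (F n) else 0)"
      unfolding gauge_mean_polynomial[OF F(1)] by (intro sum.cong) auto
    then have GP: "gauge_mean c M ?P = U n (F n)" using M by simp
    have "norm (gauge_mean c M A - gauge_mean c M ?P) \<le> norm (A - ?P)"
      using norm_gauge_mean[of c M "A - ?P"] by (simp add: c1 gauge_mean_diff)
    moreover have "norm (U n (F n) - U n (E n A)) \<le> norm (A - ?P)"
    proof -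
      have "U n (F n) - U n (E n A) = U n (E n (?P - A))"
        by (simp add: E_diff P A E_sum_U F M U_diff E_c0)
      also have "norm \<dots> \<le> supnorm (E n (?P - A))"
        by (intro norm_U E_c0 csubspace_diff[OF sub P A])
      also have "\<dots> \<le> norm (A - ?P)"
        using supnorm_E[OF csubspace_diff[OF sub P A]] by (simp add: norm_minus_commute)
      finally show ?thesis .
    qed
    ultimately have "dist (gauge_mean c M A) (U n (E n A)) < e"
      using AP norm_triangle_ineq[of "gauge_mean c M A - U n (F n)" "U n (F n) - U n (E n A)"]
      unfolding dist_norm GP by simp
    moreover have "gauge_mean c M A \<in> jacobson_radical \<A>"
      unfolding gauge_mean_def
      by (intro csubspace_sum[OF radical_csubspace] csubspace_scaleC[OF radical_csubspace] gauge_radical a)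
         (simp add: norm_power)
    ultimately show "\<exists>y\<in>jacobson_radical \<A>. dist y (U n (E n A)) < e" by blast
  qed
  then show ?thesis using radical_closed by simp
qed

text \<open>The average of the partial sums of lengths 1 to \<open>D\<close>: degree
  \<open>n\<close> occurs in \<open>D - n\<close> of them.\<close>

definition fejer :: "nat \<Rightarrow> ('h l2 \<Rightarrow>\<^sub>L 'h l2) \<Rightarrow> ('h l2 \<Rightarrow>\<^sub>L 'h l2)"
  where "fejer D A = (\<Sum>n<D. (of_nat (D - n) / of_nat D) *\<^sub>C U n (E n A))"

lemma fejer_diff: "A \<in> \<A> \<Longrightarrow> B \<in> \<A> \<Longrightarrow> fejer D (A - B) = fejer D A - fejer D B"
  unfolding fejer_def sum_subtractf[symmetric]
  by (simp add: E_diff U_diff E_c0 scaleC_diff_right)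

text \<open>Poor as it is, this bound makes \<open>fejer D\<close> continuous for fixed
  \<open>D\<close>, so that contractivity extends from polynomials to the algebra.\<close>

lemma norm_fejer_crude:
  assumes A: "A \<in> \<A>"
  shows "norm (fejer D A) \<le> D * norm A"
proof -
  have "norm (fejer D A) \<le> (\<Sum>n<D. norm A)"
    unfolding fejer_def
  proof (rule sum_norm_le)
    fix n assume "n \<in> {..<D}"
    have "norm ((of_nat (D - n) / of_nat D) *\<^sub>C U n (E n A)) \<le> cmod (of_nat (D - n) / of_nat D) * norm (U n (E n A))"
      by (rule norm_scaleC_blinfun)
    also have "\<dots> \<le> 1 * norm (U n (E n A))"
      by (rule mult_right_mono) (auto simp: norm_divide divide_le_eq_1)
    also have "\<dots> \<le> norm A"
      using order.trans[OF norm_U[OF E_c0[OF A]] supnorm_E[OF A]] by simp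
    finally show "norm ((of_nat (D - n) / of_nat D) *\<^sub>C U n (E n A)) \<le> norm A" .
  qed
  then show ?thesis by simp
qed

lemma norm_fejer_polynomial:
  assumes F: "\<And>n. F n \<in> c0" "\<And>n. N \<le> n \<Longrightarrow> F n = (\<lambda>_. 0)" and D: "0 < D"
  shows "norm (fejer D (\<Sum>n<N. U n (F n))) \<le> norm (\<Sum>n<N. U n (F n))"
proof -
  define K where "K = max N D"
  \<comment> \<open>Degrees below \<open>K\<close>, shifted by less than \<open>D\<close>, stay
    below \<open>M\<close>, so orthogonality applies without wrapping around.\<close>
  define M where "M = K + D"
  have P: "(\<Sum>n<N. U n (F n)) = (\<Sum>n<K. U n (F n))"
    by (rule sum.mono_neutral_left) (auto simp: K_def F(2) U_zero)
  define s where "s j = (\<Sum>k<D. (unit_root M ^ j) ^ k)" for j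
  \<comment> \<open>The Fejer kernel, as a normalised square of the geometric sum
    \<open>s j\<close>. It is nonnegative, so the total modulus of the weights is their sum, which
    is the multiplier of degree 0, namely 1.\<close>
  define c where "c j = complex_of_real ((cmod (s j))\<^sup>2 / (real M * real D))" for j
  have M0: "0 < M" using D by (simp add: M_def)
  \<comment> \<open>The pairs \<open>k, l < D\<close> with \<open>k + i = l\<close> are counted;
    truncated subtraction gives 0 for \<open>D \<le> i\<close>.\<close>
  have coeff: "(\<Sum>j<M. c j * (unit_root M ^ j) ^ i) = of_nat (D - i) / of_nat D" if i: "i < K" for i
  proof -
    have cc: "c j = s j * cnj (s j) / (of_nat M * of_nat D)" for j
      unfolding c_def of_real_divide by (simp only: complex_norm_square) simp
    have ss: "s j * cnj (s j) * (unit_root M ^ j) ^ i = (\<Sum>k<D. \<Sum>l<D. (unit_root M ^ j) ^ (k + i) * cnj (unit_root M ^ j) ^ l)" for j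
    proof -
      have "s j * cnj (s j) = (\<Sum>k<D. \<Sum>l<D. (unit_root M ^ j) ^ k * cnj ((unit_root M ^ j) ^ l))"
        unfolding s_def cnj_sum by (rule sum_product)
      then show ?thesis by (simp add: sum_distrib_right sum_distrib_left power_add mult_ac)
    qed
    have "(\<Sum>j<M. s j * cnj (s j) * (unit_root M ^ j) ^ i)
        = (\<Sum>k<D. \<Sum>j<M. \<Sum>l<D. (unit_root M ^ j) ^ (k + i) * cnj (unit_root M ^ j) ^ l)"
      unfolding ss by (rule sum.swap)
    also have "\<dots> = (\<Sum>k<D. \<Sum>l<D. \<Sum>j<M. (unit_root M ^ j) ^ (k + i) * cnj (unit_root M ^ j) ^ l)"
      by (intro sum.cong sum.swap refl)
    also have "\<dots> = (\<Sum>k<D. \<Sum>l<D. if k + i = l then of_nat M else 0)"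
      using i by (intro sum.cong unit_root_orthogonality refl) (auto simp: M_def)
    also have "\<dots> = (\<Sum>k<D. if k + i < D then of_nat M else 0)"
      by (intro sum.cong refl) (simp add: sum.delta')
    also have "\<dots> = (\<Sum>k\<in>{..<D - i}. of_nat M)"
      by (rule sum.mono_neutral_cong_right) auto
    finally have "(\<Sum>j<M. s j * cnj (s j) * (unit_root M ^ j) ^ i) = of_nat (D - i) * of_nat M" by simp
    then show ?thesis
      using M0 by (simp add: cc sum_divide_distrib[symmetric] field_simps)
  qed
  have "(\<Sum>j<M. cmod (c j)) = cmod (\<Sum>j<M. c j)"
  proof -
    have "(\<Sum>j<M. c j) = of_real (\<Sum>j<M. (cmod (s j))\<^sup>2 / (real M * real D))"
      by (simp add: c_def)
    also have "cmod \<dots> = (\<Sum>j<M. (cmod (s j))\<^sup>2 / (real M * real D))"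
      unfolding norm_of_real by (simp add: sum_nonneg)
    finally show ?thesis unfolding c_def norm_of_real by simp
  qed
  also have "(\<Sum>j<M. c j) = 1" using coeff[of 0] D by (simp add: K_def)
  finally have c1: "(\<Sum>j<M. cmod (c j)) = 1" by simp
  have "gauge_mean c M (\<Sum>n<K. U n (F n)) = (\<Sum>n<K. (of_nat (D - n) / of_nat D) *\<^sub>C U n (F n))"
    unfolding gauge_mean_polynomial[OF F(1)] by (intro sum.cong) (simp_all add: coeff)
  also have "\<dots> = (\<Sum>n<D. (of_nat (D - n) / of_nat D) *\<^sub>C U n (F n))"
    by (rule sum.mono_neutral_right) (auto simp: K_def)
  also have "\<dots> = fejer D (\<Sum>n<K. U n (F n))"
    unfolding fejer_def by (intro sum.cong) (simp_all add: E_sum_U F(1) K_def)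
  finally have "fejer D (\<Sum>n<K. U n (F n)) = gauge_mean c M (\<Sum>n<K. U n (F n))" by simp
  then show ?thesis
    using norm_gauge_mean[of c M "\<Sum>n<K. U n (F n)"] by (simp add: P c1)
qed

lemma norm_fejer:
  assumes A: "A \<in> \<A>" and D: "0 < D"
  shows "norm (fejer D A) \<le> norm A"
proof (rule field_le_epsilon)
  fix e :: real assume "0 < e"
  \<comment> \<open>The approximation error enters \<open>D\<close> times through the crude bound
    and once through the norm of the polynomial.\<close>
  define d where "d = e / (real D + 1)"
  have d: "0 < d" using \<open>0 < e\<close> by (simp add: d_def)
  obtain F N where F: "\<And>n. F n \<in> c0" "\<And>n. N \<le> n \<Longrightarrow> F n = (\<lambda>_. 0)"
    and AP: "norm (A - (\<Sum>n<N. U n (F n))) < d"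
    using crossed_product_approx[OF A d] by metis
  let ?P = "\<Sum>n<N. U n (F n)"
  have P: "?P \<in> \<A>" by (rule csubspace_sum[OF sub U_mem[OF F(1)]])
  have "norm (fejer D A) \<le> norm (fejer D A - fejer D ?P) + norm (fejer D ?P)"
    using norm_triangle_ineq[of "fejer D A - fejer D ?P" "fejer D ?P"] by simp
  also have "norm (fejer D A - fejer D ?P) \<le> D * norm (A - ?P)"
    using norm_fejer_crude[OF csubspace_diff[OF sub A P]] by (simp add: fejer_diff A P)
  also have "D * norm (A - ?P) \<le> D * d" using AP by (intro mult_left_mono) auto
  also have "norm (fejer D ?P) \<le> norm ?P" by (rule norm_fejer_polynomial[OF F D])
  also have "norm ?P \<le> norm A + d"
    using norm_triangle_ineq2[of ?P A] AP by (simp add: norm_minus_commute)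
  finally have "norm (fejer D A) \<le> norm A + (real D + 1) * d" by (simp add: algebra_simps)
  then show "norm (fejer D A) \<le> norm A + e" by (simp add: d_def)
qed

text \<open>The means \<open>fejer D A\<close> lie in \<open>S\<close> and converge to
  \<open>A\<close>: for a polynomial the weight in degree \<open>n\<close> misses 1 by only
  \<open>n / D\<close>, and contractivity transfers the convergence to \<open>A\<close>.\<close>

lemma mem_closed_subspace_of_homogeneous:
  assumes S: "csubspace S" "closed S" and A: "A \<in> \<A>" and hom: "\<And>n. U n (E n A) \<in> S"
  shows "A \<in> S"
proof -
  have "A \<in> closure S"
    unfolding closure_approachable
  proof (intro allI impI)
    fix e :: real assume "0 < e"
    then have e3: "0 < e/3" by simp
    obtain F N where F: "\<And>n. F n \<in> c0" "\<And>n. N \<le> n \<Longrightarrow> F n = (\<lambda>_. 0)"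
      and AP: "norm (A - (\<Sum>n<N. U n (F n))) < e/3"
      using crossed_product_approx[OF A e3] by metis
    let ?P = "\<Sum>n<N. U n (F n)"
    have P: "?P \<in> \<A>" by (rule csubspace_sum[OF sub U_mem[OF F(1)]])
    define C where "C = (\<Sum>n<N. n * norm (U n (F n)))"
    obtain D where D: "max (real N) (C / (e/3)) < real D" using reals_Archimedean2 by blast
    then have DN: "N < D" and D0: "0 < D" and CD: "C / real D < e/3"
      using e3 by (auto simp: field_simps)
    have "fejer D ?P = (\<Sum>n<D. (of_nat (D - n) / of_nat D) *\<^sub>C U n (F n))"
    proof -
      have "?P = (\<Sum>n<D. U n (F n))"
        using DN by (intro sum.mono_neutral_left) (auto simp: F(2) U_zero)
      then show ?thesis unfolding fejer_def by (intro sum.cong) (simp_all add: E_sum_U F(1))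
    qed
    also have "\<dots> = (\<Sum>n<N. (of_nat (D - n) / of_nat D) *\<^sub>C U n (F n))"
      using DN by (intro sum.mono_neutral_right) (auto simp: F(2) U_zero)
    finally have "?P - fejer D ?P = (\<Sum>n<N. U n (F n) - (of_nat (D - n) / of_nat D) *\<^sub>C U n (F n))"
      by (simp add: sum_subtractf)
    also have "norm \<dots> \<le> (\<Sum>n<N. n * norm (U n (F n)) / D)"
    proof (rule sum_norm_le)
      fix n assume n: "n \<in> {..<N}"
      have "of_nat n / of_nat D + of_nat (D - n) / of_nat D = (1 :: complex)"
        using n DN D0 by (simp add: add_divide_distrib[symmetric] of_nat_diff)
      then have "U n (F n) = (of_nat n / of_nat D + of_nat (D - n) / of_nat D) *\<^sub>C U n (F n)" by simp
      then have "U n (F n) - (of_nat (D - n) / of_nat D) *\<^sub>C U n (F n) = (of_nat n / of_nat D) *\<^sub>C U n (F n)"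
        by (metis add_diff_cancel_right' scaleC_add_left)
      then show "norm (U n (F n) - (of_nat (D - n) / of_nat D) *\<^sub>C U n (F n)) \<le> n * norm (U n (F n)) / D"
        using norm_scaleC_blinfun[of "of_nat n / of_nat D" "U n (F n)"] by (simp add: norm_divide)
    qed
    also have "\<dots> = C / D" by (simp add: C_def sum_divide_distrib)
    finally have PP: "norm (?P - fejer D ?P) < e/3" using CD by (rule order.strict_trans1)
    have FF: "norm (fejer D ?P - fejer D A) < e/3"
      using norm_fejer[OF csubspace_diff[OF sub P A] D0] AP
      by (simp add: fejer_diff A P norm_minus_commute)
    have "norm (A - fejer D A) \<le> norm (A - ?P) + norm (?P - fejer D A)"
      using norm_triangle_ineq[of "A - ?P" "?P - fejer D A"] by simp
    also have "norm (?P - fejer D A) \<le> norm (?P - fejer D ?P) + norm (fejer D ?P - fejer D A)"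
      using norm_triangle_ineq[of "?P - fejer D ?P" "fejer D ?P - fejer D A"] by simp
    finally have "dist (fejer D A) A < e"
      using PP FF AP unfolding dist_norm norm_minus_commute[of "fejer D A"] by linarith
    moreover have "fejer D A \<in> S"
      unfolding fejer_def by (intro csubspace_sum[OF S(1)] csubspace_scaleC[OF S(1)] hom)
    ultimately show "\<exists>y\<in>S. dist y A < e" by blast
  qed
  then show ?thesis using S(2) by simp
qed

end

section \<open>Coefficients vanishing on the recurrent points\<close>

text \<open>On the compact set where \<open>cmod (f x)\<close> is at least \<open>e\<close>, a
  finite sum \<open>G\<close> of squared moduli of members of \<open>J\<close> is bounded below by
  some \<open>\<delta>\<close>. Multiplying \<open>f\<close> by \<open>G / max G \<delta>\<close>
  gives a member of \<open>J\<close> that equals \<open>f\<close> there and is within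
  \<open>e\<close> of it elsewhere.\<close>

lemma mem_c0_ideal_of_vanishing:
  fixes J :: "('x::topological_space \<Rightarrow> complex) set"
  assumes J: "J \<subseteq> c0" "(\<lambda>_. 0) \<in> J"
    and add: "\<And>g h. g \<in> J \<Longrightarrow> h \<in> J \<Longrightarrow> (\<lambda>x. g x + h x) \<in> J"
    and ideal: "\<And>g h. g \<in> J \<Longrightarrow> h \<in> c0 \<Longrightarrow> (\<lambda>x. g x * h x) \<in> J"
    and unif: "\<And>g. g \<in> c0 \<Longrightarrow> (\<And>e. 0 < e \<Longrightarrow> \<exists>h\<in>J. \<forall>x. cmod (g x - h x) \<le> e) \<Longrightarrow> g \<in> J"
    and f: "f \<in> c0" and van: "\<And>x. (\<And>g. g \<in> J \<Longrightarrow> g x = 0) \<Longrightarrow> f x = 0"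
  shows "f \<in> J"
proof (rule unif[OF f])
  fix e :: real assume e: "0 < e"
  define C where "C = {x. e \<le> cmod (f x)}"
  have cf: "continuous_on UNIV f" by (rule c0_continuous[OF f])
  have "compact C"
  proof -
    obtain K where K: "compact K" "\<And>x. x \<notin> K \<Longrightarrow> cmod (f x) < e"
      using f e unfolding c0_def by blast
    have "closed C" unfolding C_def by (intro closed_Collect_le continuous_intros cf)
    moreover have "C = C \<inter> K" using K(2) by (force simp: C_def)
    ultimately show ?thesis using closed_Int_compact[of C K] K(1) by simp
  qed
  have "\<forall>x\<in>C. \<exists>g. g \<in> J \<and> g x \<noteq> 0"
  proof
    fix x assume "x \<in> C"
    then have "f x \<noteq> 0" using e by (auto simp: C_def)
    then show "\<exists>g. g \<in> J \<and> g x \<noteq> 0" using van by blast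
  qed
  then obtain g where g: "\<And>x. x \<in> C \<Longrightarrow> g x \<in> J" "\<And>x. x \<in> C \<Longrightarrow> g x x \<noteq> 0" by metis
  have gc: "continuous_on UNIV (g x)" if "x \<in> C" for x
    using g(1)[OF that] J(1) c0_continuous by blast
  have "\<exists>D\<subseteq>C. finite D \<and> C \<subseteq> (\<Union>x\<in>D. {y. g x y \<noteq> 0})"
  proof (rule compactE_image[OF \<open>compact C\<close>, of C "\<lambda>x. {y. g x y \<noteq> 0}"])
    show "open {y. g x y \<noteq> 0}" if "x \<in> C" for x
      by (intro open_Collect_neq gc[OF that] continuous_on_const)
    show "C \<subseteq> (\<Union>x\<in>C. {y. g x y \<noteq> 0})" using g(2) by blast
  qed blast
  then obtain D where D: "D \<subseteq> C" "finite D" "C \<subseteq> (\<Union>x\<in>D. {y. g x y \<noteq> 0})" by blast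
  define G where "G y = (\<Sum>x\<in>D. (cmod (g x y))\<^sup>2)" for y
  have GJ: "(\<lambda>y. complex_of_real (G y)) \<in> J"
  proof -
    have "(\<lambda>y. \<Sum>x\<in>D'. g x y * cnj (g x y)) \<in> J" if "D' \<subseteq> C" "finite D'" for D'
      using that(2,1)
    proof (induction D' rule: finite_induct)
      case (insert x D')
      have "(\<lambda>y. g x y * cnj (g x y)) \<in> J"
        using insert.prems g(1) J(1) by (intro ideal c0_cnj) auto
      then show ?case using insert by (simp add: add)
    qed (simp add: J(2))
    then show ?thesis
      using D unfolding G_def of_real_sum complex_norm_square[symmetric] by blast
  qed
  have Gc: "continuous_on UNIV G"
    unfolding G_def using D(1) by (intro continuous_intros gc) auto
  have G0: "0 \<le> G y" for y by (simp add: G_def sum_nonneg)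
  have Gpos: "0 < G y" if y: "y \<in> C" for y
  proof -
    obtain x where x: "x \<in> D" "g x y \<noteq> 0" using y D(3) by blast
    then show ?thesis unfolding G_def by (intro sum_pos2[OF D(2) x(1)]) auto
  qed
  obtain \<delta> where \<delta>: "0 < \<delta>" "\<And>y. y \<in> C \<Longrightarrow> \<delta> \<le> G y"
  proof (cases "C = {}")
    case False
    obtain y0 where "y0 \<in> C" "\<And>y. y \<in> C \<Longrightarrow> G y0 \<le> G y"
      using continuous_attains_inf[OF \<open>compact C\<close> False continuous_on_subset[OF Gc]] by blast
    then show ?thesis using that[of "G y0"] Gpos by blast
  qed (use that[of 1] in simp)
  have m: "0 < max (G y) \<delta>" for y using \<delta>(1) by simp
  define k where "k y = f y / complex_of_real (max (G y) \<delta>)" for y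
  have k: "k \<in> c0"
  proof (rule c0_dominated[OF f, where B = "1 / \<delta>"])
    show "continuous_on UNIV k"
      unfolding k_def using m by (intro continuous_intros cf Gc) (auto simp: less_le)
    show "cmod (k x) \<le> 1 / \<delta> * cmod (f x)" for x
      using \<delta>(1) m[of x] by (simp add: k_def norm_divide frac_le)
  qed
  have "cmod (f y - complex_of_real (G y) * k y) \<le> e" for y
  proof -
    define t where "t = G y / max (G y) \<delta>"
    have t: "0 \<le> t" "t \<le> 1" using G0[of y] m[of y] by (auto simp: t_def divide_le_eq_1)
    have "f y - complex_of_real (G y) * k y = complex_of_real (1 - t) * f y"
      by (simp add: k_def t_def algebra_simps)
    then have eq: "cmod (f y - complex_of_real (G y) * k y) = (1 - t) * cmod (f y)"
      using t by (simp add: norm_mult del: of_real_diff)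
    show ?thesis
    proof (cases "y \<in> C")
      case True
      then have "t = 1" using \<delta>(2)[OF True] Gpos[OF True] by (simp add: t_def max_absorb1)
      then show ?thesis unfolding eq using e by simp
    next
      case False
      then have "cmod (f y) \<le> e" by (simp add: C_def)
      then show ?thesis unfolding eq using t mult_left_le_one_le[of "cmod (f y)" "1 - t"] by simp
    qed
  qed
  then show "\<exists>h\<in>J. \<forall>x. cmod (f x - h x) \<le> e" by (intro bexI[OF _ ideal[OF GJ k]]) simp
qed

locale metrizable_crossed_product = crossed_product_system \<phi> \<rho>
  for \<phi> :: "'x::t2_space \<Rightarrow> 'x" and \<rho> :: "('x \<Rightarrow> complex) \<Rightarrow> 'h::complex_hilbert \<Rightarrow>\<^sub>L 'h" +
  assumes metrizable: "metrizable_space (euclidean :: 'x topology)"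
    and locally_compact: "locally_compact_space (euclidean :: 'x topology)"
begin

section \<open>Metric tools: bump functions and points that never return\<close>

lemma obtain_metric:
  obtains d where "Metric_space (UNIV :: 'x set) d"
    "\<And>f g. continuous_on UNIV f \<Longrightarrow> continuous_on UNIV g \<Longrightarrow> continuous_on UNIV (\<lambda>x :: 'x. d (f x) (g x))"
    "\<And>S x. open S \<Longrightarrow> x \<in> S \<Longrightarrow> \<exists>r>0. \<forall>y. d x y < r \<longrightarrow> y \<in> S"
proof -
  obtain M d where "Metric_space M d" and X: "(euclidean :: 'x topology) = Metric_space.mtopology M d"
    using metrizable unfolding metrizable_space_def by blast
  then interpret Metric_space M d by blast
  have M: "M = UNIV" using arg_cong[OF X, of topspace] by simp
  show ?thesis
  proof (rule that)
    show "Metric_space UNIV d" using Metric_space_axioms by (simp add: M)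
    show "continuous_on UNIV (\<lambda>x :: 'x. d (f x) (g x))"
      if "continuous_on UNIV f" "continuous_on UNIV g" for f g :: "'x \<Rightarrow> 'x"
      using continuous_map_mdist[of euclidean Self f g] that by (simp add: mtopology_of_def X[symmetric])
    show "\<exists>r>0. \<forall>y. d x y < r \<longrightarrow> y \<in> S" if Sx: "open S" "x \<in> S" for S x
    proof -
      have "openin mtopology S" using Sx(1) unfolding X[symmetric] by simp
      then obtain r where r: "r > 0" "mball x r \<subseteq> S" using Sx(2) unfolding openin_mtopology by blast
      have "y \<in> mball x r" if "d x y < r" for y
        unfolding in_mball using that by (simp add: M)
      then show ?thesis using r by blast
    qed
  qed
qed

lemma bump:
  assumes V: "open V" "z \<in> V"
  obtains h :: "'x \<Rightarrow> real" where "(\<lambda>y. complex_of_real (h y)) \<in> c0" "\<And>y. 0 \<le> h y" "h z = 1"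
    "\<And>y. y \<notin> V \<Longrightarrow> h y = 0"
proof -
  obtain d where "Metric_space (UNIV :: 'x set) d"
    and dc: "\<And>f g. continuous_on UNIV f \<Longrightarrow> continuous_on UNIV g \<Longrightarrow> continuous_on UNIV (\<lambda>x :: 'x. d (f x) (g x))"
    and dn: "\<And>S x. open S \<Longrightarrow> x \<in> S \<Longrightarrow> \<exists>r>0. \<forall>y. d x y < r \<longrightarrow> y \<in> S"
    using obtain_metric by blast
  then interpret Metric_space UNIV d by blast
  obtain W K where "openin euclidean W" "compactin euclidean K" "z \<in> W" "W \<subseteq> K"
    using locally_compact unfolding locally_compact_space_def by (metis UNIV_I topspace_euclidean)
  then have W: "open W" "compact K" "z \<in> W" "W \<subseteq> K" by simp_all
  obtain r where r: "0 < r" "\<And>y. d z y < r \<Longrightarrow> y \<in> W \<inter> V"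
    using dn[of "W \<inter> V" z] W V by blast
  define h where "h y = max 0 (1 - d z y / r)" for y
  have out: "h y = 0" if "y \<notin> W \<inter> V" for y
    using r(2)[of y] that r(1) by (fastforce simp: h_def not_less)
  show ?thesis
  proof (rule that[of h])
    have "continuous_on UNIV h"
      unfolding h_def using r(1) by (intro continuous_intros dc) auto
    moreover have "h y = 0" if "y \<notin> K" for y using out W(4) that by blast
    ultimately show "(\<lambda>y. complex_of_real (h y)) \<in> c0"
      using W(2) by (auto simp: c0_def intro!: continuous_intros)
    show "h z = 1" by (simp add: h_def)
    show "h y = 0" if "y \<notin> V" for y using out that by blast
  qed (simp add: h_def)
qed

text \<open>The iterates of a non-recurrent \<open>y\<close> keep a distance
  \<open>1 / (k + 1)\<close> from \<open>y\<close>, with \<open>k\<close> depending on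
  \<open>y\<close>. The closed sets \<open>Q k\<close> cover the part \<open>Y\<close> of
  \<open>K\<close> off the closure of the recurrent points, so one of them has interior relative to
  \<open>Y\<close>. In a ball of half that radius the triangle inequality excludes returns.\<close>

lemma wandering_relatively_open:
  assumes K: "closed K" and z: "z \<in> K" "z \<notin> closure (recurrent_points \<phi>)"
  obtains V where "open V" "V \<inter> K \<noteq> {}" "\<And>y j. y \<in> V \<inter> K \<Longrightarrow> 1 \<le> j \<Longrightarrow> (\<phi> ^^ j) y \<notin> V"
proof -
  obtain d where "Metric_space (UNIV :: 'x set) d"
    and dc: "\<And>f g. continuous_on UNIV f \<Longrightarrow> continuous_on UNIV g \<Longrightarrow> continuous_on UNIV (\<lambda>x :: 'x. d (f x) (g x))"
    and dn: "\<And>S x. open S \<Longrightarrow> x \<in> S \<Longrightarrow> \<exists>r>0. \<forall>y. d x y < r \<longrightarrow> y \<in> S"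
    using obtain_metric by blast
  then interpret Metric_space UNIV d by blast
  note cp = continuous_funpow[OF cont]
  define O' where "O' = - closure (recurrent_points \<phi>)"
  have O: "open O'" by (simp add: O'_def open_Compl)
  define Y where "Y = O' \<inter> K"
  let ?T = "subtopology euclidean Y"
  define Q where "Q k = {y. \<forall>j\<ge>1. 1 / (real k + 1) \<le> d ((\<phi> ^^ j) y) y}" for k :: nat
  have Qclosed: "closed (Q k)" for k
  proof -
    have "Q k = (\<Inter>j\<in>{1..}. {y. 1 / (real k + 1) \<le> d ((\<phi> ^^ j) y) y})" by (auto simp: Q_def)
    also have "closed \<dots>"
      by (intro closed_INT ballI closed_Collect_le continuous_on_const dc cp continuous_on_id)
    finally show ?thesis .
  qed
  have cover: "\<exists>k. y \<in> Q k" if "y \<in> Y" for y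
  proof -
    have "y \<notin> recurrent_points \<phi>" using that closure_subset by (auto simp: Y_def O'_def)
    then obtain V where V: "open V" "y \<in> V" "\<And>j. 1 \<le> j \<Longrightarrow> (\<phi> ^^ j) y \<notin> V"
      unfolding recurrent_points_def by blast
    obtain r where r: "0 < r" "\<And>w. d y w < r \<Longrightarrow> w \<in> V" using dn[OF V(1,2)] by blast
    obtain k where k: "inverse (real (Suc k)) < r" using reals_Archimedean[OF r(1)] by blast
    have "1 / (real k + 1) \<le> d ((\<phi> ^^ j) y) y" if "1 \<le> j" for j
      using r(2)[of "(\<phi> ^^ j) y"] V(3)[OF that] k commute[of y] by (fastforce simp: inverse_eq_divide add.commute)
    then show ?thesis by (auto simp: Q_def)
  qed
  have "\<exists>k. ?T interior_of (Y \<inter> Q k) \<noteq> {}"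
  proof (rule ccontr)
    assume no: "\<not> ?thesis"
    have "?T interior_of \<Union>(range (\<lambda>k. Y \<inter> Q k)) = {}"
    proof (rule Baire_category_alt)
      \<comment> \<open>Baire's theorem needs a locally compact \<open>Y\<close>. This is why the
        closure of the recurrent points is removed and not just the points themselves:
        \<open>Y\<close> is then closed in the open set \<open>O'\<close>.\<close>
      have "locally_compact_space (subtopology euclidean O')"
        using locally_compact_space_open_subset[of euclidean O'] locally_compact O
          metrizable_imp_Hausdorff_space[OF metrizable] by simp
      then have "locally_compact_space (subtopology (subtopology euclidean O') (O' \<inter> K))"
        using closedin_closed_Int[OF K, of O'] by (rule locally_compact_space_closed_subset)
      then have "locally_compact_space ?T" by (simp add: subtopology_subtopology Y_def inf_left_idem)
      moreover have "regular_space ?T"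
        by (intro metrizable_imp_regular_space metrizable_space_subtopology metrizable)
      ultimately show "completely_metrizable_space ?T \<or> locally_compact_space ?T \<and> regular_space ?T" by blast
      show "closedin ?T S \<and> ?T interior_of S = {}" if "S \<in> range (\<lambda>k. Y \<inter> Q k)" for S
        using that no Qclosed by (auto simp: closedin_closed_Int)
    qed simp
    moreover have "\<Union>(range (\<lambda>k. Y \<inter> Q k)) = Y" using cover by blast
    ultimately have "Y = {}" using interior_of_topspace[of ?T] by simp
    then show False using z by (auto simp: Y_def O'_def)
  qed
  then obtain k w where "w \<in> ?T interior_of (Y \<inter> Q k)" by blast
  then obtain S where S: "open S" "w \<in> S \<inter> Y" "S \<inter> Y \<subseteq> Q k"
    unfolding interior_of_def openin_subtopology by auto
  \<comment> \<open>Intersecting with \<open>O'\<close> puts \<open>V \<inter> K\<close> inside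
    \<open>S \<inter> Y\<close>, hence inside \<open>Q k\<close>.\<close>
  define V where "V = S \<inter> O' \<inter> {y. d w y < 1 / (real k + 1) / 2}"
  show ?thesis
  proof (rule that[of V])
    show "open V"
      unfolding V_def by (intro open_Int S O open_Collect_less dc continuous_on_const continuous_on_id)
    show "V \<inter> K \<noteq> {}" using S(2) by (auto simp: V_def Y_def)
    fix y j assume y: "y \<in> V \<inter> K" and j: "1 \<le> (j :: nat)"
    show "(\<phi> ^^ j) y \<notin> V"
    proof
      assume "(\<phi> ^^ j) y \<in> V"
      then have "d w ((\<phi> ^^ j) y) < 1 / (real k + 1) / 2" "d w y < 1 / (real k + 1) / 2"
        using y by (auto simp: V_def)
      moreover have "d ((\<phi> ^^ j) y) y \<le> d w ((\<phi> ^^ j) y) + d w y"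
        using triangle''[of "(\<phi> ^^ j) y" w y] by simp
      ultimately have "d ((\<phi> ^^ j) y) y < 1 / (real k + 1)" by (smt (verit) field_sum_of_halves)
      moreover have "y \<in> Q k" using y S(3) by (auto simp: V_def Y_def)
      ultimately show False using j by (fastforce simp: Q_def)
    qed
  qed
qed

text \<open>The \<open>g\<close> with \<open>U n g\<close> in the radical form an ideal of
  \<open>c0\<close>, because right multiplication by \<open>U 0 h\<close> multiplies the coefficient
  by \<open>h\<close>. The ideal is uniformly closed because \<open>U n\<close> is
  contractive.\<close>

lemma radical_coefficient_ideal:
  assumes f: "f \<in> c0"
    and van: "\<And>x. (\<And>g. g \<in> c0 \<Longrightarrow> U n g \<in> jacobson_radical \<A> \<Longrightarrow> g x = 0) \<Longrightarrow> f x = 0"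
  shows "U n f \<in> jacobson_radical \<A>"
proof -
  let ?J = "{g \<in> c0. U n g \<in> jacobson_radical \<A>}"
  have "f \<in> ?J"
  proof (rule mem_c0_ideal_of_vanishing)
    show "?J \<subseteq> c0" by blast
    show "(\<lambda>_. 0) \<in> ?J" by (simp add: c0_zero U_zero csubspace_0[OF radical_csubspace])
    show "(\<lambda>x. g x + h x) \<in> ?J" if "g \<in> ?J" "h \<in> ?J" for g h
      using that by (simp add: c0_add U_add csubspace_add[OF radical_csubspace])
    show "(\<lambda>x. g x * h x) \<in> ?J" if "g \<in> ?J" "h \<in> c0" for g h
    proof -
      have "U n g o\<^sub>L U 0 h \<in> jacobson_radical \<A>"
        using that by (intro radical_mult_right U_mem) auto
      then show ?thesis using that by (simp add: U_mult c0_mult)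
    qed
    show "g \<in> ?J" if g: "g \<in> c0" and ap: "\<And>e. 0 < e \<Longrightarrow> \<exists>h\<in>?J. \<forall>x. cmod (g x - h x) \<le> e" for g
    proof -
      have "U n g \<in> closure (jacobson_radical \<A>)"
        unfolding closure_approachable
      proof (intro allI impI)
        fix e :: real assume "0 < e"
        then have "0 < e/2" by simp
        then obtain h where h: "h \<in> c0" "U n h \<in> jacobson_radical \<A>" "\<And>x. cmod (g x - h x) \<le> e/2"
          using ap[of "e/2"] by auto
        have "norm (U n g - U n h) \<le> supnorm (\<lambda>x. g x - h x)"
          unfolding U_diff[OF g h(1), symmetric] by (rule norm_U[OF c0_diff[OF g h(1)]])
        also have "\<dots> \<le> e/2" by (rule supnorm_leI[OF h(3)])
        finally have "dist (U n h) (U n g) < e"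
          using \<open>0 < e\<close> by (simp add: dist_norm norm_minus_commute)
        then show "\<exists>y\<in>jacobson_radical \<A>. dist y (U n g) < e" using h(2) by blast
      qed
      then show ?thesis using g radical_closed by simp
    qed
  qed (use f van in auto)
  then show ?thesis by blast
qed

text \<open>Let \<open>K m\<close> be the common zero set of all \<open>f\<close> with \<open>U m f\<close> in the radical; it decreases with
  \<open>m\<close>. If \<open>K n\<close> were not contained in the closure of the recurrent points, take \<open>V\<close> meeting \<open>K n\<close> such
  that points of \<open>V \<inter> K n\<close> never return to \<open>V\<close>. For \<open>f\<close> supported in \<open>V\<close> the coefficients of
  \<open>(U n f) B (U n f)\<close> then vanish on \<open>K n\<close>, so this product is in the radical for all \<open>B\<close>; as the radical
  is semiprime, it contains \<open>U n f\<close>, which contradicts \<open>f \<noteq> 0\<close> on \<open>K n\<close>.\<close>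

lemma U_in_radical:
  assumes n: "1 \<le> n" and f: "f \<in> c0" and van: "\<And>x. x \<in> recurrent_points \<phi> \<Longrightarrow> f x = 0"
  shows "U n f \<in> jacobson_radical \<A>"
proof -
  define K where "K m = {x. \<forall>g. g \<in> c0 \<and> U m g \<in> jacobson_radical \<A> \<longrightarrow> g x = 0}" for m
  have KI: "U m g \<in> jacobson_radical \<A>" if "g \<in> c0" "\<And>x. x \<in> K m \<Longrightarrow> g x = 0" for m g
    using that by (intro radical_coefficient_ideal) (auto simp: K_def)
  have Kdec: "K (n + j) \<subseteq> K n" for j
  proof
    fix y assume y: "y \<in> K (n + j)"
    have "g y = 0" if g: "g \<in> c0" "U n g \<in> jacobson_radical \<A>" for g
    proof -
      \<comment> \<open>The constant 1 need not be in \<open>c0\<close>, so a bump with value 1 at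
        \<open>(\<phi> ^^ n) y\<close> replaces it in raising the degree by
        \<open>j\<close>.\<close>
      obtain h where h: "(\<lambda>y. complex_of_real (h y)) \<in> c0" "h ((\<phi> ^^ n) y) = 1"
        using bump[OF open_UNIV UNIV_I] by metis
      have "U j (\<lambda>y. complex_of_real (h y)) o\<^sub>L U n g \<in> jacobson_radical \<A>"
        by (intro radical_mult_left U_mem g h)
      then have "U (n + j) (\<lambda>x. complex_of_real (h ((\<phi> ^^ n) x)) * g x) \<in> jacobson_radical \<A>"
        by (simp add: U_mult h g add.commute)
      moreover have "(\<lambda>x. complex_of_real (h ((\<phi> ^^ n) x)) * g x) \<in> c0"
        by (intro c0_mult g pullback_c0[OF h(1)])
      ultimately have "complex_of_real (h ((\<phi> ^^ n) y)) * g y = 0" using y unfolding K_def by blast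
      then show ?thesis using h(2) by simp
    qed
    then show "y \<in> K n" by (simp add: K_def)
  qed
  have Kclosed: "closed (K n)"
  proof -
    have "K n = (\<Inter>g\<in>{g \<in> c0. U n g \<in> jacobson_radical \<A>}. {x. g x = 0})" by (auto simp: K_def)
    also have "closed \<dots>" by (intro closed_INT ballI closed_Collect_eq) (auto intro: c0_continuous)
    finally show ?thesis .
  qed
  have "K n \<subseteq> closure (recurrent_points \<phi>)"
  proof (rule ccontr)
    assume "\<not> ?thesis"
    then obtain z where "z \<in> K n" "z \<notin> closure (recurrent_points \<phi>)" by blast
    then obtain V where V: "open V" "V \<inter> K n \<noteq> {}" "\<And>y j. y \<in> V \<inter> K n \<Longrightarrow> 1 \<le> j \<Longrightarrow> (\<phi> ^^ j) y \<notin> V"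
      using wandering_relatively_open[OF Kclosed] by metis
    then obtain w where w: "w \<in> V" "w \<in> K n" by blast
    obtain h where hc: "(\<lambda>y. complex_of_real (h y)) \<in> c0" and hw: "h w = 1"
      and h0: "\<And>y. y \<notin> V \<Longrightarrow> h y = 0"
      using bump[OF V(1) w(1)] by metis
    define g where "g y = complex_of_real (h y)" for y
    have g: "g \<in> c0" unfolding g_def by (rule hc)
    have g0: "g y = 0" if "y \<notin> V" for y using h0[OF that] by (simp add: g_def)
    have "U n g \<in> jacobson_radical \<A>"
    proof (rule radical_semiprime[OF U_mem[OF g]])
      fix B assume B: "B \<in> \<A>"
      have bl: "bounded_linear (\<lambda>B. U n g o\<^sub>L (B o\<^sub>L U n g))"
        by (rule bounded_linear_compose[OF bounded_linear_blinfun_compose_right bounded_linear_blinfun_compose_left])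
      have "\<A> \<subseteq> (\<lambda>B. U n g o\<^sub>L (B o\<^sub>L U n g)) -` jacobson_radical \<A>"
      proof (rule crossed_product_minimal)
        show "csubspace ((\<lambda>B. U n g o\<^sub>L (B o\<^sub>L U n g)) -` jacobson_radical \<A>)"
          by (rule csubspace_bounded_linear_vimage[OF radical_csubspace bl])
             (simp add: scaleC_blinfun_compose compose_scaleC U_mem g)
        show "closed ((\<lambda>B. U n g o\<^sub>L (B o\<^sub>L U n g)) -` jacobson_radical \<A>)"
          by (rule closed_bounded_linear_vimage[OF radical_closed bl])
        fix m k assume k: "(k :: 'x \<Rightarrow> complex) \<in> c0"
        \<comment> \<open>\<open>q x\<close> can be nonzero only when \<open>x\<close> and
          \<open>(\<phi> ^^ (m + n)) x\<close> both lie in \<open>V\<close>, and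
          \<open>m + n\<close> is at least 1. Since \<open>K (n + (m + n))\<close> lies in
          \<open>K n\<close> by \<open>Kdec\<close>, vanishing on \<open>K n\<close> is
          enough.\<close>
        define q where "q x = g ((\<phi> ^^ (m + n)) x) * (k ((\<phi> ^^ n) x) * g x)" for x
        have q: "q \<in> c0" unfolding q_def by (intro c0_mult pullback_c0 g k)
        have "U n g o\<^sub>L (U m k o\<^sub>L U n g) = U (n + (m + n)) q"
          by (simp add: U_mult g k c0_mult pullback_c0 q_def[abs_def])
        moreover have "q x = 0" if "x \<in> K n" for x
          using V(3)[of x "m + n"] n that g0[of x] g0[of "(\<phi> ^^ (m + n)) x"]
          by (cases "x \<in> V") (auto simp: q_def)
        then have "U (n + (m + n)) q \<in> jacobson_radical \<A>" using Kdec by (intro KI q) blast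
        ultimately show "U m k \<in> (\<lambda>B. U n g o\<^sub>L (B o\<^sub>L U n g)) -` jacobson_radical \<A>" by simp
      qed
      then show "U n g o\<^sub>L (B o\<^sub>L U n g) \<in> jacobson_radical \<A>" using B by blast
    qed
    then have "g w = 0" using w(2) g by (simp add: K_def)
    then show False using hw by (simp add: g_def)
  qed
  moreover have "closure (recurrent_points \<phi>) \<subseteq> {x. f x = 0}"
    using van by (intro closure_minimal closed_Collect_eq c0_continuous f continuous_on_const) auto
  ultimately show ?thesis using f by (intro KI) auto
qed

end

section \<open>Radical elements vanish on the recurrent points\<close>

text \<open>If \<open>q\<close> is a return time to \<open>V\<close>, the points of \<open>V\<close>
  that are again in \<open>V\<close> at time \<open>q\<close> form a neighbourhood of
  \<open>x\<close>. A return to it at time \<open>m \<ge> 1\<close> gives the longer return time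
  \<open>q + m\<close>.\<close>

lemma recurrent_return_time:
  fixes \<phi> :: "'x::topological_space \<Rightarrow> 'x"
  assumes cont: "continuous_on UNIV \<phi>" and x: "x \<in> recurrent_points \<phi>" and V: "open V" "x \<in> V"
  shows "\<exists>q\<ge>L. (\<phi> ^^ q) x \<in> V"
  using V
proof (induction L arbitrary: V)
  case 0
  then show ?case by (intro exI[of _ 0]) simp
next
  case (Suc L)
  then obtain q where q: "L \<le> q" "(\<phi> ^^ q) x \<in> V" by blast
  have "open ((\<phi> ^^ q) -` V \<inter> V)"
    using Suc.prems(1) open_vimage[OF Suc.prems(1) continuous_funpow[OF cont, of q]] by blast
  moreover have "x \<in> (\<phi> ^^ q) -` V \<inter> V" using q Suc.prems by simp
  ultimately obtain m where m: "m \<ge> 1" "(\<phi> ^^ m) x \<in> (\<phi> ^^ q) -` V \<inter> V"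
    using x unfolding recurrent_points_def by blast
  then have "(\<phi> ^^ (q + m)) x \<in> V" by (simp add: funpow_add)
  then show ?case using q(1) m(1) by (intro exI[of _ "q + m"]) simp
qed

context metrizable_crossed_product
begin

text \<open>Following the ruler sequence \<open>p 0, p 1, p 0, p 2, p 0, p 1, p 0, p 3, \<dots>\<close> of suitable return
  times, the orbit of \<open>x\<close> stays in the set where \<open>h\<close> is bounded below. Let \<open>C\<close> be the element with
  coefficients \<open>\<mu> 2 ^ (- k) h\<close> in degree \<open>p k\<close>. The small factors \<open>2 ^ (- k)\<close> occur so rarely
  along the sequence that, for large \<open>\<mu>\<close>, the coefficients of the formal series
  \<open>C + C\<^sup>2 + C\<^sup>3 + \<dots>\<close> are unbounded at \<open>x\<close>. Up to sign, they would be the coefficients of a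
  quasi-inverse of \<open>C\<close>.\<close>

lemma not_radical_of_recurrent:
  fixes h :: "'x \<Rightarrow> real"
  assumes x: "x \<in> recurrent_points \<phi>" and n: "1 \<le> n"
    and hc: "(\<lambda>y. complex_of_real (h y)) \<in> c0" and h0: "\<And>y. 0 \<le> h y" and hx: "0 < h x"
    and rad: "\<And>p. n \<le> p \<Longrightarrow> U p (\<lambda>y. complex_of_real (h y)) \<in> jacobson_radical \<A>"
  shows False
proof -
  define \<delta> where "\<delta> = h x / 2"
  have \<delta>: "0 < \<delta>" "\<delta> < h x" using hx by (simp_all add: \<delta>_def)
  have hcont: "continuous_on UNIV h"
  proof -
    have "continuous_on UNIV (\<lambda>y. Re (complex_of_real (h y)))"
      by (intro continuous_intros c0_continuous[OF hc])
    then show ?thesis by simp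
  qed
  \<comment> \<open>A state consists of a neighbourhood \<open>V k\<close> of \<open>x\<close>, the
    duration \<open>S k\<close> of a block made of the first \<open>2 ^ k - 1\<close> steps of the
    ruler sequence, and the previous step length \<open>p (k - 1)\<close>, or 0 at the
    start.\<close>
  define P :: "nat \<Rightarrow> 'x set \<times> nat \<times> nat \<Rightarrow> bool"
    where "P k s \<longleftrightarrow> open (fst s) \<and> x \<in> fst s \<and> (k = 0 \<longrightarrow> s = ({y. \<delta> < h y}, 0, 0))" for k s
  \<comment> \<open>A block of stage \<open>k + 1\<close> is a block of stage \<open>k\<close>, a
    step \<open>r'\<close>, and another block of stage \<open>k\<close>. The new set keeps the
    points from which both copies of the block can be started, the second at time
    \<open>r' + t\<close>.\<close>
  define Q :: "nat \<Rightarrow> 'x set \<times> nat \<times> nat \<Rightarrow> 'x set \<times> nat \<times> nat \<Rightarrow> bool"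
    where "Q k s s' \<longleftrightarrow> (case s of (W, t, r) \<Rightarrow> case s' of (W', t', r') \<Rightarrow>
      n \<le> r' \<and> r < r' \<and> W' = W \<inter> (\<phi> ^^ (r' + t)) -` W \<and> t' = t + (r' + t))" for k s s'
  have "\<exists>f. \<forall>k. P k (f k) \<and> Q k (f k) (f (Suc k))"
  proof (rule dependent_nat_choice)
    have "open {y. \<delta> < h y}" by (intro open_Collect_less hcont continuous_on_const)
    then show "\<exists>s. P 0 s" using \<delta>(2) by (auto simp: P_def)
    fix s k assume "P k s"
    then obtain W t r where s: "s = (W, t, r)" "open W" "x \<in> W" unfolding P_def by (cases s) auto
    \<comment> \<open>The actual return time is \<open>q\<close>, which includes the duration
      \<open>t\<close> of the first block. The second summand makes the remaining step
      \<open>q - t\<close> at least \<open>n\<close> and longer than its predecessor.\<close>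
    obtain q where q: "t + max n (Suc r) \<le> q" "(\<phi> ^^ q) x \<in> W"
      using recurrent_return_time[OF cont x s(2,3)] by blast
    define r' where "r' = q - t"
    have r': "n \<le> r'" "r < r'" "r' + t = q" using q(1) by (auto simp: r'_def)
    have "open (W \<inter> (\<phi> ^^ (r' + t)) -` W)"
      by (intro open_Int s open_vimage continuous_funpow cont)
    then have "P (Suc k) (W \<inter> (\<phi> ^^ (r' + t)) -` W, t + (r' + t), r')"
      using s q(2) r'(3) by (simp add: P_def)
    moreover have "Q k s (W \<inter> (\<phi> ^^ (r' + t)) -` W, t + (r' + t), r')"
      using r' s by (simp add: Q_def)
    ultimately show "\<exists>s'. P (Suc k) s' \<and> Q k s s'" by blast
  qed
  then obtain f where f: "\<And>k. P k (f k)" "\<And>k. Q k (f k) (f (Suc k))" by blast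
  define V where "V k = fst (f k)" for k
  define S where "S k = fst (snd (f k))" for k
  define R where "R k = snd (snd (f k))" for k
  define p where "p k = R (Suc k)" for k
  have xV: "x \<in> V k" for k using f(1)[of k] by (simp add: P_def V_def)
  have V0: "V 0 = {y. \<delta> < h y}" and S0: "S 0 = 0" using f(1)[of 0] by (simp_all add: P_def V_def S_def)
  have step: "n \<le> p k" "R k < R (Suc k)" "V (Suc k) = V k \<inter> (\<phi> ^^ (p k + S k)) -` V k"
    "S (Suc k) = S k + (p k + S k)" for k
    using f(2)[of k] by (auto simp: Q_def V_def S_def R_def p_def split: prod.splits)
  have mono: "strict_mono p" unfolding p_def strict_mono_Suc_iff using step(2) by blast
  then have injp: "inj p" by (rule strict_mono_imp_inj_on)
  \<comment> \<open>A step of length \<open>p k\<close> contributes at least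
    \<open>\<mu> * \<delta> / 2 ^ k = 4 / 2 ^ k\<close>, enough for \<open>M\<close> below to
    grow.\<close>
  define \<mu> where "\<mu> = 4 / \<delta>"
  have \<mu>: "0 < \<mu>" "\<mu> * \<delta> = 4" using \<delta> by (simp_all add: \<mu>_def)
  define w where "w i = (if i \<in> range p then \<mu> * (1/2) ^ inv p i else 0)" for i
  have wp: "w (p k) = \<mu> * (1/2) ^ k" for k using injp by (simp add: w_def)
  have w0: "0 \<le> w i" for i using \<mu> by (simp add: w_def)
  have "p k \<noteq> 0" for k using step(1)[of k] n by linarith
  then have "0 \<notin> range p" by (metis imageE)
  then have wz: "w 0 = 0" by (simp add: w_def)
  have wsum: "summable w"
  proof (rule iffD1[OF summable_mono_reindex[OF mono]])
    show "w i = 0" if "i \<notin> range p" for i using that by (simp add: w_def)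
    show "summable (\<lambda>k. w (p k))" unfolding wp by (intro summable_mult summable_geometric) simp
  qed
  define hC where "hC y = complex_of_real (h y)" for y
  have hC: "hC \<in> c0" unfolding hC_def by (rule hc)
  define F where "F i y = complex_of_real (w i) * hC y" for i y
  have Fc0: "F i \<in> c0" for i unfolding F_def by (rule c0_scale[OF hC])
  have F1: "F \<in> ell1"
    unfolding ell1_def mem_Collect_eq
  proof (rule conjI, rule allI, rule Fc0, rule summable_comparison_test'[where N = 0])
    show "summable (\<lambda>i. w i * supnorm hC)" by (rule summable_mult2[OF wsum])
    have "supnorm (F i) \<le> w i * supnorm hC" for i
      using w0[of i] by (intro supnorm_leI) (auto simp: F_def norm_mult intro!: mult_left_mono le_supnorm hC)
    then show "norm (supnorm (F i)) \<le> w i * supnorm hC" for i using supnorm_nonneg[OF Fc0] by simp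
  qed
  define C where "C = cp_rep \<phi> \<rho> F"
  have "C \<in> jacobson_radical \<A>"
    unfolding C_def
  proof (rule cp_rep_in_closed_subspace[OF radical_csubspace radical_closed F1])
    fix i
    have UF: "U i (F i) = complex_of_real (w i) *\<^sub>C U i hC" unfolding F_def by (rule U_scale[OF hC])
    show "U i (F i) \<in> jacobson_radical \<A>"
    proof (cases "i \<in> range p")
      case True
      then show ?thesis
        unfolding UF hC_def using step(1) by (intro csubspace_scaleC[OF radical_csubspace] rad) auto
    next
      case False
      then show ?thesis unfolding UF by (simp add: w_def csubspace_0[OF radical_csubspace])
    qed
  qed
  then obtain D where D: "D \<in> \<A>" "C + D = D o\<^sub>L C" using radical_quasi_regular by blast
  have C: "C \<in> \<A>" unfolding C_def by (rule cp_rep_mem[OF F1])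
  have EC: "E N C = F N" for N unfolding C_def by (rule fourier_coeff_cp_rep[OF rep cont proper inj F1])
  \<comment> \<open>Formally \<open>- D\<close> is \<open>C + C o\<^sub>L C + ...\<close>; the
    coefficients of \<open>C\<close> are real, so real parts satisfy the same recursion.\<close>
  define a where "a N y = - Re (E N D y)" for N y
  have rec: "a N y = w N * h y + (\<Sum>i\<le>N. a (N - i) ((\<phi> ^^ i) y) * (w i * h y))" for N y
  proof -
    have "F N y + E N D y = E N (D o\<^sub>L C) y" unfolding D(2)[symmetric] by (simp add: E_add C D(1) EC)
    also have "\<dots> = (\<Sum>i\<le>N. E (N - i) D ((\<phi> ^^ i) y) * F i y)" by (simp add: E_mult C D(1) EC)
    finally have "Re (F N y + E N D y) = Re (\<Sum>i\<le>N. E (N - i) D ((\<phi> ^^ i) y) * F i y)" by (rule arg_cong)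
    then show ?thesis by (simp add: a_def F_def hC_def sum_negf)
  qed
  \<comment> \<open>Since \<open>w 0 = 0\<close>, \<open>rec\<close> expresses degree
    \<open>N\<close> through lower degrees only.\<close>
  have a0: "0 \<le> a N y" for N y
  proof (induction N arbitrary: y rule: less_induct)
    case (less N)
    have "0 \<le> a (N - i) ((\<phi> ^^ i) y) * (w i * h y)" if "i \<le> N" for i
    proof (cases "i = 0")
      case False
      then show ?thesis using that less w0 h0 by (intro mult_nonneg_nonneg) auto
    qed (simp add: wz)
    then show ?case unfolding rec[of N] using w0 h0 by (intro add_nonneg_nonneg sum_nonneg) auto
  qed
  have terms: "0 \<le> a M z * (w i * h y)" for M z i y by (intro mult_nonneg_nonneg a0 w0 h0)
  have lower1: "w N * h y \<le> a N y" for N y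
    unfolding rec[of N] using sum_nonneg[of "{..N}", OF terms] by simp
  have lower2: "a N ((\<phi> ^^ i) y) * (w i * h y) \<le> a (i + N) y" for N i y
  proof -
    have "a (i + N - i) ((\<phi> ^^ i) y) * (w i * h y) \<le> (\<Sum>j\<le>i + N. a (i + N - j) ((\<phi> ^^ j) y) * (w j * h y))"
      by (rule member_le_sum) (auto intro: terms)
    also have "\<dots> \<le> a (i + N) y" using rec[of "i + N" y] mult_nonneg_nonneg[OF w0 h0, of "i + N" y] by linarith
    finally show ?thesis by simp
  qed
  \<comment> \<open>\<open>M (Suc k)\<close> collects the guaranteed contributions of two blocks of
    stage \<open>k\<close> and of the step \<open>p k\<close> between them.\<close>
  define M where "M = rec_nat 1 (\<lambda>k m. m * m * (4 * (1/2 :: real) ^ k))"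
  have M0: "M 0 = 1" and MS: "M (Suc k) = M k * M k * (4 * (1/2) ^ k)" for k by (simp_all add: M_def)
  have Mge: "2 ^ k \<le> M k" for k
  proof (induction k)
    case (Suc k)
    have "(2 :: real) ^ Suc k \<le> 2 ^ k * 2 ^ k * (4 * (1/2) ^ k)" by (simp add: power_divide)
    also have "\<dots> \<le> M k * M k * (4 * (1/2) ^ k)"
      by (intro mult_right_mono mult_mono Suc) (auto intro: order.trans[OF _ Suc])
    finally show ?case unfolding MS .
  qed (simp add: M0)
  have Mpos: "0 \<le> M k" for k using order.trans[OF _ Mge[of k], of 0] by simp
  have path: "\<delta> < h ((\<phi> ^^ S k) y) \<and> (\<forall>N. M k * a N ((\<phi> ^^ S k) y) \<le> a (S k + N) y)" if "y \<in> V k" for k y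
    using that
  proof (induction k arbitrary: y)
    case 0
    then show ?case by (simp add: V0 S0 M0)
  next
    case (Suc k)
    define y' where "y' = (\<phi> ^^ S k) y"
    define z where "z = (\<phi> ^^ (p k + S k)) y"
    have zy: "z = (\<phi> ^^ p k) y'" by (simp add: z_def y'_def funpow_add)
    have y: "y \<in> V k" and z: "z \<in> V k" using Suc.prems by (auto simp: step(3) z_def)
    have end': "(\<phi> ^^ S (Suc k)) y = (\<phi> ^^ S k) z" by (simp add: step(4) z_def funpow_add)
    have "M (Suc k) * a N ((\<phi> ^^ S (Suc k)) y) \<le> a (S (Suc k) + N) y" for N
    proof -
      have "4 * (1/2) ^ k = w (p k) * \<delta>" using \<mu>(2) by (simp add: wp mult.commute)
      also have "\<dots> \<le> w (p k) * h y'"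
        using Suc.IH[OF y] w0[of "p k"] unfolding y'_def by (intro mult_left_mono) auto
      finally have w: "4 * (1/2) ^ k \<le> w (p k) * h y'" .
      have "M (Suc k) * a N ((\<phi> ^^ S (Suc k)) y) = M k * ((M k * a N ((\<phi> ^^ S k) z)) * (4 * (1/2) ^ k))"
        unfolding MS end' by (simp add: mult_ac)
      also have "\<dots> \<le> M k * (a (S k + N) z * (w (p k) * h y'))"
        using Suc.IH[OF z] by (intro mult_left_mono[OF mult_mono[OF _ w a0]] Mpos) auto
      also have "\<dots> \<le> M k * a (p k + (S k + N)) y'"
        unfolding zy by (intro mult_left_mono lower2 Mpos)
      also have "\<dots> \<le> a (S k + (p k + (S k + N))) y" using Suc.IH[OF y] by (simp add: y'_def)
      also have "S k + (p k + (S k + N)) = S (Suc k) + N" by (simp add: step(4))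
      finally show ?thesis .
    qed
    then show ?case using Suc.IH[OF z] by (simp add: end')
  qed
  have "2 ^ k \<le> norm D" for k
  proof -
    \<comment> \<open>\<open>path\<close> compares with a coefficient at the end of the block; one
      more step \<open>p 0\<close> supplies one that is at least 1.\<close>
    let ?y = "(\<phi> ^^ S k) x"
    have "1 \<le> \<mu> * \<delta>" using \<mu>(2) by simp
    also have "\<dots> \<le> \<mu> * h ?y" using path[OF xV[of k]] \<mu>(1) by (intro mult_left_mono) auto
    also have "\<dots> \<le> a (p 0) ?y" using lower1[of "p 0" ?y] wp[of 0] by simp
    finally have "M k * 1 \<le> M k * a (p 0) ?y" by (rule mult_left_mono[OF _ Mpos])
    also have "\<dots> \<le> a (S k + p 0) x" using path[OF xV[of k]] by blast
    also have "\<dots> \<le> norm D"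
      using abs_Re_le_cmod[of "E (S k + p 0) D x"] E_bound[OF D(1), where m = "S k + p 0" and x = x]
      unfolding a_def by linarith
    finally show ?thesis using Mge[of k] by simp
  qed
  moreover obtain k where "norm D < 2 ^ k" using real_arch_pow[of 2 "norm D"] by auto
  ultimately show False by (meson not_le)
qed

text \<open>The 0-th coefficient is multiplicative at each point. Once its value at \<open>x\<close>
  is scaled to 1, a quasi-inverse with value \<open>d\<close> there would give
  \<open>1 + d = d\<close>.\<close>

lemma radical_coefficient_0:
  assumes A: "A \<in> jacobson_radical \<A>"
  shows "E 0 A x = 0"
proof (rule ccontr)
  assume nz: "E 0 A x \<noteq> 0"
  have AA: "A \<in> \<A>" using A radical_subset by (rule rev_subsetD)
  define B where "B = (1 / E 0 A x) *\<^sub>C A"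
  have B: "B \<in> \<A>" unfolding B_def by (rule csubspace_scaleC[OF sub AA])
  have "B \<in> jacobson_radical \<A>" unfolding B_def by (rule csubspace_scaleC[OF radical_csubspace A])
  then obtain D where D: "D \<in> \<A>" "B + D = D o\<^sub>L B" using radical_quasi_regular by blast
  have EB: "E 0 B x = 1" using nz by (simp add: B_def E_scale AA)
  have "E 0 (B + D) x = E 0 (D o\<^sub>L B) x" unfolding D(2) ..
  then show False by (simp add: E_add E_mult B D(1) EB)
qed

text \<open>\<open>not_radical_of_recurrent\<close> wants one nonnegative function in all degrees
  \<open>p \<ge> n\<close>. Multiplying by \<open>cnj f\<close> on the right makes the coefficient
  nonnegative. Multiplying by \<open>U (p - n) g\<close> on the left raises the degree and brings in
  \<open>g\<close> composed with \<open>\<phi> ^^ n\<close>, whatever \<open>p\<close> is.\<close>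

lemma radical_coefficient_recurrent:
  assumes A: "A \<in> jacobson_radical \<A>" and n: "1 \<le> n" and x: "x \<in> recurrent_points \<phi>"
  shows "E n A x = 0"
proof (rule ccontr)
  assume nz: "E n A x \<noteq> 0"
  define f where "f = E n A"
  have f: "f \<in> c0" unfolding f_def using A radical_subset by (intro E_c0) blast
  obtain g where g: "(\<lambda>y. complex_of_real (g y)) \<in> c0" "\<And>y. 0 \<le> g y" "g ((\<phi> ^^ n) x) = 1"
    using bump[OF open_UNIV UNIV_I] by metis
  define h where "h y = g ((\<phi> ^^ n) y) * (cmod (f y))\<^sup>2" for y
  have hC: "complex_of_real (h y) = complex_of_real (g ((\<phi> ^^ n) y)) * (f y * cnj (f y))" for y
    unfolding h_def of_real_mult by (simp only: complex_norm_square)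
  have ff: "(\<lambda>y. f y * cnj (f y)) \<in> c0" by (intro c0_mult c0_cnj f)
  show False
  proof (rule not_radical_of_recurrent[OF x n])
    show "(\<lambda>y. complex_of_real (h y)) \<in> c0"
      unfolding hC by (intro c0_mult[OF pullback_c0[OF g(1)] ff])
    show "0 \<le> h y" for y by (simp add: h_def g(2))
    show "0 < h x" using nz by (simp add: h_def g(3) f_def)
    fix p assume p: "n \<le> p"
    have "U n f o\<^sub>L U 0 (\<lambda>y. cnj (f y)) \<in> jacobson_radical \<A>"
      unfolding f_def[symmetric]
      by (intro radical_mult_right U_mem c0_cnj f) (simp add: f_def radical_homogeneous[OF A])
    then have "U n (\<lambda>y. f y * cnj (f y)) \<in> jacobson_radical \<A>" by (simp add: U_mult f c0_cnj)
    then have "U (p - n) (\<lambda>y. complex_of_real (g y)) o\<^sub>L U n (\<lambda>y. f y * cnj (f y)) \<in> jacobson_radical \<A>"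
      by (intro radical_mult_left U_mem g)
    then show "U p (\<lambda>y. complex_of_real (h y)) \<in> jacobson_radical \<A>"
      unfolding hC using p by (simp add: U_mult[OF g(1) ff])
  qed
qed

theorem radical_eq:
  "jacobson_radical \<A> = {A \<in> \<A>. (\<forall>x. E 0 A x = 0) \<and> (\<forall>n\<ge>1. \<forall>x\<in>recurrent_points \<phi>. E n A x = 0)}"
proof (intro equalityI subsetI CollectI conjI)
  fix A assume A: "A \<in> jacobson_radical \<A>"
  show "A \<in> \<A>" using A radical_subset by (rule rev_subsetD)
  show "\<forall>x. E 0 A x = 0" using radical_coefficient_0[OF A] by blast
  show "\<forall>n\<ge>1. \<forall>x\<in>recurrent_points \<phi>. E n A x = 0" using radical_coefficient_recurrent[OF A] by blast
next
  fix A assume "A \<in> {A \<in> \<A>. (\<forall>x. E 0 A x = 0) \<and> (\<forall>n\<ge>1. \<forall>x\<in>recurrent_points \<phi>. E n A x = 0)}"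
  then have A: "A \<in> \<A>" and E0: "\<And>x. E 0 A x = 0"
    and En: "\<And>n x. 1 \<le> n \<Longrightarrow> x \<in> recurrent_points \<phi> \<Longrightarrow> E n A x = 0" by blast+
  show "A \<in> jacobson_radical \<A>"
  proof (rule mem_closed_subspace_of_homogeneous[OF radical_csubspace radical_closed A])
    fix n
    show "U n (E n A) \<in> jacobson_radical \<A>"
    proof (cases "n = 0")
      case True
      then have "E n A = (\<lambda>_. 0)" using E0 by auto
      then show ?thesis by (simp add: U_zero csubspace_0[OF radical_csubspace])
    next
      case False
      then show ?thesis using En[of n] by (intro U_in_radical E_c0 A) auto
    qed
  qed
qed

end

theorem theorem1:
  fixes \<phi> :: "'x::t2_space \<Rightarrow> 'x"
    and \<rho> :: "('x \<Rightarrow> complex) \<Rightarrow> 'h::complex_hilbert \<Rightarrow>\<^sub>L 'h"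
  assumes "metrizable_space (euclidean :: 'x topology)"
    and "locally_compact_space (euclidean :: 'x topology)"
    and "continuous_on UNIV \<phi>"
    and "proper_map euclidean euclidean \<phi>"
    and "surj \<phi>"
    and "faithful_star_rep \<rho>"
  shows "jacobson_radical (crossed_product \<phi> \<rho>) =
    {A \<in> crossed_product \<phi> \<rho>.
      (\<forall>x. fourier_coeff \<phi> \<rho> 0 A x = 0) \<and>
      (\<forall>n\<ge>1. \<forall>x\<in>recurrent_points \<phi>. fourier_coeff \<phi> \<rho> n A x = 0)}"
proof -
  interpret metrizable_crossed_product \<phi> \<rho>
    using assms unfolding faithful_star_rep_def by unfold_locales auto
  show ?thesis by (rule radical_eq)
qed

end
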